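(* Let $f=\sum_{v\in I}\alpha(v)\phi v$ be a sum of counting quasimorphisms in normal form, with $I=\mathrm{supp}(\alpha)$ finite and non-empty. (The speed of $T^{-1}$ on $[\phi v]$ then exists for all $v\in I$.) Put $a(I)=\max_{v\in I}\mathrm{sp}_S(T^{-1},[\phi v])$ and $A(I)=\{v\in I\mid \mathrm{sp}_S(T^{-1},[\phi v])=a(I)\}$. Assume: if $A(I)$ contains no $b$-and-$b$ element but does contain a $b$-left (respectively right-$b$) element, then $A(I)$ contains a $b$-left (respectively right-$b$) element of $b$-length bigger than $1$. Then $f$ is speed reduced for $T^{-1}$, i.e. the speed of $T^{-1}$ on $[f]$ exists and $\mathrm{sp}_S(T^{-1},[f])=\max_{v\in I}\mathrm{sp}_S(T^{-1},[\phi v])$.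
   Context: $F_d$ ($d\ge2$) is the free group on $S=\{a_1,\dots,a_d\}$; $a=a_1$, $b=a_2$, $\bar S=S\cup S^{-1}$, $S_b=\bar S\setminus\{b,b^{-1}\}$; elements are reduced words, $|v|_S$ is word length. $T$ is the automorphism $a\mapsto ab$ fixing all other generators. For a reduced word $v\neq e$, $\#v(w)$ is the number of (possibly overlapping) occurrences of $v$ as a contiguous subword of the reduced word $w$; $\phi v=\#v-\#(v^{-1})$. $f_1\sim f_2$ iff $f_1-f_2$ is bounded. $\mathcal{C}(F_d,S)$ is the real span of the (linearly independent) $\#v$, $v\ne e$; for $f=\sum\alpha(v)\#v$, $\|f\|_S=\max\{|v|_S:\alpha(v)\neq0\}$ ($0$ if $f=0$) and $|f|_S=\min\{\|g\|_S:g\in\mathcal{C}(F_d,S),g\sim f\}$. $\mathcal{B}(F_d)$ is the span of the $\phi v$, $\tilde{\mathcal{B}}(F_d)=\mathcal{B}(F_d)/\sim$, $|[f]|_S=|f|_S$. $\mathrm{Out}(F_d)$ acts by $X[f]=[f\circ X^{-1}]$. The speed of $X$ on $[f]$ is $\mathrm{sp}_S(X,[f])=\lim_n|X^n[f]|_S/n$; it exists if this limit exists in $\mathbb{R}$. Every reduced word is uniquely $w=b^{m_0}s_1b^{m_1}\cdots s_kb^{m_k}$ with $k\ge0$, $m_j\in\mathbb{Z}$, $s_j\in S_b$, and $s_j\neq s_{j+1}^{-1}$ whenever $m_j=0$ ($1\le j\le k-1$). Its $b$-length is $k$; $\tau_b(w)=s_1b^{m_1}\cdots s_k$ if $k\geq1$,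 and $\tau_b(w)=\varnothing$ if $k=0$. If $k\ge1$, $w$ is $b$-truncated if $m_0=m_k=0$; $b$-left if $m_0\ne0,m_k=0$; right-$b$ if $m_0=0,m_k\neq0$; $b$-and-$b$ if $m_0,m_k\ne0$. Two words are of one kind if both are $b$-truncated, both $b$-left, both right-$b$, or both $b$-and-$b$; of opposite kind if both are $b$-truncated, both $b$-and-$b$, or one is $b$-left and the other right-$b$. A finite $I\subset F_d\setminus\{e\}$ is in normal form if: (1) $v\in I$, $\tau_b(v)=\varnothing$ imply $v=b$; (2) $v,w\in I$ of one kind with $\tau_b(v)=\tau_b(w)$ imply $v=w$; (3) if $v,w$ are of opposite kind, $\tau_b(v^{-1})=\tau_b(w)$ and $v\in I$, then $w\notin I$. $f=\sum_{v\in I}\alpha(v)\phi v$ (with this representation) is in normal form if $\mathrm{supp}(\alpha)$ is. *)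

theory Defs
  imports Complex_Main "HOL-Algebra.Group"
begin

section \<open>The free group\<close>

text \<open>The letter \<open>(i, True)\<close> stands for the generator \<open>a\<^sub>i\<close> and \<open>(i, False)\<close> for its inverse;
  the generators of rank \<open>d\<close> are those with \<open>i \<in> {1..d}\<close>.\<close>

type_synonym letter = "nat \<times> bool"
type_synonym word = "letter list"

definition linv :: "letter \<Rightarrow> letter" where
  "linv x = (fst x, \<not> snd x)"

definition winv :: "word \<Rightarrow> word" where
  "winv w = rev (map linv w)"

definition reduced :: "word \<Rightarrow> bool" where
  "reduced w \<longleftrightarrow> successively (\<lambda>x y. y \<noteq> linv x) w"

definition push :: "letter \<Rightarrow> word \<Rightarrow> word" where
  "push x w = (case w of [] \<Rightarrow> [x] | y # ys \<Rightarrow> if y = linv x then ys else x # w)"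

definition reduce :: "word \<Rightarrow> word" where
  "reduce w = foldr push w []"

definition free_group :: "nat \<Rightarrow> word monoid" where
  "free_group d = \<lparr>carrier = {w. reduced w \<and> fst ` set w \<subseteq> {1..d}},
                   mult = (\<lambda>u v. reduce (u @ v)), one = []\<rparr>"

abbreviation F :: "nat \<Rightarrow> word set" where
  "F d \<equiv> carrier (free_group d)"

definition gen_a :: letter where "gen_a = (1, True)"
definition gen_b :: letter where "gen_b = (2, True)"

text \<open>The endomorphism of the free group that sends each letter \<open>x\<close> to \<open>s x\<close>.\<close>

definition hom_ext :: "(letter \<Rightarrow> word) \<Rightarrow> word \<Rightarrow> word" where
  "hom_ext s w = reduce (concat (map s w))"

definition twist :: "word \<Rightarrow> word" where
  "twist = hom_ext (\<lambda>x. if x = gen_a then [gen_a, gen_b]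
                        else if x = linv gen_a then [linv gen_b, linv gen_a]
                        else [x])"

definition twist_inv :: "nat \<Rightarrow> word \<Rightarrow> word" where
  "twist_inv d = inv_into (F d) twist"

lemma linv_linv [simp]: "linv (linv x) = x"
  by (simp add: linv_def)

lemma linv_neq [simp]: "linv x \<noteq> x" "x \<noteq> linv x"
  by (simp_all add: linv_def prod_eq_iff)

lemma fst_linv [simp]: "fst (linv x) = fst x"
  by (simp add: linv_def)

lemma reduced_simps [simp]:
  "reduced []"
  "reduced [x]"
  "reduced (x # y # w) \<longleftrightarrow> y \<noteq> linv x \<and> reduced (y # w)"
  by (simp_all add: reduced_def)

lemma reduced_tl: "reduced (x # w) \<Longrightarrow> reduced w"
  by (cases w) auto

lemma reduced_push: "reduced w \<Longrightarrow> reduced (push x w)"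
  by (auto simp: push_def split: list.splits dest: reduced_tl)

lemma push_reduced: "reduced (x # w) \<Longrightarrow> push x w = x # w"
  by (auto simp: push_def split: list.splits)

lemma push_linv_push: "reduced w \<Longrightarrow> push x (push (linv x) w) = w"
  by (cases w rule: list.exhaust; cases "tl w")
     (auto simp: push_def split: list.splits if_splits)

lemma reduced_foldr_push: "reduced v \<Longrightarrow> reduced (foldr push u v)"
  by (induction u) (auto intro: reduced_push)

lemma reduced_reduce [simp]: "reduced (reduce w)"
  by (simp add: reduce_def reduced_foldr_push)

lemma reduce_id: "reduced w \<Longrightarrow> reduce w = w"
proof (induction w)
  case (Cons x w)
  have "reduce (x # w) = push x (reduce w)" by (simp add: reduce_def)
  also have "reduce w = w" using Cons.IH reduced_tl[OF Cons.prems] .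
  finally show ?case using push_reduced[OF Cons.prems] by simp
qed (simp add: reduce_def)

lemma foldr_push_push:
  assumes "reduced v"
  shows "foldr push (push x u) v = push x (foldr push u v)"
proof (cases "\<exists>ys. u = linv x # ys")
  case True
  then obtain ys where "u = linv x # ys" by blast
  then show ?thesis
    using push_linv_push[of "foldr push ys v" x] reduced_foldr_push[OF assms]
    by (simp add: push_def[of x "linv x # ys"])
next
  case False
  then show ?thesis by (auto simp: push_def[of x u] split: list.splits)
qed

lemma foldr_push_reduce:
  "reduced v \<Longrightarrow> foldr push (reduce u) v = foldr push u v"
  by (induction u) (auto simp: reduce_def foldr_push_push)

lemma reduce_reduce_left: "reduce (reduce u @ v) = reduce (u @ v)"
proof -
  have "foldr push (reduce u) (reduce v) = foldr push u (reduce v)"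
    by (rule foldr_push_reduce) simp
  then show ?thesis by (simp add: reduce_def)
qed

lemma reduce_reduce_right: "reduce (u @ reduce v) = reduce (u @ v)"
  using reduce_id[OF reduced_reduce, of v] by (simp add: reduce_def)

lemma set_push: "set (push x w) \<subseteq> insert x (set w)"
  by (auto simp: push_def split: list.splits if_splits)

lemma set_reduce: "set (reduce w) \<subseteq> set w"
proof (induction w)
  case (Cons x w)
  then show ?case using set_push[of x "reduce w"] by (auto simp: reduce_def)
qed (simp add: reduce_def)

lemma winv_simps [simp]:
  "winv [] = []" "winv (x # w) = winv w @ [linv x]" "winv (winv w) = w"
  "length (winv w) = length w" "set (winv w) = linv ` set w"
  by (simp_all add: winv_def rev_map o_def)

lemma reduced_winv:
  assumes "reduced w"
  shows "reduced (winv w)"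
proof -
  have "successively (\<lambda>y x. y \<noteq> linv x) (map linv w)"
    using assms unfolding reduced_def successively_map
    by (rule successively_mono) (auto simp: linv_def prod_eq_iff)
  then show ?thesis by (simp add: reduced_def winv_def successively_rev)
qed

lemma foldr_push_winv: "reduced w \<Longrightarrow> foldr push (winv w) w = []"
proof (induction w)
  case (Cons x w)
  have "push (linv x) (x # w) = w" by (simp add: push_def)
  with Cons show ?case by (auto dest: reduced_tl)
qed simp

lemma F_iff: "w \<in> F d \<longleftrightarrow> reduced w \<and> fst ` set w \<subseteq> {1..d}"
  by (simp add: free_group_def)

lemma reduce_in_F: "fst ` set w \<subseteq> {1..d} \<Longrightarrow> reduce w \<in> F d"
  using set_reduce[of w] by (auto simp: F_iff)

lemma winv_in_F: "w \<in> F d \<Longrightarrow> winv w \<in> F d"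
  by (auto simp: F_iff reduced_winv image_image)

lemma group_free_group: "group (free_group d)"
proof (rule groupI)
  fix u v assume "u \<in> F d" "v \<in> F d"
  then show "u \<otimes>\<^bsub>free_group d\<^esub> v \<in> F d"
    using reduce_in_F[of "u @ v" d] by (auto simp: free_group_def)
next
  fix u v w
  show "u \<otimes>\<^bsub>free_group d\<^esub> v \<otimes>\<^bsub>free_group d\<^esub> w = u \<otimes>\<^bsub>free_group d\<^esub> (v \<otimes>\<^bsub>free_group d\<^esub> w)"
    by (simp add: free_group_def reduce_reduce_left reduce_reduce_right)
next
  fix w assume w: "w \<in> F d"
  then have "reduce (winv w @ w) = []"
    using foldr_push_winv[of w] reduce_id[of w] by (simp add: F_iff reduce_def)
  then show "\<exists>v\<in>F d. v \<otimes>\<^bsub>free_group d\<^esub> w = \<one>\<^bsub>free_group d\<^esub>"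
    using winv_in_F[OF w] by (intro bexI[of _ "winv w"]) (simp_all add: free_group_def)
qed (auto simp: free_group_def reduce_id)

lemma reduce_concat_map_reduce:
  assumes s: "\<And>x. s (linv x) = winv (s x)" and red: "\<And>x. reduced (s x)"
  shows "reduce (concat (map s (reduce w))) = reduce (concat (map s w))"
proof -
  have push: "reduce (concat (map s (push x u))) = reduce (s x @ concat (map s u))" for x u
  proof (cases "\<exists>ys. u = linv x # ys")
    case True
    then obtain ys where u: "u = linv x # ys" by blast
    have "foldr push (winv (winv (s x))) (winv (s x)) = []"
      by (rule foldr_push_winv) (simp add: red reduced_winv)
    then have "reduce (s x @ winv (s x)) = []"
      using reduce_id[of "winv (s x)"] by (simp add: reduce_def red reduced_winv)
    then show ?thesis
      using reduce_reduce_left[of "s x @ winv (s x)" "concat (map s ys)"]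
      by (simp add: u push_def s)
  next
    case False
    then show ?thesis by (auto simp: push_def split: list.splits)
  qed
  show ?thesis
  proof (induction w)
    case (Cons x w)
    have "reduce (concat (map s (reduce (x # w)))) = reduce (s x @ concat (map s (reduce w)))"
      using push[of x "reduce w"] by (simp add: reduce_def)
    also have "\<dots> = reduce (s x @ reduce (concat (map s (reduce w))))"
      by (simp add: reduce_reduce_right)
    also have "\<dots> = reduce (concat (map s (x # w)))"
      by (simp add: Cons reduce_reduce_right)
    finally show ?case .
  qed (simp add: reduce_def)
qed

lemma twist_iso:
  assumes "2 \<le> d"
  shows "twist \<in> iso (free_group d) (free_group d)"
proof -
  define s where "s = (\<lambda>x. if x = gen_a then [gen_a, gen_b]
    else if x = linv gen_a then [linv gen_b, linv gen_a] else [x])"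
  define t where "t = (\<lambda>x. if x = gen_a then [gen_a, linv gen_b]
    else if x = linv gen_a then [gen_b, linv gen_a] else [x])"
  have ab: "gen_a \<noteq> gen_b" "linv gen_a \<noteq> gen_b" "gen_a \<noteq> linv gen_b" "linv gen_a \<noteq> linv gen_b"
    "gen_b \<noteq> gen_a" "gen_b \<noteq> linv gen_a" "linv gen_b \<noteq> gen_a" "linv gen_b \<noteq> linv gen_a"
    by (auto simp: gen_a_def gen_b_def linv_def)
  have s: "s (linv x) = winv (s x)" "reduced (s x)"
    and t: "t (linv x) = winv (t x)" "reduced (t x)" for x
    by (auto simp: s_def t_def gen_a_def gen_b_def linv_def winv_def prod_eq_iff)
  have F: "hom_ext r w \<in> F d" if "w \<in> F d" "r = s \<or> r = t" for r w
  proof -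
    have "fst ` set (r x) \<subseteq> {1..d}" if "fst x \<in> {1..d}" for x
      using that \<open>r = s \<or> r = t\<close> assms
      by (auto simp: s_def t_def gen_a_def gen_b_def linv_def split: if_splits)
    moreover have "fst x \<in> {1..d}" if "x \<in> set w" for x
      using \<open>w \<in> F d\<close> that unfolding F_iff by blast
    ultimately have "fst ` set (concat (map r w)) \<subseteq> {1..d}"
      unfolding set_concat set_map by blast
    then show ?thesis unfolding hom_ext_def by (rule reduce_in_F)
  qed
  have comp: "hom_ext q (hom_ext r w) = w"
    if w: "w \<in> F d" and qr: "q = s \<and> r = t \<or> q = t \<and> r = s" for q r w
  proof -
    have letter: "reduce (concat (map q (r x))) = [x]" for x
      using qr ab by (auto simp: s_def t_def reduce_def push_def)
    have "hom_ext q (hom_ext r w) = reduce (concat (map q (concat (map r w))))"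
      unfolding hom_ext_def using s t qr by (intro reduce_concat_map_reduce) auto
    also have "\<dots> = reduce w"
    proof (induction w)
      case (Cons x w)
      have "reduce (concat (map q (concat (map r (x # w))))) =
        reduce (reduce (concat (map q (r x))) @ reduce (concat (map q (concat (map r w)))))"
        by (simp add: reduce_reduce_left reduce_reduce_right)
      also have "\<dots> = reduce (x # w)"
        using reduce_reduce_right[of "[x]" w] by (simp add: letter Cons)
      finally show ?case .
    qed simp
    finally show ?thesis using w by (simp add: F_iff reduce_id)
  qed
  have twist: "twist = hom_ext s" by (simp add: twist_def s_def)
  have "twist \<in> hom (free_group d) (free_group d)"
  proof (rule homI)
    fix u v
    have "hom_ext s (reduce (u @ v)) = reduce (hom_ext s u @ hom_ext s v)"
      unfolding hom_ext_def
      by (simp add: reduce_concat_map_reduce s reduce_reduce_left reduce_reduce_right)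
    then show "twist (u \<otimes>\<^bsub>free_group d\<^esub> v) = twist u \<otimes>\<^bsub>free_group d\<^esub> twist v"
      by (simp add: twist free_group_def)
  qed (simp add: twist F)
  moreover have "bij_betw twist (F d) (F d)"
    by (rule bij_betwI[where g = "hom_ext t"]) (auto simp: twist F comp)
  ultimately show ?thesis by (simp add: iso_def)
qed


section \<open>Counting functions and quasimorphisms\<close>

definition occ :: "word \<Rightarrow> word \<Rightarrow> nat" where
  "occ v w = card {(x, y). w = x @ v @ y}"

definition phi :: "word \<Rightarrow> word \<Rightarrow> real" where
  "phi v w = real (occ v w) - real (occ (winv v) w)"

text \<open>Only values on \<open>F d\<close> matter for functions on words.\<close>

definition bdd_equiv :: "nat \<Rightarrow> (word \<Rightarrow> real) \<Rightarrow> (word \<Rightarrow> real) \<Rightarrow> bool" where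
  "bdd_equiv d f g \<longleftrightarrow> (\<exists>M. \<forall>w\<in>F d. \<bar>f w - g w\<bar> \<le> M)"

definition bdd_class :: "nat \<Rightarrow> (word \<Rightarrow> real) \<Rightarrow> (word \<Rightarrow> real) set" where
  "bdd_class d f = {g. bdd_equiv d f g}"

definition coefficients :: "nat \<Rightarrow> (word \<Rightarrow> real) set" where
  "coefficients d = {\<alpha>. finite {v. \<alpha> v \<noteq> 0} \<and> {v. \<alpha> v \<noteq> 0} \<subseteq> F d - {[]}}"

definition represents :: "nat \<Rightarrow> (word \<Rightarrow> real) \<Rightarrow> (word \<Rightarrow> real) \<Rightarrow> bool" where
  "represents d \<alpha> f \<longleftrightarrow>
     \<alpha> \<in> coefficients d \<and> (\<forall>w\<in>F d. f w = (\<Sum>v\<in>{v. \<alpha> v \<noteq> 0}. \<alpha> v * real (occ v w)))"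

text \<open>\<open>\<C>(F\<^sub>d, S)\<close>, \<open>\<parallel>f\<parallel>\<^sub>S\<close> and \<open>|c|\<^sub>S\<close>. The coefficients of \<open>f\<close> are unique by
  \<open>represents_unique\<close> below; the infimum is a minimum, taken in \<open>nat\<close>, whenever the class
  meets \<open>\<C>(F\<^sub>d, S)\<close>.\<close>

definition counting_space :: "nat \<Rightarrow> (word \<Rightarrow> real) set" where
  "counting_space d = {f. \<exists>\<alpha>. represents d \<alpha> f}"

definition counting_norm :: "nat \<Rightarrow> (word \<Rightarrow> real) \<Rightarrow> nat" where
  "counting_norm d f = (let \<alpha> = (THE \<alpha>. represents d \<alpha> f)
                        in Max (insert 0 (length ` {v. \<alpha> v \<noteq> 0})))"

definition class_norm :: "nat \<Rightarrow> (word \<Rightarrow> real) set \<Rightarrow> nat" where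
  "class_norm d c = Inf (counting_norm d ` (c \<inter> counting_space d))"

lemma finite_occ: "finite {(x, y). w = x @ v @ y}"
proof (rule finite_subset)
  show "{(x, y). w = x @ v @ y} \<subseteq> (\<lambda>n. (take n w, drop (n + length v) w)) ` {..length w}"
  proof
    fix p assume "p \<in> {(x, y). w = x @ v @ y}"
    then show "p \<in> (\<lambda>n. (take n w, drop (n + length v) w)) ` {..length w}"
      by (intro image_eqI[of _ _ "length (fst p)"]) auto
  qed
qed simp

lemma occ_self: "occ v v = 1"
proof -
  have "{(x, y). v = x @ v @ y} = {([], [])}"
    by (auto dest: arg_cong[where f = length])
  then show ?thesis by (simp add: occ_def)
qed

lemma occ_eq_0:
  assumes "length v \<le> length u" "u \<noteq> v"
  shows "occ u v = 0"
proof -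
  have "{(x, y). v = x @ u @ y} = {}"
  proof (rule ccontr)
    assume "{(x, y). v = x @ u @ y} \<noteq> {}"
    then obtain x y where v: "v = x @ u @ y" by auto
    then have "length x = 0" "length y = 0" using assms(1) by auto
    with v assms(2) show False by simp
  qed
  then show ?thesis by (simp only: occ_def card.empty)
qed

lemma represents_unique:
  assumes "represents d \<alpha> f" "represents d \<beta> f"
  shows "\<alpha> = \<beta>"
proof (rule ccontr)
  assume "\<alpha> \<noteq> \<beta>"
  define U where "U = {v. \<alpha> v \<noteq> 0} \<union> {v. \<beta> v \<noteq> 0}"
  have U: "finite U" "U \<subseteq> F d"
    using assms by (auto simp: U_def represents_def coefficients_def)
  obtain v0 where v0: "\<alpha> v0 \<noteq> \<beta> v0" using \<open>\<alpha> \<noteq> \<beta>\<close> by blast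
  define v where "v = arg_min length (\<lambda>v. \<alpha> v \<noteq> \<beta> v)"
  have v: "\<alpha> v \<noteq> \<beta> v" and min: "\<And>u. \<alpha> u \<noteq> \<beta> u \<Longrightarrow> length v \<le> length u"
    unfolding v_def using arg_min_nat_lemma[of "\<lambda>v. \<alpha> v \<noteq> \<beta> v" v0 length] v0 by auto
  have vU: "v \<in> U" using v by (auto simp: U_def)
  have val: "(\<Sum>u\<in>U. \<gamma> u * real (occ u v)) = f v"
    if "represents d \<gamma> f" "{v. \<gamma> v \<noteq> 0} \<subseteq> U" for \<gamma>
  proof -
    have "(\<Sum>u\<in>U. \<gamma> u * real (occ u v)) = (\<Sum>u\<in>{v. \<gamma> v \<noteq> 0}. \<gamma> u * real (occ u v))"
      using that U by (intro sum.mono_neutral_right) auto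
    then show ?thesis using that(1) vU U by (auto simp: represents_def)
  qed
  have "(\<Sum>u\<in>U. (\<alpha> u - \<beta> u) * real (occ u v)) = 0"
    using val[OF assms(1)] val[OF assms(2)]
    by (simp add: left_diff_distrib sum_subtractf U_def)
  moreover have "(\<Sum>u\<in>U. (\<alpha> u - \<beta> u) * real (occ u v)) =
      (\<Sum>u\<in>{v}. (\<alpha> u - \<beta> u) * real (occ u v))"
    using U vU min by (intro sum.mono_neutral_right) (auto, metis occ_eq_0 less_irrefl)
  ultimately show False using v by (simp add: occ_self)
qed


section \<open>Action of automorphisms and speed\<close>

text \<open>\<open>X[f] = [f \<circ> X\<^sup>-\<^sup>1]\<close>, where the automorphism \<open>X\<close> stands for its outer class (inner
  automorphisms fix the class of every counting quasimorphism). The result is the full class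
  modulo bounded functions, since \<open>f \<circ> X\<^sup>-\<^sup>1\<close> need not itself be a sum of counting
  quasimorphisms.\<close>

definition class_act ::
    "nat \<Rightarrow> (word \<Rightarrow> word) \<Rightarrow> (word \<Rightarrow> real) set \<Rightarrow> (word \<Rightarrow> real) set" where
  "class_act d X c = (\<Union>f\<in>c. bdd_class d (f \<circ> inv_into (F d) X))"

lemma bdd_equiv_trans: "bdd_equiv d f g \<Longrightarrow> bdd_equiv d g h \<Longrightarrow> bdd_equiv d f h"
  unfolding bdd_equiv_def
proof (elim exE)
  fix M N
  assume "\<forall>w\<in>F d. \<bar>f w - g w\<bar> \<le> M" "\<forall>w\<in>F d. \<bar>g w - h w\<bar> \<le> N"
  then have "\<forall>w\<in>F d. \<bar>f w - h w\<bar> \<le> M + N" by fastforce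
  then show "\<exists>M. \<forall>w\<in>F d. \<bar>f w - h w\<bar> \<le> M" by blast
qed

lemma class_act_bdd_class:
  assumes "X \<in> iso (free_group d) (free_group d)"
  shows "class_act d X (bdd_class d f) = bdd_class d (f \<circ> inv_into (F d) X)"
proof -
  have "inv_into (F d) X w \<in> F d" if "w \<in> F d" for w
    using assms that by (auto simp: iso_def bij_betw_def intro: inv_into_into)
  then have "bdd_equiv d (f \<circ> inv_into (F d) X) (g \<circ> inv_into (F d) X)" if "bdd_equiv d f g" for g
    using that by (auto simp: bdd_equiv_def)
  moreover have "bdd_equiv d f f" by (auto simp: bdd_equiv_def)
  ultimately show ?thesis
    unfolding class_act_def bdd_class_def by (blast intro: bdd_equiv_trans)
qed

definition speed_seq :: "nat \<Rightarrow> (word \<Rightarrow> word) \<Rightarrow> (word \<Rightarrow> real) set \<Rightarrow> nat \<Rightarrow> real" where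
  "speed_seq d X c n = real (class_norm d ((class_act d X ^^ n) c)) / real n"

definition speed_exists :: "nat \<Rightarrow> (word \<Rightarrow> word) \<Rightarrow> (word \<Rightarrow> real) set \<Rightarrow> bool" where
  "speed_exists d X c \<longleftrightarrow> convergent (speed_seq d X c)"

definition speed :: "nat \<Rightarrow> (word \<Rightarrow> word) \<Rightarrow> (word \<Rightarrow> real) set \<Rightarrow> real" where
  "speed d X c = lim (speed_seq d X c)"


section \<open>Normal form\<close>

definition bpow :: "int \<Rightarrow> word" where
  "bpow m = replicate (nat \<bar>m\<bar>) (if 0 \<le> m then gen_b else linv gen_b)"

text \<open>\<open>b_decomp w m0 [(s\<^sub>1, m\<^sub>1), \<dots>, (s\<^sub>k, m\<^sub>k)]\<close> says that \<open>w = b\<^sup>m\<^sup>0 s\<^sub>1 b\<^sup>m\<^sup>1 \<cdots> s\<^sub>k b\<^sup>m\<^sup>k\<close>.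
  If \<open>w \<in> F d\<close>, the \<open>s\<^sub>j\<close> are automatically letters of rank \<open>d\<close>.\<close>

definition b_decomp :: "word \<Rightarrow> int \<Rightarrow> (letter \<times> int) list \<Rightarrow> bool" where
  "b_decomp w m0 xs \<longleftrightarrow>
     w = bpow m0 @ concat (map (\<lambda>(s, m). s # bpow m) xs) \<and>
     (\<forall>(s, m)\<in>set xs. s \<noteq> gen_b \<and> s \<noteq> linv gen_b) \<and>
     successively (\<lambda>(s, m) (s', m'). m = 0 \<longrightarrow> s \<noteq> linv s') xs"

definition b_first :: "word \<Rightarrow> int" where
  "b_first w = fst (THE (m0, xs). b_decomp w m0 xs)"

definition b_syllables :: "word \<Rightarrow> (letter \<times> int) list" where
  "b_syllables w = snd (THE (m0, xs). b_decomp w m0 xs)"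

definition b_length :: "word \<Rightarrow> nat" where
  "b_length w = length (b_syllables w)"

definition b_last :: "word \<Rightarrow> int" where
  "b_last w = snd (last (b_syllables w))"

text \<open>\<open>s\<^sub>1 b\<^sup>m\<^sup>1 \<cdots> s\<^sub>k\<close>; the value \<open>[]\<close> for \<open>k = 0\<close> encodes \<open>\<emptyset>\<close>.\<close>

definition tau_b :: "word \<Rightarrow> word" where
  "tau_b w = (let xs = b_syllables w in
     if xs = [] then []
     else concat (map (\<lambda>(s, m). s # bpow m) (butlast xs)) @ [fst (last xs)])"

definition b_truncated :: "word \<Rightarrow> bool" where
  "b_truncated w \<longleftrightarrow> 1 \<le> b_length w \<and> b_first w = 0 \<and> b_last w = 0"

definition b_left :: "word \<Rightarrow> bool" where
  "b_left w \<longleftrightarrow> 1 \<le> b_length w \<and> b_first w \<noteq> 0 \<and> b_last w = 0"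

definition right_b :: "word \<Rightarrow> bool" where
  "right_b w \<longleftrightarrow> 1 \<le> b_length w \<and> b_first w = 0 \<and> b_last w \<noteq> 0"

definition b_and_b :: "word \<Rightarrow> bool" where
  "b_and_b w \<longleftrightarrow> 1 \<le> b_length w \<and> b_first w \<noteq> 0 \<and> b_last w \<noteq> 0"

definition one_kind :: "word \<Rightarrow> word \<Rightarrow> bool" where
  "one_kind v w \<longleftrightarrow> b_truncated v \<and> b_truncated w \<or> b_left v \<and> b_left w \<or>
     right_b v \<and> right_b w \<or> b_and_b v \<and> b_and_b w"

definition opposite_kind :: "word \<Rightarrow> word \<Rightarrow> bool" where
  "opposite_kind v w \<longleftrightarrow> b_truncated v \<and> b_truncated w \<or> b_and_b v \<and> b_and_b w \<or>
     b_left v \<and> right_b w \<or> right_b v \<and> b_left w"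

definition normal_form :: "nat \<Rightarrow> word set \<Rightarrow> bool" where
  "normal_form d I \<longleftrightarrow> finite I \<and> I \<subseteq> F d - {[]} \<and>
     (\<forall>v\<in>I. tau_b v = [] \<longrightarrow> v = [gen_b]) \<and>
     (\<forall>v\<in>I. \<forall>w\<in>I. one_kind v w \<and> tau_b v = tau_b w \<longrightarrow> v = w) \<and>
     (\<forall>v w. opposite_kind v w \<and> tau_b (winv v) = tau_b w \<and> v \<in> I \<longrightarrow> w \<notin> I)"

lemma bpow_simps:
  "bpow 0 = []"
  "0 \<le> m \<Longrightarrow> bpow (m + 1) = gen_b # bpow m"
  "m \<le> 0 \<Longrightarrow> bpow (m - 1) = linv gen_b # bpow m"
proof -
  show "bpow 0 = []" by (simp add: bpow_def)
  show "bpow (m + 1) = gen_b # bpow m" if "0 \<le> m"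
    using that by (simp add: bpow_def nat_add_distrib)
  show "bpow (m - 1) = linv gen_b # bpow m" if "m \<le> 0"
  proof -
    have "nat \<bar>m - 1\<bar> = Suc (nat \<bar>m\<bar>)" using that by arith
    then show ?thesis using that by (cases "m = 0") (simp_all add: bpow_def)
  qed
qed

lemma bpow_inj:
  assumes "bpow m = bpow n"
  shows "m = n"
proof -
  have "nat \<bar>m\<bar> = nat \<bar>n\<bar>"
    using arg_cong[OF assms, of length] by (simp add: bpow_def)
  moreover have "m = n" if "m = - n"
  proof (rule ccontr)
    assume "m \<noteq> n"
    with that have "(if 0 \<le> m then gen_b else linv gen_b) \<noteq> (if 0 \<le> n then gen_b else linv gen_b)"
      "nat \<bar>m\<bar> \<noteq> 0" by auto
    with assms show False by (auto simp: bpow_def replicate_eq_replicate)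
  qed
  ultimately show ?thesis by linarith
qed

lemma b_decomp_unique:
  assumes "b_decomp w m0 xs" "b_decomp w n0 ys"
  shows "m0 = n0 \<and> xs = ys"
proof -
  define body where "body = (\<lambda>xs :: (letter \<times> int) list. concat (map (\<lambda>(s, m). s # bpow m) xs))"
  define good where
    "good = (\<lambda>xs :: (letter \<times> int) list. \<forall>(s, m)\<in>set xs. s \<noteq> gen_b \<and> s \<noteq> linv gen_b)"
  let ?B = "\<lambda>x. x = gen_b \<or> x = linv gen_b"
  have split: "takeWhile ?B (bpow m @ body xs) = bpow m"
    "dropWhile ?B (bpow m @ body xs) = body xs" if "good xs" for m xs
  proof -
    have "\<forall>x\<in>set (bpow m). ?B x" by (auto simp: bpow_def)
    moreover have "takeWhile ?B (body xs) = []" "dropWhile ?B (body xs) = body xs"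
      using that by (cases xs; auto simp: body_def good_def)+
    ultimately show "takeWhile ?B (bpow m @ body xs) = bpow m"
      "dropWhile ?B (bpow m @ body xs) = body xs"
      by (simp_all add: takeWhile_append2 dropWhile_append2)
  qed
  have unique: "m = n \<and> xs = ys"
    if "bpow m @ body xs = bpow n @ body ys" "good xs" "good ys" for m n xs ys
    using that
  proof (induction xs arbitrary: m n ys)
    case Nil
    have b: "body [] = body ys" and m: "bpow m = bpow n"
      using arg_cong[OF Nil.prems(1), of "takeWhile ?B"] arg_cong[OF Nil.prems(1), of "dropWhile ?B"]
      unfolding split[OF Nil.prems(2)] split[OF Nil.prems(3)] by -
    have "ys = []"
    proof (cases ys)
      case (Cons y zs)
      with b show ?thesis unfolding body_def by (cases y) simp
    qed
    with bpow_inj[OF m] show ?case by simp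
  next
    case (Cons x xs)
    have b: "body (x # xs) = body ys" and m: "bpow m = bpow n"
      using arg_cong[OF Cons.prems(1), of "takeWhile ?B"] arg_cong[OF Cons.prems(1), of "dropWhile ?B"]
      unfolding split[OF Cons.prems(2)] split[OF Cons.prems(3)] by -
    obtain s k where x: "x = (s, k)" by (cases x)
    obtain t l zs where ys: "ys = (t, l) # zs"
    proof (cases ys)
      case Nil
      with b show ?thesis by (simp add: body_def x)
    next
      case (Cons y zs)
      then show ?thesis using that by (cases y) simp
    qed
    have "s # bpow k @ body xs = t # bpow l @ body zs"
      using b unfolding body_def x ys by simp
    then have st: "s = t" and "bpow k @ body xs = bpow l @ body zs" by blast+
    moreover have "good xs" "good zs"
      using Cons.prems unfolding good_def ys by simp_all
    ultimately have "k = l \<and> xs = zs" by (intro Cons.IH)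
    with st bpow_inj[OF m] show ?case unfolding x ys by blast
  qed
  have "w = bpow m0 @ body xs" "w = bpow n0 @ body ys" "good xs" "good ys"
    using assms unfolding b_decomp_def body_def good_def by blast+
  then show ?thesis by (intro unique) simp_all
qed

lemma b_decomp_ex: "reduced w \<Longrightarrow> \<exists>m0 xs. b_decomp w m0 xs"
proof (induction w)
  case Nil
  have "b_decomp [] 0 []" by (simp add: b_decomp_def bpow_simps)
  then show ?case by blast
next
  case (Cons x w)
  then obtain m xs where d: "b_decomp w m xs" using reduced_tl by blast
  have hd: "w = [] \<or> hd w \<noteq> linv x" using Cons.prems by (cases w) auto
  have w: "w = bpow m @ concat (map (\<lambda>(s, m). s # bpow m) xs)"
    using d by (simp add: b_decomp_def)
  consider "x = gen_b" | "x = linv gen_b" | "x \<noteq> gen_b" "x \<noteq> linv gen_b" by blast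
  then show ?case
  proof cases
    case 1
    have "0 \<le> m"
    proof (rule ccontr)
      assume "\<not> 0 \<le> m"
      then have "bpow m = linv gen_b # bpow (m + 1)" using bpow_simps(3)[of "m + 1"] by simp
      with hd w 1 show False by simp
    qed
    then have "b_decomp (x # w) (m + 1) xs"
      using d 1 by (simp add: b_decomp_def bpow_simps)
    then show ?thesis by blast
  next
    case 2
    have "m \<le> 0"
    proof (rule ccontr)
      assume "\<not> m \<le> 0"
      then have "bpow m = gen_b # bpow (m - 1)" using bpow_simps(2)[of "m - 1"] by simp
      with hd w 2 show False by simp
    qed
    then have "b_decomp (x # w) (m - 1) xs"
      using d 2 by (simp add: b_decomp_def bpow_simps)
    then show ?thesis by blast
  next
    case 3
    have "x \<noteq> linv s" if "m = 0" "xs = (s, k) # zs" for s k zs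
      using hd that by (auto simp: w bpow_simps)
    then have "b_decomp (x # w) 0 ((x, m) # xs)"
      using d 3 by (cases xs) (auto simp: b_decomp_def bpow_simps)
    then show ?thesis by blast
  qed
qed

lemma b_decomp_the:
  assumes "b_decomp w m0 xs"
  shows "b_first w = m0" "b_syllables w = xs"
proof -
  have "(THE (m0, xs). b_decomp w m0 xs) = (m0, xs)"
  proof (rule the_equality)
    show "case (m0, xs) of (m0, xs) \<Rightarrow> b_decomp w m0 xs" using assms by simp
    fix p assume "case p of (m0, xs) \<Rightarrow> b_decomp w m0 xs"
    then show "p = (m0, xs)" using b_decomp_unique[OF _ assms] by (cases p) blast
  qed
  then show "b_first w = m0" "b_syllables w = xs"
    by (simp_all add: b_first_def b_syllables_def)
qed

end

theory Submission
  imports Defs "HOL-Library.Sublist"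
begin

text \<open>Write \<open>T\<close> for the twist. On a reduced word \<open>b\<^sup>m\<^sup>0 s\<^sub>1 b\<^sup>m\<^sup>1 \<cdots> s\<^sub>k b\<^sup>m\<^sup>k\<close> the power \<open>T\<^sup>n\<close>
only moves exponents: the block of \<open>b\<close> between \<open>s\<close> and \<open>t\<close> gains \<open>n\<close> if \<open>s = a\<close>, loses \<open>n\<close>
if \<open>t = a\<^sup>-\<^sup>1\<close>, and the letters \<open>s\<^sub>i\<close> never cancel (\<open>twist_pow_split\<close>, \<open>twist_pow_core\<close>). Call
the number of inner blocks of \<open>v\<close> that move, plus one for each end of \<open>v\<close> that carries a power of
\<open>b\<close>, the shear speed of \<open>v\<close>. It turns out to be the speed of \<open>T\<^sup>-\<^sup>1\<close> on \<open>[\<phi> v]\<close>, and everything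
reduces to estimating the length of \<open>f \<circ> T\<^sup>n\<close> from both sides up to a constant.

Upper bound (\<open>len_le_occ_twist_pow\<close>). An occurrence of \<open>v\<close> in \<open>T\<^sup>n w\<close> is an occurrence in \<open>w\<close> of
the core \<open>s\<^sub>1 b\<^sup>m\<^sup>1 \<cdots> s\<^sub>k\<close> with its blocks moved back, which has length
\<open>n\<close> times the number of moving blocks up to a constant. A power of \<open>b\<close> at an end of \<open>v\<close>
adds a condition on the neighbouring block of \<open>w\<close> that is decided by \<open>n + O(1)\<close> letters. So counting
\<open>v\<close> in \<open>T\<^sup>n w\<close> means counting words whose length is the shear speed times \<open>n\<close>, up to a constant.

Lower bound (\<open>not_len_le\<close>). Words of length at most \<open>|x| + 1\<close> cannot see which \<open>p\<^sub>i\<close> in front of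
\<open>x\<close> belongs to which \<open>q\<^sub>j\<close> behind it. Hence they are counted equally in the periodic words
with periods \<open>p\<^sub>1 x q\<^sub>1 y p\<^sub>2 x q\<^sub>2 y\<close> and \<open>p\<^sub>1 x q\<^sub>2 y p\<^sub>2 x q\<^sub>1 y\<close>. The images of these words
under \<open>T\<^sup>n\<close> are periodic again. If \<open>x\<close> comes from the inside of some \<open>v\<close> by moving the blocks back, then
this inside stands between the images of \<open>p\<^sub>i\<close> and \<open>q\<^sub>j\<close>, and the occurrences of \<open>v\<close>, a word of
fixed length, depend on both sides, no matter how long \<open>x\<close> is. The values of \<open>f\<close> on the images then
drift apart, as soon as the alternating sum of \<open>f\<close> over the four combinations does not vanish. Only
occurrences that reach from \<open>p\<^sub>i\<close> to \<open>q\<^sub>j\<close> contribute to this sum (\<open>cross_product\<close>).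

The normal form ensures that for a well chosen \<open>v\<close> among the elements of maximal speed nothing else
contributes. Elements of smaller speed are discarded by the upper bound (\<open>lower_bd_add\<close>). If a
b-and-b element exists, long blocks of \<open>b\<close> of both signs on both sides isolate it. If not,
a b-left element of b-length greater than one is isolated by long blocks on its left and by
a change of its last inner block; a right-b element is an inverse of a b-left one. If all elements are
truncated, changes of the first and the last inner block isolate any of them. A b-left
element \<open>b\<^sup>m s\<close> has no inner block to change, so that the block in front of \<open>s\<close> has to serve
both sides. This is where right-b elements \<open>s' b\<^sup>l\<close> can interfere, and it explains the assumption on
the b-length. For a single \<open>\<phi> v\<close> only the inverse of \<open>v\<close> could interfere, which it does not
(\<open>lower_bd_b_left_1\<close>).\<close>

section \<open>Words, inverses and reduction\<close>

abbreviation a :: letter where "a \<equiv> gen_a"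
abbreviation a' :: letter where "a' \<equiv> linv gen_a"
abbreviation b :: letter where "b \<equiv> gen_b"

definition nonb :: "letter \<Rightarrow> bool" where "nonb s \<longleftrightarrow> s \<noteq> gen_b \<and> s \<noteq> linv gen_b"

lemma letters_simps [simp]:
  "a \<noteq> a'" "a' \<noteq> a" "a \<noteq> b" "b \<noteq> a" "a' \<noteq> b" "b \<noteq> a'"
  "a \<noteq> linv b" "linv b \<noteq> a" "a' \<noteq> linv b" "linv b \<noteq> a'" "nonb a" "nonb a'"
  "\<not> nonb b" "\<not> nonb (linv b)"
  by (auto simp: gen_a_def gen_b_def linv_def nonb_def)

lemma linv_eq_iff [simp]: "linv x = linv y \<longleftrightarrow> x = y"
  by (metis linv_linv)

lemma nonb_linv [simp]: "nonb (linv s) \<longleftrightarrow> nonb s"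
  by (metis linv_linv nonb_def)

lemma nonbD:
  assumes "nonb s"
  shows "s \<noteq> b" "s \<noteq> linv b" "linv s \<noteq> b" "linv s \<noteq> linv b"
    "b \<noteq> s" "linv b \<noteq> s" "b \<noteq> linv s" "linv b \<noteq> linv s"
  using assms nonb_linv[of s] by (auto simp: nonb_def)

lemma reduced_append:
  "reduced (u @ v) \<longleftrightarrow> reduced u \<and> reduced v \<and> (u = [] \<or> v = [] \<or> hd v \<noteq> linv (last u))"
  by (auto simp: reduced_def successively_append_iff)

lemma reduced_Cons: "reduced (x # w) \<longleftrightarrow> reduced w \<and> (w = [] \<or> hd w \<noteq> linv x)"
  using reduced_append[of "[x]" w] by auto

lemma winv_append [simp]: "winv (u @ v) = winv v @ winv u"
  by (simp add: winv_def)

lemma winv_Nil_iff [simp]: "winv w = [] \<longleftrightarrow> w = []" "[] = winv w \<longleftrightarrow> w = []"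
  by (simp_all add: winv_def)

lemma winv_inj [simp]: "winv u = winv v \<longleftrightarrow> u = v"
  by (metis winv_simps(3))

lemma reduced_winv_iff [simp]: "reduced (winv w) \<longleftrightarrow> reduced w"
  by (metis reduced_winv winv_simps(3))

lemma hd_winv: "w \<noteq> [] \<Longrightarrow> hd (winv w) = linv (last w)"
  by (simp add: winv_def hd_rev last_map)

lemma last_winv: "w \<noteq> [] \<Longrightarrow> last (winv w) = linv (hd w)"
  by (simp add: winv_def last_rev hd_map)

lemma reduce_cong: "reduce u = reduce u' \<Longrightarrow> reduce v = reduce v' \<Longrightarrow> reduce (u @ v) = reduce (u' @ v')"
  by (metis reduce_reduce_left reduce_reduce_right)

lemma reduce_append_left: "reduce u = reduce u' \<Longrightarrow> reduce (u @ v) = reduce (u' @ v)"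
  by (metis reduce_reduce_left)

lemma reduce_append_right: "reduce v = reduce v' \<Longrightarrow> reduce (u @ v) = reduce (u @ v')"
  by (metis reduce_reduce_right)

lemma reduce_Cons_right: "reduce v = reduce v' \<Longrightarrow> reduce (x # v) = reduce (x # v')"
  using reduce_append_right[of v v' "[x]"] by simp

section \<open>Powers of b\<close>

lemma length_bpow [simp]: "length (bpow m) = nat \<bar>m\<bar>"
  by (simp add: bpow_def)

lemma bpow_Nil_iff [simp]: "bpow m = [] \<longleftrightarrow> m = 0" "[] = bpow m \<longleftrightarrow> m = 0"
  by (auto simp: bpow_def)

lemma bpow_0 [simp]: "bpow 0 = []" by simp

lemma set_bpow: "set (bpow m) \<subseteq> {b, linv b}"
  by (auto simp: bpow_def)

lemma bpow_not_nonb: "x \<in> set (bpow m) \<Longrightarrow> \<not> nonb x"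
  using set_bpow by (auto simp: nonb_def)

lemma hd_bpow: "m \<noteq> 0 \<Longrightarrow> hd (bpow m) = (if 0 \<le> m then b else linv b)"
  by (simp add: bpow_def)

lemma last_bpow: "m \<noteq> 0 \<Longrightarrow> last (bpow m) = (if 0 \<le> m then b else linv b)"
  by (simp add: bpow_def)

lemma reduced_bpow [simp]: "reduced (bpow m)"
proof -
  have "reduced (replicate k x)" for k and x :: letter
    by (induction k) (auto simp: reduced_Cons)
  then show ?thesis by (simp add: bpow_def)
qed

lemma winv_bpow [simp]: "winv (bpow m) = bpow (- m)"
  by (auto simp: bpow_def winv_def)

text \<open>Powers of \<open>b\<close> with exponents of opposite sign cancel in the group but not as words, which is
why the sign condition is unavoidable here and absent in \<open>reduce_bpow_add\<close>.\<close>

lemma bpow_add_same_sign: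
  assumes "0 \<le> i \<and> 0 \<le> j \<or> i \<le> 0 \<and> j \<le> 0"
  shows "bpow (i + j) = bpow i @ bpow j"
proof -
  have "nat \<bar>i + j\<bar> = nat \<bar>i\<bar> + nat \<bar>j\<bar>" using assms by arith
  then show ?thesis using assms
    by (cases "i = 0"; cases "j = 0") (auto simp: bpow_def replicate_add)
qed

lemma reduce_bpow_winv: "reduce (bpow m @ bpow (- m) @ w) = reduce w"
proof -
  have "reduce (winv (bpow (-m)) @ bpow (-m)) = reduce []"
    using foldr_push_winv[of "bpow (-m)"] reduce_id[of "bpow (-m)"] by (simp add: reduce_def)
  then show ?thesis using reduce_append_left[of "bpow m @ bpow (-m)" "[]" w] by simp
qed

lemma reduce_bpow_add: "reduce (bpow i @ bpow j @ w) = reduce (bpow (i + j) @ w)"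
proof -
  consider "0 \<le> i \<and> 0 \<le> j \<or> i \<le> 0 \<and> j \<le> 0" | "0 \<le> i + j \<and> 0 \<le> - j \<or> i + j \<le> 0 \<and> - j \<le> 0"
    | "0 \<le> i + j \<and> 0 \<le> - i \<or> i + j \<le> 0 \<and> - i \<le> 0" by linarith
  then show ?thesis
  proof cases
    case 1 then show ?thesis by (simp add: bpow_add_same_sign)
  next
    case 2
    then have "bpow i = bpow (i + j) @ bpow (- j)" using bpow_add_same_sign[of "i + j" "- j"] by simp
    then show ?thesis using reduce_append_right[OF reduce_bpow_winv[of "- j" w]] by simp
  next
    case 3
    then have "bpow j = bpow (- i) @ bpow (i + j)" using bpow_add_same_sign[of "- i" "i + j"] by (simp add: disj_commute conj_commute)
    then show ?thesis using reduce_bpow_winv[of i "bpow (i + j) @ w"] by simp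
  qed
qed

text \<open>The recursions along a word consume one block of \<open>b\<close> and the letter behind it.\<close>

lemma bpow_split:
  assumes "reduced w"
  obtains m where "w = bpow m" | m t v where "w = bpow m @ t # v" "nonb t"
proof -
  obtain m xs where d: "b_decomp w m xs" using b_decomp_ex[OF assms] by blast
  then show ?thesis
    by (cases xs) (force intro: that simp: b_decomp_def nonb_def)+
qed

section \<open>The powers of the twist\<close>

text \<open>The powers of \<open>b\<close> that \<open>T\<^sup>n\<close> creates to the right and to the left of a letter. Recording both as
signed exponents makes inversion exchange them up to sign.\<close>

definition expR :: "int \<Rightarrow> letter \<Rightarrow> int" where "expR n s = (if s = a then n else 0)"
definition expL :: "int \<Rightarrow> letter \<Rightarrow> int" where "expL n s = (if s = a' then - n else 0)"

definition twist_subst :: "int \<Rightarrow> word \<Rightarrow> word" where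
  "twist_subst n w = concat (map (\<lambda>s. bpow (expL n s) @ s # bpow (expR n s)) w)"

text \<open>The exponent is an integer, so that the inverse automorphism obeys the same laws.\<close>

definition twist_pow :: "int \<Rightarrow> word \<Rightarrow> word" where "twist_pow n w = reduce (twist_subst n w)"

lemma expR_linv [simp]: "expR n (linv s) = - expL n s" and expL_linv [simp]: "expL n (linv s) = - expR n s"
  by (auto simp: expR_def expL_def) (metis linv_linv)+

lemma expR_uminus [simp]: "expR (- n) s = - expR n s" and expL_uminus [simp]: "expL (- n) s = - expL n s"
  by (auto simp: expR_def expL_def)

lemma expR_add: "expR (m + n) s = expR m s + expR n s" and expL_add: "expL (m + n) s = expL m s + expL n s"
  by (auto simp: expR_def expL_def)

lemma expR_expL_letters [simp]: "expR n a = n" "expR n a' = 0" "expL n a' = - n" "expL n a = 0"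
  "expR n b = 0" "expL n b = 0" "expR n (linv b) = 0" "expL n (linv b) = 0"
  by (simp_all add: expR_def expL_def)

lemma twist_subst_simps [simp]: "twist_subst n [] = []" "twist_subst n (u @ v) = twist_subst n u @ twist_subst n v"
  "twist_subst n (s # v) = bpow (expL n s) @ s # bpow (expR n s) @ twist_subst n v"
  by (simp_all add: twist_subst_def)

lemma twist_subst_b_word: "set w \<subseteq> {b, linv b} \<Longrightarrow> twist_subst n w = w"
  by (induction w) auto

lemma twist_subst_bpow [simp]: "twist_subst n (bpow m) = bpow m"
  using twist_subst_b_word set_bpow by blast

lemma twist_subst_winv: "twist_subst n (winv w) = winv (twist_subst n w)"
  by (induction w) auto

text \<open>Inversion is an anti-automorphism, so every statement about the right end of a word yields one
about its left end.\<close>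

lemma reduce_winv: "reduce (winv w) = winv (reduce w)"
proof (induction w)
  case (Cons x w)
  have inv: "reduce (winv u @ u) = []" if "reduced u" for u
    using foldr_push_winv[OF that] reduce_id[OF that] by (simp add: reduce_def)
  let ?u = "reduce (x # w)"
  have "reduce (winv w @ [linv x]) = reduce ((winv w @ [linv x]) @ ?u @ winv ?u)"
  proof -
    have "reduce (?u @ winv ?u) = reduce []"
      using inv[of "winv ?u"] by (simp only: winv_simps reduced_winv_iff reduced_reduce) (simp add: reduce_def)
    from reduce_append_right[OF this, of "winv w @ [linv x]"] show ?thesis by simp
  qed
  also have "\<dots> = reduce ((winv w @ [linv x] @ x # w) @ winv ?u)"
    using reduce_append_right[OF reduce_append_left[of "?u" "x # w" "winv ?u"], of "winv w @ [linv x]"]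
      reduce_id[of ?u] by simp
  also have "\<dots> = reduce ([] @ winv ?u)"
  proof (rule reduce_append_left)
    have "reduce ([linv x] @ x # w) = reduce w"
    proof -
      have "reduce ([linv x, x] @ w) = reduce ([] @ w)"
        by (rule reduce_append_left) (simp add: reduce_def push_def)
      then show ?thesis by simp
    qed
    then have "reduce (winv w @ [linv x] @ x # w) = reduce (winv w @ w)"
      by (rule reduce_append_right)
    also have "\<dots> = reduce (reduce (winv w) @ reduce w)"
      by (simp add: reduce_reduce_left reduce_reduce_right)
    also have "\<dots> = []" by (simp add: Cons.IH inv)
    finally show "reduce (winv w @ [linv x] @ x # w) = reduce []" by (simp add: reduce_def)
  qed
  also have "\<dots> = winv ?u" using reduce_id[of "winv ?u"] by (simp add: reduced_winv)
  finally show ?case by simp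
qed (simp add: reduce_def)

lemma reduced_letter_image: "reduced (bpow (expL n s) @ s # bpow (expR n s))"
  by (cases "n = 0") (simp_all add: reduced_append reduced_Cons hd_bpow last_bpow expR_def expL_def)

lemma reduce_twist_subst_reduce: "reduce (twist_subst n (reduce w)) = reduce (twist_subst n w)"
  unfolding twist_subst_def
  by (rule reduce_concat_map_reduce) (simp_all add: reduced_letter_image)

lemma reduce_twist_subst_twist_subst: "reduce (twist_subst m (twist_subst n w)) = reduce (twist_subst (m + n) w)"
proof (induction w)
  case (Cons s w)
  have 1: "reduce (bpow (expR m s) @ bpow (expR n s) @ twist_subst m (twist_subst n w)) =
      reduce (bpow (expR (m + n) s) @ twist_subst (m + n) w)"
    by (metis reduce_bpow_add expR_add reduce_append_right[OF Cons.IH])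
  have "reduce (bpow (expL n s) @ bpow (expL m s) @ s # bpow (expR m s) @ bpow (expR n s) @ twist_subst m (twist_subst n w))
    = reduce (bpow (expL (m + n) s) @ s # bpow (expR m s) @ bpow (expR n s) @ twist_subst m (twist_subst n w))"
    using reduce_bpow_add[of "expL n s" "expL m s"] by (simp add: expL_add add.commute)
  also have "\<dots> = reduce (bpow (expL (m + n) s) @ s # bpow (expR (m + n) s) @ twist_subst (m + n) w)"
    by (rule reduce_append_right[OF reduce_Cons_right[OF 1]])
  finally show ?case by simp
qed simp

lemma twist_subst_0 [simp]: "twist_subst 0 w = w"
  by (induction w) (auto simp: expR_def expL_def)

lemma twist_pow_twist_pow: "twist_pow m (twist_pow n w) = twist_pow (m + n) w"
  by (simp add: twist_pow_def reduce_twist_subst_reduce reduce_twist_subst_twist_subst)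

lemma twist_pow_0: "reduced w \<Longrightarrow> twist_pow 0 w = w"
  by (simp add: twist_pow_def reduce_id)

lemma reduced_twist_pow [simp]: "reduced (twist_pow n w)"
  by (simp add: twist_pow_def)

lemma twist_eq_twist_pow: "twist w = twist_pow 1 w"
proof -
  have "(if s = gen_a then [gen_a, gen_b] else if s = linv gen_a then [linv gen_b, linv gen_a] else [s])
    = bpow (expL 1 s) @ s # bpow (expR 1 s)" for s
    by (simp add: expR_def expL_def bpow_def)
  then show ?thesis by (simp add: twist_def hom_ext_def twist_pow_def twist_subst_def)
qed

text \<open>The images of what stands to the right and to the left of a letter \<open>s\<close> other than \<open>b\<^sup>\<plusminus>\<^sup>1\<close>. The
power of \<open>b\<close> that \<open>s\<close> itself creates on that side is included.\<close>

definition imR :: "int \<Rightarrow> letter \<Rightarrow> word \<Rightarrow> word" where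
  "imR n s Y = reduce (bpow (expR n s) @ twist_subst n Y)"

definition imL :: "int \<Rightarrow> letter \<Rightarrow> word \<Rightarrow> word" where
  "imL n s X = reduce (twist_subst n X @ bpow (expL n s))"

lemma imL_eq: "imL n s X = winv (imR n (linv s) (winv X))"
  by (simp add: imL_def imR_def twist_subst_winv flip: reduce_winv)

lemma imR_bpow: "imR n s (bpow m) = bpow (m + expR n s)"
  using reduce_bpow_add[of "expR n s" m "[]"] by (simp add: imR_def reduce_id add.commute)

lemma imR_Cons_reduce:
  "imR n s (bpow m @ t # Y) = reduce (bpow (m + expR n s + expL n t) @ t # imR n t Y)"
proof -
  have "imR n s (bpow m @ t # Y)
    = reduce (bpow (expR n s) @ bpow m @ bpow (expL n t) @ [t] @ bpow (expR n t) @ twist_subst n Y)"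
    by (simp add: imR_def)
  also have "\<dots> = reduce (bpow (expR n s + m + expL n t) @ [t] @ bpow (expR n t) @ twist_subst n Y)"
    by (metis reduce_bpow_add)
  also have "\<dots> = reduce (bpow (expR n s + m + expL n t) @ [t] @ imR n t Y)"
    unfolding imR_def by (metis reduce_append_right reduce_reduce_right append_assoc)
  finally show ?thesis by (simp add: ac_simps)
qed

text \<open>The letters other than \<open>b\<^sup>\<plusminus>\<^sup>1\<close> do not cancel: a neighbour \<open>t = s\<^sup>-\<^sup>1\<close> of \<open>s\<close> forces a nontrivial
block between them, and this block does not move, because \<open>s\<close> and \<open>s\<^sup>-\<^sup>1\<close> act on it in opposite ways.\<close>

lemma reduced_imR: "nonb s \<Longrightarrow> reduced (s # Y) \<Longrightarrow> reduced (s # imR n s Y)"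
proof (induction "length Y" arbitrary: s Y rule: less_induct)
  case less
  have Y: "reduced Y" using less.prems(2) by (simp add: reduced_Cons)
  show ?case
  proof (cases rule: bpow_split[OF Y])
    case (1 m)
    then show ?thesis using less.prems nonbD[of s]
      by (auto simp: imR_bpow reduced_Cons hd_bpow split: if_splits)
  next
    case (2 m t V)
    let ?k = "m + expR n s + expL n t"
    have "reduced (t # V)" using Y 2 by (simp add: reduced_append)
    then have V: "reduced (t # imR n t V)" using 2 less by simp
    have t: "t \<noteq> linv s" if "?k = 0"
    proof
      assume t: "t = linv s"
      with that have "m = 0" by simp
      with 2 t less.prems show False by simp
    qed
    have "reduced (s # bpow ?k @ t # imR n t V)"
      using V t 2(2) less.prems(1) nonbD[of s] nonbD[of t]
      by (cases "?k = 0") (auto simp: reduced_Cons reduced_append hd_bpow last_bpow)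
    moreover from this have "reduced (bpow ?k @ t # imR n t V)" by (rule reduced_tl)
    ultimately show ?thesis by (simp add: 2 imR_Cons_reduce reduce_id)
  qed
qed

lemma imR_Cons:
  assumes "nonb s" "nonb t" "reduced (s # bpow m @ t # Y)"
  shows "imR n s (bpow m @ t # Y) = bpow (m + expR n s + expL n t) @ t # imR n t Y"
proof -
  let ?k = "m + expR n s + expL n t"
  have "reduced (t # Y)" using assms by (simp add: reduced_Cons reduced_append)
  then have V: "reduced (t # imR n t Y)" using assms reduced_imR by blast
  then have "reduced (bpow ?k @ t # imR n t Y)"
    using assms(2) nonbD[of t] by (cases "?k = 0") (auto simp: reduced_append last_bpow)
  then show ?thesis by (simp add: imR_Cons_reduce reduce_id)
qed

lemma reduced_imL:
  assumes "nonb s" "reduced (X @ [s])"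
  shows "reduced (imL n s X @ [s])"
proof -
  have "reduced (winv (X @ [s]))" using assms(2) reduced_winv by blast
  then have "reduced (linv s # imR n (linv s) (winv X))"
    using assms(1) by (intro reduced_imR) auto
  then have "reduced (winv (linv s # imR n (linv s) (winv X)))" using reduced_winv by blast
  then show ?thesis by (simp add: imL_eq)
qed

lemma reduced_glue: "reduced (u @ [s]) \<Longrightarrow> reduced (s # v) \<Longrightarrow> reduced (u @ s # v)"
  by (auto simp: reduced_append reduced_Cons)

text \<open>Each letter other than \<open>b\<^sup>\<plusminus>\<^sup>1\<close> survives, and the parts on its two sides are transformed
independently. This is what makes \<open>T\<^sup>n\<close> local.\<close>

lemma twist_pow_split:
  assumes "nonb s" "reduced (X @ s # Y)"
  shows "twist_pow n (X @ s # Y) = imL n s X @ s # imR n s Y"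
proof -
  have "reduced ((X @ [s]) @ Y)" using assms(2) by simp
  then have r: "reduced (X @ [s])" "reduced (s # Y)"
    using assms(2) by (simp_all add: reduced_append del: append_assoc)
  have "reduced (imL n s X @ s # imR n s Y)"
    by (rule reduced_glue[OF reduced_imL[OF assms(1) r(1)] reduced_imR[OF assms(1) r(2)]])
  moreover have "twist_pow n (X @ s # Y) = reduce (imL n s X @ s # imR n s Y)"
  proof -
    have "twist_pow n (X @ s # Y) = reduce ((twist_subst n X @ bpow (expL n s)) @ [s] @ (bpow (expR n s) @ twist_subst n Y))"
      by (simp add: twist_pow_def)
    also have "\<dots> = reduce (imL n s X @ [s] @ imR n s Y)"
      using reduce_reduce_left[of "twist_subst n X @ bpow (expL n s)" "[s] @ imR n s Y"]
        reduce_reduce_right[of "(twist_subst n X @ bpow (expL n s)) @ [s]" "bpow (expR n s) @ twist_subst n Y"]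
      by (simp add: imL_def imR_def)
    finally show ?thesis by simp
  qed
  ultimately show ?thesis by (simp add: reduce_id)
qed

lemma imR_imR:
  assumes "reduced Y" shows "imR (- n) s (imR n s Y) = Y"
proof -
  have "imR (- n) s (imR n s Y) = reduce (bpow (- expR n s) @ twist_subst (- n) (bpow (expR n s) @ twist_subst n Y))"
    unfolding imR_def by (metis expR_uminus reduce_append_right reduce_twist_subst_reduce)
  also have "\<dots> = reduce (bpow (- expR n s) @ bpow (expR n s) @ twist_subst (- n) (twist_subst n Y))" by simp
  also have "\<dots> = reduce (twist_subst (- n) (twist_subst n Y))"
    using reduce_bpow_winv[of "- expR n s"] by simp
  also have "\<dots> = Y" using assms by (simp add: reduce_twist_subst_twist_subst reduce_id)
  finally show ?thesis .
qed

lemma imL_imL: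
  assumes "reduced X" shows "imL (- n) s (imL n s X) = X"
  using imR_imR[of "winv X" n "linv s"] assms by (simp add: imL_eq)

section \<open>Cores of words\<close>

text \<open>A core is a word that starts and ends with a letter other than \<open>b\<^sup>\<plusminus>\<^sup>1\<close>. It is stored as its first
letter \<open>s\<close> and the list of the following pairs of a block and the letter behind it; in contrast to
the syllables of the normal form, no block at the end has to be treated separately.\<close>

fun tail :: "(int \<times> letter) list \<Rightarrow> word" where
  "tail [] = []"
| "tail ((m, t) # ys) = bpow m @ t # tail ys"

fun shift :: "int \<Rightarrow> letter \<Rightarrow> (int \<times> letter) list \<Rightarrow> (int \<times> letter) list" where
  "shift n s [] = []"
| "shift n s ((m, t) # ys) = (m + expR n s + expL n t, t) # shift n t ys"

fun final :: "letter \<Rightarrow> (int \<times> letter) list \<Rightarrow> letter" where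
  "final s [] = s"
| "final s ((m, t) # ys) = final t ys"

fun red_tail :: "letter \<Rightarrow> (int \<times> letter) list \<Rightarrow> bool" where
  "red_tail s [] = nonb s"
| "red_tail s ((m, t) # ys) = (nonb s \<and> (m = 0 \<longrightarrow> t \<noteq> linv s) \<and> red_tail t ys)"

text \<open>With parameter \<open>1\<close> the sum is the rate at which the block between \<open>s\<close> and \<open>t\<close> moves;
it is \<open>0\<close>, \<open>1\<close> or \<open>-1\<close>.\<close>

fun shear_count :: "letter \<Rightarrow> (int \<times> letter) list \<Rightarrow> nat" where
  "shear_count s [] = 0"
| "shear_count s ((m, t) # ys) = of_bool (expR 1 s + expL 1 t \<noteq> 0) + shear_count t ys"

lemma tail_append [simp]: "tail (xs @ ys) = tail xs @ tail ys"
  by (induction xs rule: tail.induct) auto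

lemma final_append [simp]: "final s (xs @ ys) = final (final s xs) ys"
  by (induction s xs rule: final.induct) auto

lemma shift_append [simp]: "shift n s (xs @ ys) = shift n s xs @ shift n (final s xs) ys"
  by (induction n s xs rule: shift.induct) auto

lemma shear_count_append [simp]: "shear_count s (xs @ ys) = shear_count s xs + shear_count (final s xs) ys"
  by (induction s xs rule: shear_count.induct) auto

lemma red_tail_nonb: "red_tail s ys \<Longrightarrow> nonb s"
  by (cases "(s, ys)" rule: red_tail.cases) auto

lemma red_tail_append [simp]: "red_tail s (xs @ ys) \<longleftrightarrow> red_tail s xs \<and> red_tail (final s xs) ys"
  by (induction s xs rule: red_tail.induct) (auto dest: red_tail_nonb)

lemma final_shift [simp]: "final s (shift n s ys) = final s ys"
  by (induction n s ys rule: shift.induct) auto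

lemma red_tail_shift [simp]: "red_tail s (shift n s ys) \<longleftrightarrow> red_tail s ys"
  by (induction n s ys rule: shift.induct) auto

lemma shift_shift [simp]: "shift m s (shift n s ys) = shift (m + n) s ys"
  by (induction n s ys rule: shift.induct) (auto simp: expR_add expL_add)

lemma shift_0 [simp]: "shift 0 s ys = ys"
  by (induction "0::int" s ys rule: shift.induct) (auto simp: expR_def expL_def)

lemma last_core: "last (s # tail ys) = final s ys"
  by (induction s ys rule: final.induct) auto

lemma red_tail_final: "red_tail s ys \<Longrightarrow> nonb (final s ys)"
  by (induction s ys rule: final.induct) auto

lemma red_tail_reduced: "red_tail s ys \<Longrightarrow> reduced (s # tail ys)"
proof (induction s ys rule: red_tail.induct)
  case (2 s m t ys)
  then show ?case using red_tail_nonb[of t ys] nonbD[of s] nonbD[of t]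
    by (cases "m = 0") (auto simp: reduced_Cons reduced_append hd_bpow last_bpow)
qed simp

lemma expR_expL_bound: "\<bar>expR n s + expL n t\<bar> \<le> \<bar>n\<bar>"
  by (auto simp: expR_def expL_def)

lemma expR_expL_scale: "expR n s + expL n t = n * (expR 1 s + expL 1 t)"
  by (auto simp: expR_def expL_def)

lemma expR_expL_unit: "expR 1 s + expL 1 t \<in> {-1, 0, 1}"
  by (auto simp: expR_def expL_def)

text \<open>Each moving block has length \<open>n\<close> up to its original length.\<close>

lemma length_tail_shift:
  "int (length (tail (shift n s ys))) \<le> int (length (tail ys)) + \<bar>n\<bar> * int (shear_count s ys)"
  "int (length (tail (shift n s ys))) \<ge> \<bar>n\<bar> * int (shear_count s ys) - int (length (tail ys))"
proof (induction s ys rule: shear_count.induct)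
  case (2 s m t ys)
  have "expR n s + expL n t = n * (expR 1 s + expL 1 t)" by (rule expR_expL_scale)
  then have e: "\<bar>expR n s + expL n t\<bar> = \<bar>n\<bar> * of_bool (expR 1 s + expL 1 t \<noteq> 0)"
    using expR_expL_unit[of s t] by (auto simp: abs_mult)
  {
    case 1
    show ?case using 2(1) e by (simp add: algebra_simps)
  next
    case 2
    show ?case using "2.IH"(2) e by (simp add: algebra_simps)
  }
qed auto

lemma imR_core:
  assumes "red_tail s ys" "reduced (s # tail ys @ Y)"
  shows "imR n s (tail ys @ Y) = tail (shift n s ys) @ imR n (final s ys) Y"
  using assms
proof (induction s ys rule: red_tail.induct)
  case (2 s m t ys)
  have "reduced (t # tail ys @ Y)" using 2 by (simp add: reduced_Cons reduced_append)
  with 2 red_tail_nonb[of t ys] show ?case by (simp add: imR_Cons)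
qed simp

lemma twist_pow_core:
  assumes "red_tail s ys" "reduced (X @ s # tail ys @ Y)"
  shows "twist_pow n (X @ s # tail ys @ Y) = imL n s X @ s # tail (shift n s ys) @ imR n (final s ys) Y"
proof -
  have "reduced (s # tail ys @ Y)" using assms(2) by (simp add: reduced_append)
  then show ?thesis
    using twist_pow_split[of s X "tail ys @ Y" n] imR_core[of s ys Y n] assms red_tail_nonb by auto
qed

lemma twist_pow_core_alone:
  assumes "red_tail s ys"
  shows "twist_pow n (s # tail ys) = bpow (expL n s) @ s # tail (shift n s ys) @ bpow (expR n (final s ys))"
  using twist_pow_core[OF assms, of "[]" "[]" n] red_tail_reduced[OF assms]
  by (simp add: imL_def imR_def reduce_id)

section \<open>Decomposition of words\<close>

text \<open>The decomposition of a word of positive b-length into a core and two outer powers of \<open>b\<close>.\<close>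

definition b_form :: "word \<Rightarrow> int \<Rightarrow> letter \<Rightarrow> (int \<times> letter) list \<Rightarrow> int \<Rightarrow> bool" where
  "b_form v m s ys k \<longleftrightarrow> v = bpow m @ s # tail ys @ bpow k \<and> red_tail s ys"

text \<open>The same data in the shape that the normal form uses, with each block stored behind its letter.\<close>

fun syllables :: "letter \<Rightarrow> (int \<times> letter) list \<Rightarrow> int \<Rightarrow> (letter \<times> int) list" where
  "syllables s [] k = [(s, k)]"
| "syllables s ((m, t) # ys) k = (s, m) # syllables t ys k"

lemma syllables_ne [simp]: "syllables s ys k \<noteq> []" "[] \<noteq> syllables s ys k"
  by (cases "(s, ys, k)" rule: syllables.cases; auto)+

lemma syllables_word: "concat (map (\<lambda>(s, m). s # bpow m) (syllables s ys k)) = s # tail ys @ bpow k"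
  by (induction s ys k rule: syllables.induct) auto

lemma b_form_b_decomp:
  assumes "b_form v m s ys k" shows "b_decomp v m (syllables s ys k)"
proof -
  have "\<forall>(s, m)\<in>set (syllables s ys k). s \<noteq> b \<and> s \<noteq> linv b" if "red_tail s ys"
    using that by (induction s ys k rule: syllables.induct) (auto simp: nonb_def)
  moreover have "successively (\<lambda>(s, m) (s', m'). m = 0 \<longrightarrow> s \<noteq> linv s') (syllables s ys k)" if "red_tail s ys"
    using that
  proof (induction s ys k rule: syllables.induct)
    case (2 s m t ys k)
    obtain m' zs where "syllables t ys k = (t, m') # zs" by (cases "(t, ys, k)" rule: syllables.cases) auto
    with 2 show ?case by auto
  qed simp
  ultimately show ?thesis using assms by (simp add: b_form_def b_decomp_def syllables_word)
qed

lemma syllables_butlast: "concat (map (\<lambda>(s, m). s # bpow m) (butlast (syllables s ys k))) @ [fst (last (syllables s ys k))] = s # tail ys"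
  by (induction s ys k rule: syllables.induct) auto

lemma b_form_the:
  assumes "b_form v m s ys k"
  shows "b_first v = m" "b_syllables v = syllables s ys k" "b_length v = Suc (length ys)"
    "b_last v = k" "tau_b v = s # tail ys"
proof -
  note d = b_decomp_the[OF b_form_b_decomp[OF assms]]
  show "b_first v = m" and syllables: "b_syllables v = syllables s ys k" by (fact d)+
  have "length (syllables s ys k) = Suc (length ys)" "snd (last (syllables s ys k)) = k"
    by (induction s ys k rule: syllables.induct) auto
  then show "b_length v = Suc (length ys)" "b_last v = k"
    by (simp_all add: b_length_def b_last_def syllables)
  show "tau_b v = s # tail ys" by (simp only: tau_b_def syllables Let_def syllables_ne if_False syllables_butlast)
qed

lemma bpow_the:
  "b_length (bpow m) = 0" "tau_b (bpow m) = []"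
proof -
  have "b_decomp (bpow m) m []" by (simp add: b_decomp_def)
  from b_decomp_the(2)[OF this] show "b_length (bpow m) = 0" "tau_b (bpow m) = []"
    by (simp_all add: b_length_def tau_b_def)
qed

lemma b_form_cases:
  assumes "reduced v"
  obtains m where "v = bpow m" | m s ys k where "b_form v m s ys k"
proof -
  have "\<exists>ys k. Y = tail ys @ bpow k \<and> red_tail s ys" if "reduced (s # Y)" "nonb s" for s Y
    using that
  proof (induction "length Y" arbitrary: s Y rule: less_induct)
    case less
    have Y: "reduced Y" using less.prems(1) by (simp add: reduced_Cons)
    show ?case
    proof (cases rule: bpow_split[OF Y])
      case (1 m)
      then have "Y = tail [] @ bpow m \<and> red_tail s []" using less.prems by simp
      then show ?thesis by blast
    next
      case (2 m t V)
      have "reduced (t # V)" using Y 2 by (simp add: reduced_append)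
      then obtain ys k where "V = tail ys @ bpow k" "red_tail t ys" using less.hyps[of V t] 2 by auto
      moreover have "t \<noteq> linv s" if "m = 0" using less.prems 2 that by simp
      ultimately have "Y = tail ((m, t) # ys) @ bpow k \<and> red_tail s ((m, t) # ys)"
        using 2 less.prems by simp
      then show ?thesis by blast
    qed
  qed
  note rest = this
  show ?thesis
  proof (cases rule: bpow_split[OF assms])
    case (1 m) then show ?thesis using that by blast
  next
    case (2 m t V)
    have "reduced (t # V)" using assms 2 by (simp add: reduced_append)
    with rest 2 obtain ys k where "V = tail ys @ bpow k" "red_tail t ys" by blast
    with 2 have "b_form v m t ys k" by (simp add: b_form_def)
    then show ?thesis using that by blast
  qed
qed

lemma b_form_unique:
  assumes "b_form v m s ys k" "b_form v m' s' ys' k'"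
  shows "m = m'" "k = k'" "s # tail ys = s' # tail ys'" "syllables s ys k = syllables s' ys' k'"
  using b_form_the[OF assms(1)] b_form_the[OF assms(2)] by metis+

lemma syllables_inject: "syllables s ys k = syllables s' ys' k' \<Longrightarrow> s = s' \<and> ys = ys' \<and> k = k'"
proof (induction s ys k arbitrary: s' ys' rule: syllables.induct)
  case (1 s k)
  then show ?case by (cases "(s', ys', k')" rule: syllables.cases) auto
next
  case (2 s m t ys k)
  then show ?case by (cases "(s', ys', k')" rule: syllables.cases) auto
qed

text \<open>Words of b-length zero get the value \<open>0\<close>: the only one in a normal form is \<open>b\<close>, and
\<open>\<phi> b\<close> composed with \<open>T\<^sup>n\<close> has length one for all \<open>n\<close>.\<close>

definition shear_speed :: "word \<Rightarrow> nat" where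
  "shear_speed v = (if b_length v = 0 then 0 else
     (THE r. \<exists>m s ys k. b_form v m s ys k \<and> r = shear_count s ys + of_bool (m \<noteq> 0) + of_bool (k \<noteq> 0)))"

lemma shear_speed_form:
  assumes "b_form v m s ys k"
  shows "shear_speed v = shear_count s ys + of_bool (m \<noteq> 0) + of_bool (k \<noteq> 0)"
proof -
  have "(THE r. \<exists>m s ys k. b_form v m s ys k \<and> r = shear_count s ys + of_bool (m \<noteq> 0) + of_bool (k \<noteq> 0))
    = shear_count s ys + of_bool (m \<noteq> 0) + of_bool (k \<noteq> 0)"
  proof (rule the_equality)
    fix r assume "\<exists>m s ys k. b_form v m s ys k \<and> r = shear_count s ys + of_bool (m \<noteq> 0) + of_bool (k \<noteq> 0)"
    then obtain m' s' ys' k' where f: "b_form v m' s' ys' k'"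
      and r: "r = shear_count s' ys' + of_bool (m' \<noteq> 0) + of_bool (k' \<noteq> 0)" by blast
    show "r = shear_count s ys + of_bool (m \<noteq> 0) + of_bool (k \<noteq> 0)"
      using b_form_unique[OF assms f] syllables_inject[OF b_form_unique(4)[OF assms f]] r by simp
  qed (use assms in blast)
  then show ?thesis by (simp add: shear_speed_def b_form_the(3)[OF assms])
qed

lemma shear_speed_bpow [simp]: "shear_speed (bpow m) = 0"
  by (simp add: shear_speed_def bpow_the)

fun rev_tail :: "letter \<Rightarrow> (int \<times> letter) list \<Rightarrow> (int \<times> letter) list" where
  "rev_tail s [] = []"
| "rev_tail s ((m, t) # ys) = rev_tail t ys @ [(- m, linv s)]"

lemma rev_tail_final: "final (linv (final s ys)) (rev_tail s ys) = linv s"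
  by (induction s ys rule: rev_tail.induct) auto

lemma rev_tail_winv: "winv (s # tail ys) = linv (final s ys) # tail (rev_tail s ys)"
proof (induction s ys rule: rev_tail.induct)
  case (2 s m t ys)
  have "winv (s # tail ((m, t) # ys)) = winv (t # tail ys) @ bpow (- m) @ [linv s]" by simp
  then show ?case unfolding 2 by simp
qed simp

lemma rev_tail_red_tail: "red_tail s ys \<Longrightarrow> red_tail (linv (final s ys)) (rev_tail s ys)"
  by (induction s ys rule: rev_tail.induct) (auto simp: rev_tail_final dest: red_tail_nonb)

lemma rev_tail_shear_count: "shear_count (linv (final s ys)) (rev_tail s ys) = shear_count s ys"
  by (induction s ys rule: rev_tail.induct) (auto simp: rev_tail_final)

lemma rev_tail_length [simp]: "length (rev_tail s ys) = length ys"
  by (induction s ys rule: rev_tail.induct) auto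

lemma b_form_winv:
  assumes "b_form v m s ys k"
  shows "b_form (winv v) (- k) (linv (final s ys)) (rev_tail s ys) (- m)"
proof -
  have "winv v = bpow (- k) @ winv (s # tail ys) @ bpow (- m)"
    using assms by (simp add: b_form_def)
  then show ?thesis unfolding rev_tail_winv using assms rev_tail_red_tail by (simp add: b_form_def)
qed

section \<open>Functions of bounded length\<close>

text \<open>Having a representative of length at most \<open>L\<close> modulo bounded functions. In contrast to the norm
of a class this is meaningful without knowing that a representative exists, and the coefficients may
vanish, which makes sums easy.\<close>

definition len_le :: "nat \<Rightarrow> nat \<Rightarrow> (word \<Rightarrow> real) \<Rightarrow> bool" where
  "len_le d L f \<longleftrightarrow> (\<exists>\<gamma> U. finite U \<and> U \<subseteq> F d - {[]} \<and> (\<forall>u\<in>U. length u \<le> L) \<and>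
     bdd_equiv d f (\<lambda>w. \<Sum>u\<in>U. \<gamma> u * real (occ u w)))"

lemma bdd_equiv_sym: "bdd_equiv d f g \<Longrightarrow> bdd_equiv d g f"
  by (simp add: bdd_equiv_def abs_minus_commute)

lemma len_le_mono: "len_le d L f \<Longrightarrow> L \<le> L' \<Longrightarrow> len_le d L' f"
  unfolding len_le_def by (meson order_trans)

lemma len_le_bdd: "len_le d L f \<Longrightarrow> bdd_equiv d f g \<Longrightarrow> len_le d L g"
  unfolding len_le_def by (meson bdd_equiv_trans bdd_equiv_sym)

lemma len_le_cong: "len_le d L f \<Longrightarrow> (\<And>w. w \<in> F d \<Longrightarrow> f w = g w) \<Longrightarrow> len_le d L g"
  by (erule len_le_bdd) (auto simp: bdd_equiv_def intro!: exI[of _ 0])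

lemma len_le_add:
  assumes "len_le d L f" "len_le d L g"
  shows "len_le d L (\<lambda>w. f w + g w)"
proof -
  obtain \<gamma> U B where U: "finite U" "U \<subseteq> F d - {[]}" "\<forall>u\<in>U. length u \<le> L"
    and B: "\<forall>w\<in>F d. \<bar>f w - (\<Sum>u\<in>U. \<gamma> u * real (occ u w))\<bar> \<le> B"
    using assms(1) unfolding len_le_def bdd_equiv_def by blast
  obtain \<delta> V C where V: "finite V" "V \<subseteq> F d - {[]}" "\<forall>u\<in>V. length u \<le> L"
    and C: "\<forall>w\<in>F d. \<bar>g w - (\<Sum>u\<in>V. \<delta> u * real (occ u w))\<bar> \<le> C"
    using assms(2) unfolding len_le_def bdd_equiv_def by blast
  define \<eta> where "\<eta> u = (if u \<in> U then \<gamma> u else 0) + (if u \<in> V then \<delta> u else 0)" for u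
  have "(\<Sum>u\<in>U \<union> V. \<eta> u * real (occ u w)) =
      (\<Sum>u\<in>U. \<gamma> u * real (occ u w)) + (\<Sum>u\<in>V. \<delta> u * real (occ u w))" for w
  proof -
    have "(\<Sum>u\<in>U \<union> V. \<eta> u * real (occ u w)) =
      (\<Sum>u\<in>U \<union> V. if u \<in> U then \<gamma> u * real (occ u w) else 0) +
      (\<Sum>u\<in>U \<union> V. if u \<in> V then \<delta> u * real (occ u w) else 0)"
      unfolding sum.distrib[symmetric] by (intro sum.cong) (auto simp: \<eta>_def algebra_simps)
    then show ?thesis using U(1) V(1) by (simp add: sum.If_cases Int_absorb1)
  qed
  then have "\<forall>w\<in>F d. \<bar>f w + g w - (\<Sum>u\<in>U \<union> V. \<eta> u * real (occ u w))\<bar> \<le> B + C"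
    using B C by fastforce
  then show ?thesis using U V unfolding len_le_def bdd_equiv_def
    by (intro exI[of _ \<eta>] exI[of _ "U \<union> V"]) auto
qed

lemma len_le_scale:
  assumes "len_le d L f"
  shows "len_le d L (\<lambda>w. c * f w)"
proof -
  obtain \<gamma> U B where U: "finite U" "U \<subseteq> F d - {[]}" "\<forall>u\<in>U. length u \<le> L"
    and B: "\<forall>w\<in>F d. \<bar>f w - (\<Sum>u\<in>U. \<gamma> u * real (occ u w))\<bar> \<le> B"
    using assms(1) unfolding len_le_def bdd_equiv_def by blast
  have "\<bar>c * f w - (\<Sum>u\<in>U. (c * \<gamma> u) * real (occ u w))\<bar> \<le> \<bar>c\<bar> * B" if "w \<in> F d" for w
  proof -
    have "c * f w - (\<Sum>u\<in>U. (c * \<gamma> u) * real (occ u w)) =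
        c * (f w - (\<Sum>u\<in>U. \<gamma> u * real (occ u w)))"
      by (simp only: sum_distrib_left mult.assoc right_diff_distrib)
    then have "\<bar>c * f w - (\<Sum>u\<in>U. (c * \<gamma> u) * real (occ u w))\<bar> =
        \<bar>c\<bar> * \<bar>f w - (\<Sum>u\<in>U. \<gamma> u * real (occ u w))\<bar>" by (simp only: abs_mult)
    also have "\<dots> \<le> \<bar>c\<bar> * B" using bspec[OF B that] by (rule mult_left_mono) simp
    finally show ?thesis .
  qed
  then show ?thesis using U unfolding len_le_def bdd_equiv_def
    by (intro exI[of _ "\<lambda>u. c * \<gamma> u"] exI[of _ U]) blast
qed

lemma len_le_zero: "len_le d L (\<lambda>w. 0)"
  unfolding len_le_def bdd_equiv_def by (intro exI[of _ undefined] exI[of _ "{}"]) auto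

lemma len_le_diff: "len_le d L f \<Longrightarrow> len_le d L g \<Longrightarrow> len_le d L (\<lambda>w. f w - g w)"
  using len_le_add[of d L f "\<lambda>w. (-1) * g w"] len_le_scale[of d L g "-1"] by simp

lemma len_le_occ: "u \<in> F d \<Longrightarrow> u \<noteq> [] \<Longrightarrow> length u \<le> L \<Longrightarrow> len_le d L (\<lambda>w. real (occ u w))"
  unfolding len_le_def bdd_equiv_def
  by (intro exI[of _ "\<lambda>_. 1"] exI[of _ "{u}"]) auto

section \<open>Occurrences\<close>

lemma finite_splits: "finite {(X, Y). w = X @ C @ Y \<and> P X Y}"
  by (rule finite_subset[OF _ finite_occ[of w C]]) auto

lemma overlap_left:
  assumes "L @ Z = x @ w" "\<not> prefix L x"
  obtains l where "L = x @ l" "l \<noteq> []"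
proof -
  obtain us where "L = x @ us \<and> us @ Z = w \<or> L @ us = x \<and> Z = us @ w"
    using assms(1) by (auto simp: append_eq_append_conv2)
  then show ?thesis using assms(2) that by (cases "us = []") (auto simp: prefix_def)
qed

lemma overlap_right:
  assumes "Z @ R = w @ y" "\<not> suffix R y"
  obtains r where "R = r @ y" "r \<noteq> []"
proof -
  obtain us where "Z = w @ us \<and> us @ R = y \<or> Z @ us = w \<and> R = us @ y"
    using assms(1) by (auto simp: append_eq_append_conv2)
  then show ?thesis using assms(2) that by (cases "us = []") (auto simp: suffix_def)
qed

text \<open>Inclusion and exclusion along the overlap \<open>Z\<close>: an occurrence of \<open>u\<close> lies in \<open>L Z\<close>, or in
\<open>Z R\<close>, or it covers \<open>Z\<close> together with letters on both sides.\<close>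

lemma occ_glue:
  assumes "u \<noteq> []"
  shows "occ u (L @ Z @ R) + occ u Z = occ u (L @ Z) + occ u (Z @ R) +
    card {(l, r). u = l @ Z @ r \<and> l \<noteq> [] \<and> r \<noteq> [] \<and> suffix l L \<and> prefix r R}"
proof -
  let ?O = "{(x, y). L @ Z @ R = x @ u @ y}"
  let ?A = "{(x, y). L @ Z @ R = x @ u @ y \<and> suffix R y}"
  let ?B = "{(x, y). L @ Z @ R = x @ u @ y \<and> prefix L x}"
  let ?C = "{(x, y). L @ Z @ R = x @ u @ y \<and> \<not> suffix R y \<and> \<not> prefix L x}"
  have fin: "finite {(x, y). L @ Z @ R = x @ u @ y \<and> P x y}" for P by (rule finite_splits)
  have A: "card ?A = occ u (L @ Z)" unfolding occ_def
    by (rule bij_betw_same_card[symmetric], rule bij_betwI[where f = "\<lambda>(x, y). (x, y @ R)"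
          and g = "\<lambda>(x, y). (x, take (length y - length R) y)"])
       (auto simp: suffix_def)
  have B: "card ?B = occ u (Z @ R)" unfolding occ_def
    by (rule bij_betw_same_card[symmetric], rule bij_betwI[where f = "\<lambda>(x, y). (L @ x, y)"
          and g = "\<lambda>(x, y). (drop (length L) x, y)"])
       (auto simp: prefix_def)
  have AB: "card (?A \<inter> ?B) = occ u Z" unfolding occ_def
    by (rule bij_betw_same_card[symmetric], rule bij_betwI[where f = "\<lambda>(x, y). (L @ x, y @ R)"
          and g = "\<lambda>(x, y). (drop (length L) x, take (length y - length R) y)"])
       (auto simp: prefix_def suffix_def)
  have C: "card ?C = card {(l, r). u = l @ Z @ r \<and> l \<noteq> [] \<and> r \<noteq> [] \<and> suffix l L \<and> prefix r R}"
  proof (rule bij_betw_same_card[symmetric], rule bij_betwI[where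
          f = "\<lambda>(l, r). (take (length L - length l) L, drop (length r) R)"
          and g = "\<lambda>(x, y). (drop (length x) L, take (length R - length y) R)"])
    show "(\<lambda>(l, r). (take (length L - length l) L, drop (length r) R))
      \<in> {(l, r). u = l @ Z @ r \<and> l \<noteq> [] \<and> r \<noteq> [] \<and> suffix l L \<and> prefix r R} \<rightarrow> ?C"
      by (auto simp: suffix_def prefix_def dest: arg_cong[where f = length])
    show "(\<lambda>(x, y). (drop (length x) L, take (length R - length y) R))
      \<in> ?C \<rightarrow> {(l, r). u = l @ Z @ r \<and> l \<noteq> [] \<and> r \<noteq> [] \<and> suffix l L \<and> prefix r R}"
    proof (rule Pi_I)
      fix p assume "p \<in> ?C"
      then obtain x y where p: "p = (x, y)" and eq: "L @ Z @ R = x @ u @ y"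
        and ns: "\<not> suffix R y" "\<not> prefix L x" by auto
      from overlap_left[OF eq ns(2)] obtain l where l: "L = x @ l" "l \<noteq> []" .
      have "(L @ Z) @ R = (x @ u) @ y" using eq by simp
      from overlap_right[OF this ns(1)] obtain r where r: "R = r @ y" "r \<noteq> []" .
      from eq l r have "u = l @ Z @ r" by simp
      with p l r show "(case p of (x, y) \<Rightarrow> (drop (length x) L, take (length R - length y) R))
        \<in> {(l, r). u = l @ Z @ r \<and> l \<noteq> [] \<and> r \<noteq> [] \<and> suffix l L \<and> prefix r R}"
        by (auto simp: suffix_def)
    qed
  next
    fix p assume "p \<in> {(l, r). u = l @ Z @ r \<and> l \<noteq> [] \<and> r \<noteq> [] \<and> suffix l L \<and> prefix r R}"
    then show "(case case p of (l, r) \<Rightarrow> (take (length L - length l) L, drop (length r) R) of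
        (x, y) \<Rightarrow> (drop (length x) L, take (length R - length y) R)) = p"
      by (auto simp: suffix_def prefix_def)
  next
    fix p assume "p \<in> ?C"
    then obtain x y where p: "p = (x, y)" and eq: "L @ Z @ R = x @ u @ y"
      and ns: "\<not> suffix R y" "\<not> prefix L x" by auto
    from overlap_left[OF eq ns(2)] obtain l where l: "L = x @ l" "l \<noteq> []" .
    have "(L @ Z) @ R = (x @ u) @ y" using eq by simp
    from overlap_right[OF this ns(1)] obtain r where r: "R = r @ y" "r \<noteq> []" .
    show "(case case p of (x, y) \<Rightarrow> (drop (length x) L, take (length R - length y) R) of
        (l, r) \<Rightarrow> (take (length L - length l) L, drop (length r) R)) = p"
      using p l r by auto
  qed
  have "?O = (?A \<union> ?B) \<union> ?C" by auto
  then have "occ u (L @ Z @ R) = card ((?A \<union> ?B) \<union> ?C)" by (simp add: occ_def)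
  also have "\<dots> = card (?A \<union> ?B) + card ?C"
    using fin by (intro card_Un_disjoint) auto
  finally have "occ u (L @ Z @ R) = card (?A \<union> ?B) + card ?C" .
  moreover have "card ?A + card ?B = card (?A \<union> ?B) + card (?A \<inter> ?B)"
    using fin by (intro card_Un_Int) auto
  ultimately show ?thesis using A B C AB by simp
qed

text \<open>A word that is not longer than \<open>|Z| + 1\<close> cannot cover \<open>Z\<close> with letters on both sides, so that a long
\<open>Z\<close> separates what stands before it from what stands behind it.\<close>

lemma occ_sep:
  assumes "u \<noteq> []" "length u \<le> length Z + 1"
  shows "real (occ u (L @ Z @ R)) = real (occ u (L @ Z)) + real (occ u (Z @ R)) - real (occ u Z)"
proof -
  have "{(l, r). u = l @ Z @ r \<and> l \<noteq> [] \<and> r \<noteq> [] \<and> suffix l L \<and> prefix r R} = {}"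
  proof -
    have False if "u = l @ Z @ r" "l \<noteq> []" "r \<noteq> []" for l r
      using assms(2) that by (cases l; cases r) auto
    then show ?thesis by blast
  qed
  then have "occ u (L @ Z @ R) + occ u Z = occ u (L @ Z) + occ u (Z @ R)"
    using occ_glue[OF assms(1), of L Z R] by (simp only: card.empty)
  then show ?thesis by linarith
qed

lemma occ_eq_0I:
  assumes "\<And>x y. w \<noteq> x @ u @ y"
  shows "occ u w = 0"
  using assms by (auto simp: occ_def)

section \<open>Counting after a power of the twist: the upper bound\<close>

lemma finite_F_length: "finite {u \<in> F d. length u = L}"
proof -
  have "{u \<in> F d. length u = L} \<subseteq> {u. set u \<subseteq> {1..d} \<times> UNIV \<and> length u = L}"
    by (auto simp: F_iff)
  then show ?thesis by (rule finite_subset) (intro finite_lists_length_eq, simp)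
qed

lemma card_prefix_splits: "card {(X, Y). w = X @ C @ Y \<and> length X < l} \<le> l"
proof -
  have "inj_on (\<lambda>(X, Y). length X) {(X, Y). w = X @ C @ Y \<and> length X < l}"
    by (auto simp: inj_on_def)
  then have "card {(X, Y). w = X @ C @ Y \<and> length X < l} =
      card ((\<lambda>(X, Y). length X) ` {(X, Y). w = X @ C @ Y \<and> length X < l})"
    by (simp add: card_image)
  also have "\<dots> \<le> card {..<l}" by (rule card_mono) auto
  finally show ?thesis by simp
qed

lemma card_suffix_splits: "card {(X, Y). w = X @ C @ Y \<and> length Y < l} \<le> l"
proof -
  have "inj_on (\<lambda>(X, Y). length Y) {(X, Y). w = X @ C @ Y \<and> length Y < l}"
    by (auto simp: inj_on_def append_eq_append_conv)
  then have "card {(X, Y). w = X @ C @ Y \<and> length Y < l} =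
      card ((\<lambda>(X, Y). length Y) ` {(X, Y). w = X @ C @ Y \<and> length Y < l})"
    by (simp add: card_image)
  also have "\<dots> \<le> card {..<l}" by (rule card_mono) auto
  finally show ?thesis by simp
qed

text \<open>Occurrences of a core \<open>C\<close> with conditions on both sides that are decided by \<open>l\<close> and \<open>r\<close> letters are
counted by the admissible words of length \<open>l + |C| + r\<close>. The occurrences near the ends of
the word have no full window, but there are at most \<open>l + r\<close> of them.\<close>

lemma len_le_windows:
  assumes C: "C \<noteq> []"
    and P: "\<And>X p. reduced (X @ p @ C) \<Longrightarrow> length p = l \<Longrightarrow> P (X @ p) \<longleftrightarrow> P p"
    and Q: "\<And>Y q. reduced (C @ q @ Y) \<Longrightarrow> length q = r \<Longrightarrow> Q (q @ Y) \<longleftrightarrow> Q q"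
  shows "len_le d (l + length C + r) (\<lambda>w. real (card {(X, Y). w = X @ C @ Y \<and> P X \<and> Q Y}))"
proof -
  define U where "U = {u \<in> F d. length u = l + length C + r \<and>
    P (take l u) \<and> take (length C) (drop l u) = C \<and> Q (drop (l + length C) u)}"
  have finU: "finite U"
    by (rule finite_subset[OF _ finite_F_length[of d "l + length C + r"]]) (auto simp: U_def)
  have main: "\<bar>real (card {(X, Y). w = X @ C @ Y \<and> P X \<and> Q Y}) - (\<Sum>u\<in>U. 1 * real (occ u w))\<bar> \<le> real (l + r)"
    if w: "w \<in> F d" for w
  proof -
    let ?S = "{(X, Y). w = X @ C @ Y \<and> P X \<and> Q Y}"
    let ?A = "{(X, Y). w = X @ C @ Y \<and> P X \<and> Q Y \<and> l \<le> length X \<and> r \<le> length Y}"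
    let ?B = "{(X, Y). w = X @ C @ Y \<and> length X < l}"
    let ?D = "{(X, Y). w = X @ C @ Y \<and> length Y < r}"
    have fin: "finite {(X, Y). w = X @ C @ Y \<and> R X Y}" for R by (rule finite_splits)
    have "card ?S \<le> card (?A \<union> (?B \<union> ?D))" using fin by (intro card_mono) auto
    also have "\<dots> \<le> card ?A + (card ?B + card ?D)"
      by (meson card_Un_le add_left_mono order_trans)
    also have "\<dots> \<le> card ?A + (l + r)"
      using card_prefix_splits[of w C l] card_suffix_splits[of w C r] by linarith
    finally have 1: "card ?S \<le> card ?A + (l + r)" .
    have 2: "card ?A \<le> card ?S" using fin by (intro card_mono) auto
    have "card ?A = card (SIGMA u:U. {(x, y). w = x @ u @ y})"
    proof (rule bij_betw_same_card, rule bij_betwI[where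
        f = "\<lambda>(X, Y). (drop (length X - l) X @ C @ take r Y, take (length X - l) X, drop r Y)"
        and g = "\<lambda>(u, x, y). (x @ take l u, drop (l + length C) u @ y)"])
      show "(\<lambda>(X, Y). (drop (length X - l) X @ C @ take r Y, take (length X - l) X, drop r Y))
          \<in> ?A \<rightarrow> (SIGMA u:U. {(x, y). w = x @ u @ y})"
      proof (clarsimp)
        fix X Y assume *: "w = X @ C @ Y" "P X" "Q Y" "l \<le> length X" "r \<le> length Y"
        define p where "p = drop (length X - l) X"
        define q where "q = take r Y"
        obtain X0 where X: "X = X0 @ p" using append_take_drop_id[of "length X - l" X] p_def by metis
        obtain Y0 where Y: "Y = q @ Y0" using append_take_drop_id[of r Y] q_def by metis
        have len: "length p = l" "length q = r" using * by (auto simp: p_def q_def)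
        have red: "reduced (X0 @ p @ C @ q @ Y0)" using w * X Y by (simp add: F_iff)
        then have "reduced (X0 @ p @ C)" "reduced (C @ q @ Y0)"
          using reduced_append[of "X0 @ p @ C" "q @ Y0"] reduced_append[of "X0 @ p" "C @ q @ Y0"] by auto
        then have "P p" "Q q" using P[of X0 p] Q[of q Y0] len * X Y by auto
        moreover have "p @ C @ q \<in> F d"
        proof -
          have "reduced (p @ C @ q)"
            using red reduced_append[of "X0" "p @ C @ q @ Y0"] reduced_append[of "p @ C @ q" "Y0"] by auto
          then show ?thesis using w * X Y by (auto simp: F_iff)
        qed
        ultimately show "drop (length X - l) X @ C @ take r Y \<in> U"
          using len unfolding U_def p_def[symmetric] q_def[symmetric] by auto
      qed
    next
      show "(\<lambda>(u, x, y). (x @ take l u, drop (l + length C) u @ y))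
          \<in> (SIGMA u:U. {(x, y). w = x @ u @ y}) \<rightarrow> ?A"
      proof (rule Pi_I)
        fix z assume "z \<in> (SIGMA u:U. {(x, y). w = x @ u @ y})"
        then obtain u x y where z: "z = (u, x, y)" and u: "u \<in> U" and w': "w = x @ u @ y" by auto
        define p where "p = take l u"
        define q where "q = drop (l + length C) u"
        have len: "length p = l" "length q = r" using u by (auto simp: p_def q_def U_def)
        have upq: "u = p @ C @ q" using u append_take_drop_id[of l u] append_take_drop_id[of "length C" "drop l u"]
          by (simp add: U_def p_def q_def drop_drop add.commute)
        have red: "reduced (x @ p @ C @ q @ y)" using w w' upq by (simp add: F_iff)
        then have "reduced (x @ p @ C)" "reduced (C @ q @ y)"
          using reduced_append[of "x @ p @ C" "q @ y"] reduced_append[of "x @ p" "C @ q @ y"] by auto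
        then have "P (x @ p)" "Q (q @ y)" using P[of x p] Q[of q y] len u by (auto simp: U_def p_def q_def)
        then show "(case z of (u, x, y) \<Rightarrow> (x @ take l u, drop (l + length C) u @ y)) \<in> ?A"
          using len upq w' z unfolding p_def[symmetric] q_def[symmetric] by (simp flip: p_def q_def)
      qed
    next
      fix z assume "z \<in> ?A"
      then show "(case case z of (X, Y) \<Rightarrow> (drop (length X - l) X @ C @ take r Y, take (length X - l) X, drop r Y)
        of (u, x, y) \<Rightarrow> (x @ take l u, drop (l + length C) u @ y)) = z"
        by (auto split: prod.splits)
    next
      fix z assume "z \<in> (SIGMA u:U. {(x, y). w = x @ u @ y})"
      then obtain u x y where z: "z = (u, x, y)" and u: "u \<in> U" by auto
      define p where "p = take l u"
      define q where "q = drop (l + length C) u"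
      have "length p = l" "length q = r" using u by (auto simp: p_def q_def U_def)
      moreover have "u = p @ C @ q"
        using u append_take_drop_id[of l u] append_take_drop_id[of "length C" "drop l u"]
        by (simp add: U_def p_def q_def drop_drop add.commute)
      ultimately have upq: "u = p @ C @ q" "length p = l" "length q = r" by auto
      then show "(case case z of (u, x, y) \<Rightarrow> (x @ take l u, drop (l + length C) u @ y) of
        (X, Y) \<Rightarrow> (drop (length X - l) X @ C @ take r Y, take (length X - l) X, drop r Y)) = z"
        using z by simp
    qed
    also have "\<dots> = (\<Sum>u\<in>U. occ u w)"
      unfolding occ_def using finU finite_occ by (subst card_SigmaI) auto
    finally have 3: "card ?A = (\<Sum>u\<in>U. occ u w)" .
    have "(\<Sum>u\<in>U. 1 * real (occ u w)) = real (card ?A)" by (simp add: 3)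
    then show ?thesis using 1 2 by linarith
  qed
  have "[] \<notin> U" using C by (auto simp: U_def)
  then have "finite U \<and> U \<subseteq> F d - {[]} \<and> (\<forall>u\<in>U. length u \<le> l + length C + r) \<and>
     bdd_equiv d (\<lambda>w. real (card {(X, Y). w = X @ C @ Y \<and> P X \<and> Q Y})) (\<lambda>w. \<Sum>u\<in>U. 1 * real (occ u w))"
    using finU main unfolding bdd_equiv_def by (auto simp: U_def)
  then show ?thesis unfolding len_le_def by (intro exI[of _ "\<lambda>_. 1"] exI[of _ U]) 
qed

lemma b_form_good:
  assumes "b_form v m s ys k"
  shows "red_tail s ys" "nonb s" "nonb (final s ys)"
  using assms red_tail_nonb[of s ys] red_tail_final[of s ys] by (simp_all add: b_form_def)

lemma prefix_winv: "suffix (winv u) (winv v) \<longleftrightarrow> prefix u v"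
proof
  assume "suffix (winv u) (winv v)"
  then obtain z where "winv v = z @ winv u" by (auto simp: suffix_def)
  then have "v = winv (z @ winv u)" by (metis winv_simps(3))
  then show "prefix u v" by (simp add: prefix_def)
qed (auto simp: prefix_def suffix_def)

text \<open>Pulling back along \<open>T\<^sup>n\<close>: splittings of \<open>w\<close> at the core moved by \<open>-n\<close> correspond bijectively to splittings
of \<open>T\<^sup>n w\<close> at the core itself, because \<open>imL\<close> and \<open>imR\<close> are inverted by the opposite power.\<close>

lemma occ_twist_pow:
  assumes w: "reduced w" and v: "b_form v m s ys k"
  shows "occ v (twist_pow n w) = card {(X, Y). w = X @ (s # tail (shift (- n) s ys)) @ Y \<and>
    suffix (bpow m) (imL n s X) \<and> prefix (bpow k) (imR n (final s ys) Y)}"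
    (is "_ = card ?S")
proof -
  define t where "t = final s ys"
  define zs where "zs = shift (- n) s ys"
  have g: "red_tail s ys" "red_tail s zs" "nonb s" "nonb t" "final s zs = t" "shift n s zs = ys"
    using b_form_good[OF v] by (simp_all add: zs_def t_def)
  have v': "v = bpow m @ (s # tail ys) @ bpow k" using v by (simp add: b_form_def)
  let ?S' = "{(X, Y). twist_pow n w = X @ (s # tail ys) @ Y \<and> suffix (bpow m) X \<and> prefix (bpow k) Y}"
  have "occ v (twist_pow n w) = card ?S'" unfolding occ_def
    by (rule bij_betw_same_card, rule bij_betwI[where f = "\<lambda>(x, y). (x @ bpow m, bpow k @ y)"
        and g = "\<lambda>(X, Y). (take (length X - length (bpow m)) X, drop (length (bpow k)) Y)"])
       (auto simp: v' suffix_def prefix_def)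
  also have "card ?S = card ?S'"
  proof (rule bij_betw_same_card, rule bij_betwI[where f = "\<lambda>(X, Y). (imL n s X, imR n t Y)"
        and g = "\<lambda>(X, Y). (imL (- n) s X, imR (- n) t Y)"])
    show "(\<lambda>(X, Y). (imL n s X, imR n t Y)) \<in> ?S \<rightarrow> ?S'"
      using twist_pow_core[OF g(2), of _ _ n] w g by (auto simp: t_def zs_def)
    show "(\<lambda>(X, Y). (imL (- n) s X, imR (- n) t Y)) \<in> ?S' \<rightarrow> ?S"
    proof (rule Pi_I)
      fix p assume "p \<in> ?S'"
      then obtain X Y where p: "p = (X, Y)" and eq: "twist_pow n w = X @ s # tail ys @ Y"
        and ps: "suffix (bpow m) X" "prefix (bpow k) Y" by auto
      have red: "reduced (X @ s # tail ys @ Y)" by (metis eq reduced_twist_pow)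
      then have "reduced X" "reduced Y"
        using reduced_append[of "X @ s # tail ys" Y] reduced_append[of X] by auto
      then have "imL n s (imL (- n) s X) = X" "imR n t (imR (- n) t Y) = Y"
        using imL_imL[of X "- n" s] imR_imR[of Y "- n" t] by auto
      moreover have "w = imL (- n) s X @ s # tail zs @ imR (- n) t Y"
        using twist_pow_core[OF g(1) red, of "- n"] w unfolding eq[symmetric] twist_pow_twist_pow
        by (simp add: twist_pow_0 zs_def t_def)
      ultimately show "(case p of (X, Y) \<Rightarrow> (imL (- n) s X, imR (- n) t Y)) \<in> ?S"
        using p ps by (simp add: zs_def t_def)
    qed
  next
    fix p assume "p \<in> ?S"
    then obtain X Y where p: "p = (X, Y)" and eq: "w = X @ s # tail zs @ Y" by (auto simp: zs_def)
    have "reduced X" "reduced Y"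
      using w eq reduced_append[of "X @ s # tail zs" Y] reduced_append[of X] by auto
    then show "(case case p of (X, Y) \<Rightarrow> (imL n s X, imR n t Y) of (X, Y) \<Rightarrow> (imL (- n) s X, imR (- n) t Y)) = p"
      using p imL_imL imR_imR by simp
  next
    fix p assume "p \<in> ?S'"
    then obtain X Y where p: "p = (X, Y)" and eq: "twist_pow n w = X @ s # tail ys @ Y" by auto
    have "reduced (X @ s # tail ys @ Y)" by (metis eq reduced_twist_pow)
    then have "reduced X" "reduced Y"
      using reduced_append[of "X @ s # tail ys" Y] reduced_append[of X] by auto
    then show "(case case p of (X, Y) \<Rightarrow> (imL (- n) s X, imR (- n) t Y) of (X, Y) \<Rightarrow> (imL n s X, imR n t Y)) = p"
      using p imL_imL[of X "- n"] imR_imR[of Y "- n"] by simp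
  qed
  finally show ?thesis by simp
qed

lemma prefix_bpow:
  assumes "Z = [] \<or> nonb (hd Z)"
  shows "prefix (bpow k) (bpow i @ Z) \<longleftrightarrow> k = 0 \<or> 0 < k \<and> k \<le> i \<or> k < 0 \<and> i \<le> k"
proof
  assume p: "prefix (bpow k) (bpow i @ Z)"
  show "k = 0 \<or> 0 < k \<and> k \<le> i \<or> k < 0 \<and> i \<le> k"
  proof (cases "k = 0")
    case False
    have i: "i \<noteq> 0"
    proof
      assume "i = 0"
      with p False have "Z \<noteq> []" "hd Z = hd (bpow k)" by (auto simp: prefix_def hd_append)
      then show False using assms False nonbD by (auto simp: hd_bpow split: if_splits)
    qed
    have "hd (bpow k) = hd (bpow i)" using p False i
      by (metis bpow_Nil_iff(1) hd_append2 prefix_def)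
    then have s: "0 < k \<longleftrightarrow> 0 < i" using False i by (auto simp: hd_bpow split: if_splits)
    have "nat \<bar>k\<bar> \<le> nat \<bar>i\<bar>"
    proof (rule ccontr)
      assume n: "\<not> nat \<bar>k\<bar> \<le> nat \<bar>i\<bar>"
      then obtain j where k: "bpow k = bpow i @ bpow j" "j \<noteq> 0"
        using bpow_add_same_sign[of i "k - i"] s False i by (cases "0 < k") auto
      with p have "prefix (bpow j) Z" by simp
      then have "Z \<noteq> []" "hd Z = hd (bpow j)" using k by (auto simp: prefix_def hd_append)
      then show False using assms k nonbD by (auto simp: hd_bpow split: if_splits)
    qed
    with s i show ?thesis by auto
  qed simp
next
  assume "k = 0 \<or> 0 < k \<and> k \<le> i \<or> k < 0 \<and> i \<le> k"
  then have "bpow i = bpow k @ bpow (i - k)" using bpow_add_same_sign[of k "i - k"] by auto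
  then show "prefix (bpow k) (bpow i @ Z)" by simp
qed

lemma bpow_append_reduced:
  assumes "reduced (bpow i @ bpow j)" shows "bpow i @ bpow j = bpow (i + j)"
proof (cases "i = 0 \<or> j = 0")
  case False
  then have "0 \<le> i \<and> 0 \<le> j \<or> i \<le> 0 \<and> j \<le> 0"
    using assms by (auto simp: reduced_append hd_bpow last_bpow split: if_splits)
  then show ?thesis by (simp add: bpow_add_same_sign)
qed auto

text \<open>The block behind \<open>t\<close> moves by at most \<open>n\<close>. If it has at least \<open>n + |k|\<close> letters, its sign alone decides
whether \<open>b\<^sup>k\<close> is a prefix of the image; otherwise the given letters contain the whole block and the
letter behind it.\<close>

lemma prefix_imR_local:
  assumes t: "nonb t" and red: "reduced (t # q @ Y)"
    and len: "length q = (if k = 0 then 0 else n + nat \<bar>k\<bar>)"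
  shows "prefix (bpow k) (imR (int n) t (q @ Y)) \<longleftrightarrow> prefix (bpow k) (imR (int n) t q)"
proof (cases "k = 0")
  case False
  have q: "reduced q" using red by (simp add: reduced_Cons reduced_append)
  show ?thesis
  proof (cases rule: bpow_split[OF q])
    case (1 M)
    then have M: "int n + \<bar>k\<bar> = \<bar>M\<bar>" using len False by simp
    have Y: "reduced Y" using red reduced_append[of "t # q" Y] by simp
    have *: "prefix (bpow k) (imR (int n) t q) \<longleftrightarrow> 0 < k \<and> 0 < M \<or> k < 0 \<and> M < 0"
      using prefix_bpow[of "[]" k "M + expR (int n) t"] M False by (auto simp: 1 imR_bpow expR_def)
    show ?thesis
    proof (cases rule: bpow_split[OF Y])
      case Y1: (1 M')
      have r: "reduced (bpow M @ bpow M')" using red 1 Y1 by (simp add: reduced_Cons)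
      then have s: "0 \<le> M \<and> 0 \<le> M' \<or> M \<le> 0 \<and> M' \<le> 0"
        by (cases "M = 0 \<or> M' = 0") (auto simp: reduced_append hd_bpow last_bpow split: if_splits)
      have "q @ Y = bpow (M + M')" using bpow_append_reduced[OF r] 1 Y1 by simp
      then have "prefix (bpow k) (imR (int n) t (q @ Y)) \<longleftrightarrow> 0 < k \<and> 0 < M \<or> k < 0 \<and> M < 0"
        using prefix_bpow[of "[]" k "M + M' + expR (int n) t"] M False s by (auto simp: imR_bpow expR_def)
      with * show ?thesis by simp
    next
      case Y2: (2 M' u V)
      have "reduced ((t # bpow M @ bpow M') @ u # V)" using red 1 Y2 by simp
      then have r: "reduced (bpow M @ bpow M')" unfolding reduced_append[of "t # bpow M @ bpow M'"]
        by (simp add: reduced_Cons)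
      then have s: "0 \<le> M \<and> 0 \<le> M' \<or> M \<le> 0 \<and> M' \<le> 0"
        by (cases "M = 0 \<or> M' = 0") (auto simp: reduced_append hd_bpow last_bpow split: if_splits)
      have qY: "q @ Y = bpow (M + M') @ u # V" using bpow_append_reduced[OF r] 1 Y2 by simp
      have "imR (int n) t (q @ Y) = bpow (M + M' + expR n t + expL n u) @ u # imR n u V"
        unfolding qY using t Y2 red[unfolded qY] by (intro imR_Cons)
      moreover have "prefix (bpow k) (bpow (M + M' + expR n t + expL n u) @ u # imR n u V) \<longleftrightarrow>
          0 < k \<and> 0 < M \<or> k < 0 \<and> M < 0"
      proof -
        define e where "e = expR n t + expL n u"
        have e: "\<bar>e\<bar> \<le> int n" using expR_expL_bound[of "int n" t u] by (simp add: e_def)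
        have "0 < M \<Longrightarrow> \<bar>k\<bar> \<le> M + M' + e" "M < 0 \<Longrightarrow> M + M' + e \<le> - \<bar>k\<bar>" "M \<noteq> 0"
          using e M s False by auto
        then have "k \<noteq> 0 \<Longrightarrow> (k = 0 \<or> 0 < k \<and> k \<le> M + M' + e \<or> k < 0 \<and> M + M' + e \<le> k) =
            (0 < k \<and> 0 < M \<or> k < 0 \<and> M < 0)"
          by (cases "0 < M"; cases "0 < k") auto
        then show ?thesis
          using prefix_bpow[of "u # imR n u V" k "M + M' + e"] False Y2(2) by (simp add: e_def add.assoc)
      qed
      ultimately show ?thesis using * by simp
    qed
  next
    case (2 M u V)
    have "reduced ((t # q) @ Y)" using red by simp
    then have "reduced (t # q)" unfolding reduced_append by simp
    then have "imR n t q = bpow (M + expR n t + expL n u) @ u # imR n u V"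
      "imR n t (q @ Y) = bpow (M + expR n t + expL n u) @ u # imR n u (V @ Y)"
      using imR_Cons[OF t 2(2), of M V n] imR_Cons[OF t 2(2), of M "V @ Y" n] 2 red by auto
    then show ?thesis
      using prefix_bpow[of "u # imR n u V" k] prefix_bpow[of "u # imR n u (V @ Y)" k] 2 by simp
  qed
qed simp

lemma suffix_imL_local:
  assumes s: "nonb s" and red: "reduced (X @ p @ [s])"
    and len: "length p = (if m = 0 then 0 else n + nat \<bar>m\<bar>)"
  shows "suffix (bpow m) (imL (int n) s (X @ p)) \<longleftrightarrow> suffix (bpow m) (imL (int n) s p)"
proof -
  have eq: "suffix (bpow m) (imL (int n) s Z) \<longleftrightarrow> prefix (bpow (- m)) (imR (int n) (linv s) (winv Z))" for Z
    using prefix_winv[of "bpow (- m)"] by (simp add: imL_eq)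
  have "reduced (winv (X @ p @ [s]))" using red by (rule reduced_winv)
  then have "reduced (linv s # winv p @ winv X)" by simp
  then show ?thesis
    unfolding eq using prefix_imR_local[of "linv s" "winv p" "winv X" "- m" n] s len by simp
qed

text \<open>Each end with a power of \<open>b\<close> costs \<open>n + O(1)\<close> letters, and the core moved back costs
\<open>n\<close> for each moving block.\<close>

lemma len_le_occ_twist_pow:
  assumes v: "b_form v m s ys k"
  shows "\<exists>C. \<forall>n. len_le d (shear_speed v * n + C) (\<lambda>w. real (occ v (twist_pow (int n) w)))"
proof (intro exI allI)
  fix n :: nat
  define l where "l = (if m = 0 then 0 else n + nat \<bar>m\<bar>)"
  define r where "r = (if k = 0 then 0 else n + nat \<bar>k\<bar>)"
  define C where "C = s # tail (shift (- int n) s ys)"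
  have g: "red_tail s ys" "nonb s" "nonb (final s ys)"
    using b_form_good[OF v] by simp_all
  have "len_le d (l + length C + r) (\<lambda>w. real (card {(X, Y). w = X @ C @ Y \<and>
    suffix (bpow m) (imL (int n) s X) \<and> prefix (bpow k) (imR (int n) (final s ys) Y)}))"
  proof (rule len_le_windows)
    show "C \<noteq> []" by (simp add: C_def)
  next
    fix X p assume r: "reduced (X @ p @ C)" "length p = l"
    then have "reduced ((X @ p @ [s]) @ tail (shift (- int n) s ys))" by (simp add: C_def)
    then have "reduced (X @ p @ [s])" unfolding reduced_append[of "X @ p @ [s]"] by simp
    then show "suffix (bpow m) (imL (int n) s (X @ p)) = suffix (bpow m) (imL (int n) s p)"
      using suffix_imL_local[OF g(2)] r by (simp add: l_def)
  next
    fix Y q assume r: "reduced (C @ q @ Y)" "length q = r"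
    have "C \<noteq> []" "last C = final s ys" using last_core[of s "shift (- int n) s ys"] by (simp_all add: C_def)
    then have "C = butlast C @ [final s ys]" by (metis append_butlast_last_id)
    then have "reduced (butlast C @ final s ys # q @ Y)" using r(1)
      by (metis append.assoc append_Cons append_Nil)
    then have "reduced (final s ys # q @ Y)" unfolding reduced_append[of "butlast C"] by simp
    then show "prefix (bpow k) (imR (int n) (final s ys) (q @ Y)) = prefix (bpow k) (imR (int n) (final s ys) q)"
      using prefix_imR_local[OF g(3)] r by (simp add: r_def)
  qed
  then have *: "len_le d (l + length C + r) (\<lambda>w. real (occ v (twist_pow (int n) w)))"
    by (rule len_le_cong) (simp add: occ_twist_pow[OF _ v] C_def F_iff)
  have "length (tail (shift (- int n) s ys)) \<le> length (tail ys) + n * shear_count s ys"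
  proof -
    have "int (length (tail (shift (- int n) s ys))) \<le> int (length (tail ys)) + int n * int (shear_count s ys)"
      using length_tail_shift(1)[of "- int n" s ys] by simp
    then show ?thesis unfolding of_nat_mult[symmetric] of_nat_add[symmetric] of_nat_le_iff .
  qed
  then have "l + length C + r \<le> shear_speed v * n + (nat \<bar>m\<bar> + nat \<bar>k\<bar> + length (tail ys) + 1)"
    by (simp add: shear_speed_form[OF v] l_def r_def C_def algebra_simps)
  with * show "len_le d (shear_speed v * n + (nat \<bar>m\<bar> + nat \<bar>k\<bar> + length (tail ys) + 1))
      (\<lambda>w. real (occ v (twist_pow (int n) w)))" by (rule len_le_mono)
qed

text \<open>One-sided estimates of the growth of the length of \<open>f \<circ> T\<^sup>n\<close>. The lower one is vacuous if
there are no representatives at all; it is of interest together with the upper one.\<close>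

definition upper_bd :: "nat \<Rightarrow> (word \<Rightarrow> real) \<Rightarrow> nat \<Rightarrow> bool" where
  "upper_bd d f r \<longleftrightarrow> (\<exists>C. \<forall>n. len_le d (r * n + C) (\<lambda>w. f (twist_pow (int n) w)))"

definition lower_bd :: "nat \<Rightarrow> (word \<Rightarrow> real) \<Rightarrow> nat \<Rightarrow> bool" where
  "lower_bd d f r \<longleftrightarrow> (\<exists>C. \<forall>n\<ge>C. \<forall>L. len_le d L (\<lambda>w. f (twist_pow (int n) w)) \<longrightarrow> r * n \<le> L + C)"

lemma lower_bd_0: "lower_bd d f 0"
  by (simp add: lower_bd_def)

lemma upper_bd_mono:
  assumes "upper_bd d f r" "r \<le> r'" shows "upper_bd d f r'"
proof -
  obtain C where "\<forall>n. len_le d (r * n + C) (\<lambda>w. f (twist_pow (int n) w))"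
    using assms(1) by (auto simp: upper_bd_def)
  then have "\<forall>n. len_le d (r' * n + C) (\<lambda>w. f (twist_pow (int n) w))"
    using assms(2) by (meson len_le_mono add_le_mono1 mult_le_mono1)
  then show ?thesis by (auto simp: upper_bd_def)
qed

lemma upper_bd_scale: "upper_bd d f r \<Longrightarrow> upper_bd d (\<lambda>w. c * f w) r"
  unfolding upper_bd_def using len_le_scale by blast

lemma upper_bd_add:
  assumes "upper_bd d f r" "upper_bd d g r" shows "upper_bd d (\<lambda>w. f w + g w) r"
proof -
  obtain C where C: "\<forall>n. len_le d (r * n + C) (\<lambda>w. f (twist_pow (int n) w))" using assms(1) by (auto simp: upper_bd_def)
  obtain D where D: "\<forall>n. len_le d (r * n + D) (\<lambda>w. g (twist_pow (int n) w))" using assms(2) by (auto simp: upper_bd_def)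
  have "len_le d (r * n + (C + D)) (\<lambda>w. f (twist_pow (int n) w) + g (twist_pow (int n) w))" for n
    using C D by (intro len_le_add) (auto intro: len_le_mono)
  then show ?thesis by (auto simp: upper_bd_def)
qed

lemma upper_bd_zero: "upper_bd d (\<lambda>w. 0) r"
  by (simp add: upper_bd_def len_le_zero)

lemma upper_bd_sum:
  "finite K \<Longrightarrow> (\<And>i. i \<in> K \<Longrightarrow> upper_bd d (f i) r) \<Longrightarrow> upper_bd d (\<lambda>w. \<Sum>i\<in>K. f i w) r"
  by (induction K rule: finite_induct) (auto intro: upper_bd_zero upper_bd_add)

lemma upper_bd_phi_form:
  assumes "b_form v m s ys k"
  shows "upper_bd d (phi v) (shear_speed v)"
proof -
  have v: "upper_bd d (\<lambda>w. real (occ u w)) (shear_speed u)" if "b_form u m s ys k" for u m s ys k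
    unfolding upper_bd_def using len_le_occ_twist_pow[OF that] .
  have "shear_speed (winv v) = shear_speed v"
    using shear_speed_form[OF b_form_winv[OF assms]] shear_speed_form[OF assms] by (simp add: rev_tail_shear_count)
  then have "upper_bd d (\<lambda>w. real (occ v w) + (-1) * real (occ (winv v) w)) (shear_speed v)"
    using v[OF assms] v[OF b_form_winv[OF assms]] by (intro upper_bd_add upper_bd_scale) simp_all
  then show ?thesis by (simp add: phi_def[abs_def])
qed

section \<open>The homomorphism counting b\<close>

lemma occ_letter: "occ [x] w = count_list w x"
proof (induction w)
  case Nil then show ?case by (simp add: occ_def)
next
  case (Cons y w)
  define J where "J = (\<lambda>(p, q). (y # p, q)) ` {(p, q). w = p @ [x] @ q}"
  have "card J = occ [x] w"
    unfolding occ_def J_def by (rule card_image) (auto simp: inj_on_def)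
  moreover have "finite J" unfolding J_def by (rule finite_imageI[OF finite_occ])
  moreover have "([], w) \<notin> J" by (auto simp: J_def)
  moreover have "{(p, q). y # w = p @ [x] @ q} = (if y = x then insert ([], w) J else J)"
    by (auto simp: Cons_eq_append_conv image_iff J_def)
  ultimately have "occ [x] (y # w) = occ [x] w + (if y = x then 1 else 0)"
    unfolding occ_def[of "[x]" "y # w"] by simp
  then show ?case using Cons by simp
qed

lemma phi_letter: "phi [x] w = real (count_list w x) - real (count_list w (linv x))"
  by (simp add: phi_def occ_letter)

lemma phi_letter_reduce: "phi [x] (reduce w) = phi [x] w"
proof (induction w)
  case (Cons y w)
  have "phi [x] (push y u) = phi [x] (y # u)" for u
    by (cases u) (auto simp: phi_letter push_def)
  moreover have "reduce (y # w) = push y (reduce w)" by (simp add: reduce_def)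
  ultimately show ?case using Cons by (simp add: phi_letter)
qed (simp add: reduce_def)

lemma count_bpow: "phi [b] (bpow m) = m"
proof -
  have "count_list (replicate k y) x = (if y = x then k else 0)" for k and x y :: letter
    by (induction k) auto
  then show ?thesis by (auto simp: phi_letter bpow_def)
qed

text \<open>The exponent sum of \<open>b\<close> is additive and invariant under reduction, and each \<open>a\<close> contributes \<open>n\<close> to it.\<close>

lemma phi_b_twist_pow: "phi [b] (twist_pow n w) = phi [b] w + n * phi [a] w"
proof -
  have "phi [b] (twist_subst n w) = phi [b] w + n * phi [a] w"
  proof (induction w)
    case (Cons y w)
    have "phi [b] (twist_subst n (y # w)) = expL n y + phi [b] [y] + expR n y + phi [b] (twist_subst n w)"
      unfolding count_bpow[symmetric] by (simp add: phi_letter)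
    moreover have "phi [b] (y # w) = phi [b] [y] + phi [b] w" "phi [a] (y # w) = phi [a] [y] + phi [a] w"
      by (simp_all add: phi_letter)
    moreover have "real_of_int (expL n y + expR n y) = n * phi [a] [y]"
      by (auto simp: phi_letter expR_def expL_def)
    ultimately show ?case using Cons by (simp add: algebra_simps)
  qed (simp add: phi_letter)
  then show ?thesis by (simp add: twist_pow_def phi_letter_reduce)
qed

lemma upper_bd_b:
  assumes "2 \<le> d" shows "upper_bd d (phi [b]) 0"
proof -
  have F: "[a] \<in> F d" "[b] \<in> F d" "[linv a] \<in> F d" "[linv b] \<in> F d"
    using assms by (auto simp: F_iff gen_a_def gen_b_def linv_def)
  have ph: "len_le d 1 (phi [x])" if "[x] \<in> F d" "[linv x] \<in> F d" for x
    using len_le_diff[OF len_le_occ[of "[x]" d 1] len_le_occ[of "[linv x]" d 1]] that by (simp add: phi_def[abs_def])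
  have "len_le d 1 (\<lambda>w. phi [b] (twist_pow (int n) w))" for n
    unfolding phi_b_twist_pow using F ph by (intro len_le_add len_le_scale) auto
  then show ?thesis unfolding upper_bd_def by (intro exI[of _ 1]) simp
qed

section \<open>A test for long words\<close>

text \<open>Between powers of \<open>b\<close> such words can be concatenated without cancellation.\<close>

definition nonb_ends :: "word \<Rightarrow> bool" where
  "nonb_ends w \<longleftrightarrow> w \<noteq> [] \<and> nonb (hd w) \<and> nonb (last w)"

text \<open>The periodic words by which functions of small length are tested; \<open>y\<close> is a long power of \<open>b\<close>, which
separates the wagons and is fixed by the twist.\<close>

definition train :: "word \<Rightarrow> word \<Rightarrow> word \<Rightarrow> nat \<Rightarrow> word" where
  "train y W W' N = y @ concat (replicate N (W @ y @ W' @ y))"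

lemma occ_train:
  assumes "u \<noteq> []" "length u \<le> length y + 1"
  shows "real (occ u (train y W W' N)) = real (occ u y) +
    real N * (real (occ u (y @ W @ y)) + real (occ u (y @ W' @ y)) - 2 * real (occ u y))"
proof (induction N)
  case (Suc N)
  define R where "R = concat (replicate N (W @ y @ W' @ y))"
  have "real (occ u (train y W W' (Suc N))) = real (occ u ((y @ W) @ y @ (W' @ y @ R)))"
    by (simp add: train_def R_def)
  also have "\<dots> = real (occ u (y @ W @ y)) + real (occ u ((y @ W') @ y @ R)) - real (occ u y)"
    by (subst occ_sep[OF assms]) simp
  also have "real (occ u ((y @ W') @ y @ R)) =
      real (occ u (y @ W' @ y)) + real (occ u (y @ R)) - real (occ u y)"
    by (subst occ_sep[OF assms]) simp
  finally show ?case using Suc by (simp add: train_def R_def algebra_simps)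
qed (simp add: train_def)

lemma reduced_insert:
  assumes "M \<noteq> 0" "nonb_ends W" "reduced W" "reduced (bpow M @ R)"
  shows "reduced (bpow M @ W @ bpow M @ R)"
  using assms nonbD[of "hd W"] nonbD[of "last W"] nonbD[of "linv (last W)"]
  by (auto simp: reduced_append nonb_ends_def hd_bpow last_bpow)

lemma reduced_train:
  assumes "M \<noteq> 0" "nonb_ends W" "reduced W" "nonb_ends W'" "reduced W'"
  shows "reduced (train (bpow M) W W' N)"
proof (induction N)
  case (Suc N)
  then show ?case
    using reduced_insert[OF assms(1-3) reduced_insert[OF assms(1,4,5)]] by (simp add: train_def)
qed (simp add: train_def)

lemma train_in_F:
  assumes "2 \<le> d" "M \<noteq> 0" "nonb_ends W" "W \<in> F d" "nonb_ends W'" "W' \<in> F d"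
  shows "train (bpow M) W W' N \<in> F d"
proof -
  have "fst ` set (bpow M) \<subseteq> {1..d}"
    using set_bpow[of M] assms(1) by (auto simp: gen_b_def linv_def)
  then have "fst ` set (train (bpow M) W W' N) \<subseteq> {1..d}"
    using assms by (auto simp: train_def F_iff)
  then show ?thesis using reduced_train[OF assms(2,3) _ assms(5)] assms by (simp add: F_iff)
qed

lemma twist_pow_train:
  assumes "M \<noteq> 0" "nonb_ends V" "nonb_ends V'" "twist_pow n W = V" "twist_pow n W' = V'"
  shows "twist_pow n (train (bpow M) W W' N) = train (bpow M) V V' N"
proof -
  have V: "reduced V" "reduced V'" using assms(4,5) by auto
  have *: "reduce (twist_subst n W) = reduce V" "reduce (twist_subst n W') = reduce V'"
    using assms(4,5) V by (simp_all add: twist_pow_def reduce_id)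
  have **: "reduce (twist_subst n (W @ bpow M @ W' @ bpow M)) = reduce (V @ bpow M @ V' @ bpow M)"
    unfolding twist_subst_simps twist_subst_bpow by (rule reduce_cong[OF *(1) reduce_append_right[OF reduce_append_left[OF *(2)]]])
  have "reduce (twist_subst n (concat (replicate N (W @ bpow M @ W' @ bpow M)))) =
      reduce (concat (replicate N (V @ bpow M @ V' @ bpow M)))"
  proof (induction N)
    case (Suc N)
    show ?case using reduce_cong[OF ** Suc] by simp
  qed simp
  then have "twist_pow n (train (bpow M) W W' N) = reduce (train (bpow M) V V' N)"
    unfolding twist_pow_def train_def twist_subst_simps twist_subst_bpow by (rule reduce_append_right)
  then show ?thesis using reduced_train[OF assms(1,2) V(1) assms(3) V(2)] by (simp add: reduce_id)
qed

definition cross :: "word \<Rightarrow> word \<Rightarrow> word \<Rightarrow> word \<Rightarrow> word \<Rightarrow> real" where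
  "cross u W11 W22 W12 W21 = real (occ u W11) + real (occ u W22) - real (occ u W12) - real (occ u W21)"

text \<open>A function of length at most \<open>L\<close> takes the same value on the two trains that contain the four
combinations in a different pairing, because \<open>x\<close> and \<open>y\<close> separate. The given function differs
on them by a nonzero multiple of the number of periods, which is unbounded.\<close>

lemma not_len_le:
  fixes M :: int
  assumes d: "2 \<le> d" and J: "finite J" "[] \<notin> J" "\<And>u. u \<in> J \<Longrightarrow> length u \<le> nat M + 1"
    and M: "0 < M" and L: "L \<le> length x + 1" "L \<le> nat M + 1"
    and W: "\<And>p q. p \<in> {p1, p2} \<Longrightarrow> q \<in> {q1, q2} \<Longrightarrow> p @ x @ q \<in> F d \<and> nonb_ends (p @ x @ q)"
    and V: "twist_pow n (p1 @ x @ q1) = V11" "twist_pow n (p2 @ x @ q2) = V22"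
      "twist_pow n (p1 @ x @ q2) = V12" "twist_pow n (p2 @ x @ q1) = V21"
    and nb: "nonb_ends V11" "nonb_ends V22" "nonb_ends V12" "nonb_ends V21"
    and cross: "(\<Sum>u\<in>J. \<beta> u * cross u (bpow M @ V11 @ bpow M)
      (bpow M @ V22 @ bpow M) (bpow M @ V12 @ bpow M) (bpow M @ V21 @ bpow M)) \<noteq> 0"
  shows "\<not> len_le d L (\<lambda>w. \<Sum>u\<in>J. \<beta> u * real (occ u (twist_pow n w)))"
proof
  assume "len_le d L (\<lambda>w. \<Sum>u\<in>J. \<beta> u * real (occ u (twist_pow n w)))"
  then obtain \<gamma> U B where U: "finite U" "U \<subseteq> F d - {[]}" "\<forall>u\<in>U. length u \<le> L"
    and B: "\<forall>w\<in>F d. \<bar>(\<Sum>u\<in>J. \<beta> u * real (occ u (twist_pow n w))) - (\<Sum>u\<in>U. \<gamma> u * real (occ u w))\<bar> \<le> B"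
    unfolding len_le_def bdd_equiv_def by blast
  define y where "y = bpow M"
  define E1 where "E1 N = train y (p1 @ x @ q1) (p2 @ x @ q2) N" for N
  define E2 where "E2 N = train y (p1 @ x @ q2) (p2 @ x @ q1) N" for N
  have leny: "length y = nat M" using M by (simp add: y_def)
  have E: "E1 N \<in> F d" "E2 N \<in> F d" for N
    unfolding E1_def E2_def y_def using M W d by (intro train_in_F; simp)+
  have T: "twist_pow n (E1 N) = train y V11 V22 N" "twist_pow n (E2 N) = train y V12 V21 N" for N
    unfolding E1_def E2_def y_def using M V nb by (intro twist_pow_train; simp)+
  have same: "occ u (E1 N) = occ u (E2 N)" if "u \<in> U" for u N
  proof -
    have u: "u \<noteq> []" "length u \<le> length x + 1" "length u \<le> length y + 1"
      using U that L leny by auto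
    have "real (occ u (y @ (p @ x @ q) @ y)) =
        real (occ u (y @ p @ x)) + real (occ u (x @ q @ y)) - real (occ u x)" for p q
      using occ_sep[OF u(1,2), of "y @ p" "q @ y"] by simp
    then have "real (occ u (E1 N)) = real (occ u (E2 N))"
      unfolding E1_def E2_def occ_train[OF u(1,3)] by simp
    then show ?thesis by simp
  qed
  define D where "D = (\<Sum>u\<in>J. \<beta> u * cross u (bpow M @ V11 @ bpow M)
      (bpow M @ V22 @ bpow M) (bpow M @ V12 @ bpow M) (bpow M @ V21 @ bpow M))"
  have diff: "(\<Sum>u\<in>J. \<beta> u * real (occ u (twist_pow n (E1 N)))) - (\<Sum>u\<in>J. \<beta> u * real (occ u (twist_pow n (E2 N))))
      = real N * D" for N
  proof -
    have "\<beta> u * real (occ u (twist_pow n (E1 N))) - \<beta> u * real (occ u (twist_pow n (E2 N))) =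
      real N * (\<beta> u * cross u (bpow M @ V11 @ bpow M)
        (bpow M @ V22 @ bpow M) (bpow M @ V12 @ bpow M) (bpow M @ V21 @ bpow M))" if "u \<in> J" for u
    proof -
      have u: "u \<noteq> []" "length u \<le> length y + 1" using J that leny by auto
      show ?thesis unfolding T occ_train[OF u] cross_def by (simp add: y_def algebra_simps)
    qed
    then show ?thesis unfolding D_def sum_distrib_left sum_subtractf[symmetric] by (rule sum.cong[OF refl])
  qed
  have bound: "real N * \<bar>D\<bar> \<le> 2 * B" for N
  proof -
    have "\<bar>real N * D\<bar> \<le> B + B"
      using bspec[OF B E(1)[of N]] bspec[OF B E(2)[of N]] diff[of N] same by (simp add: abs_le_iff)
    then show ?thesis by (simp add: abs_mult)
  qed
  have "D \<noteq> 0" using cross by (simp add: D_def)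
  then obtain N :: nat where "2 * B < real N * \<bar>D\<bar>" using reals_Archimedean3[of "\<bar>D\<bar>"] by auto
  with bound[of N] show False by simp
qed

text \<open>If the four words share their middle part \<open>Z\<close>, everything cancels in the alternating sum but the
occurrences that cover \<open>Z\<close> with letters on both sides.\<close>

lemma cross_product:
  assumes "u \<noteq> []"
  shows "cross u (L1 @ Z @ R1) (L2 @ Z @ R2) (L1 @ Z @ R2) (L2 @ Z @ R1) =
    (let c = \<lambda>L R. real (card {(l, r). u = l @ Z @ r \<and> l \<noteq> [] \<and> r \<noteq> [] \<and> suffix l L \<and> prefix r R})
     in c L1 R1 + c L2 R2 - c L1 R2 - c L2 R1)"
proof -
  have "real (occ u (L @ Z @ R)) = real (occ u (L @ Z)) + real (occ u (Z @ R)) - real (occ u Z) +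
    real (card {(l, r). u = l @ Z @ r \<and> l \<noteq> [] \<and> r \<noteq> [] \<and> suffix l L \<and> prefix r R})" for L R
    using arg_cong[OF occ_glue[OF assms, of L Z R], of real] by simp
  then show ?thesis by (simp add: cross_def Let_def)
qed

lemma lower_bdI:
  assumes "\<And>n L. n \<ge> N \<Longrightarrow> len_le d L (\<lambda>w. f (twist_pow (int n) w)) \<Longrightarrow> r * n \<le> L + C"
  shows "lower_bd d f r"
  unfolding lower_bd_def
proof (intro exI[of _ "max N C"] allI impI)
  fix n L assume "max N C \<le> n" "len_le d L (\<lambda>w. f (twist_pow (int n) w))"
  then have "r * n \<le> L + C" using assms by simp
  then show "r * n \<le> L + max N C" by linarith
qed

lemma suffix_bpow_iff:
  assumes "length l \<le> nat \<bar>i\<bar>"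
  shows "suffix l (A @ bpow i) \<longleftrightarrow> l = bpow (sgn i * int (length l))"
proof -
  define k where "k = sgn i * int (length l)"
  have "int (length l) \<le> \<bar>i\<bar>" using assms by linarith
  then have "0 \<le> i - k \<and> 0 \<le> k \<or> i - k \<le> 0 \<and> k \<le> 0"
    by (cases "0 < i"; cases "i = 0") (auto simp: k_def)
  then have i: "bpow i = bpow (i - k) @ bpow k" using bpow_add_same_sign[of "i - k" k] by simp
  have len: "length (bpow k) = length l" using assms by (cases "i = 0") (auto simp: abs_mult k_def)
  show ?thesis unfolding k_def[symmetric]
  proof
    assume "suffix l (A @ bpow i)"
    then obtain z where "(A @ bpow (i - k)) @ bpow k = z @ l" by (auto simp: suffix_def i)
    then show "l = bpow k" using append_eq_append_conv[of "bpow k" l "A @ bpow (i - k)" z] len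
      by (simp del: append_assoc)
  next
    assume "l = bpow k"
    then show "suffix l (A @ bpow i)" by (simp add: i suffix_def)
  qed
qed

lemma prefix_bpow_iff:
  assumes "length r \<le> nat \<bar>i\<bar>"
  shows "prefix r (bpow i @ A) \<longleftrightarrow> r = bpow (sgn i * int (length r))"
proof -
  define k where "k = sgn i * int (length r)"
  have "int (length r) \<le> \<bar>i\<bar>" using assms by linarith
  then have "0 \<le> k \<and> 0 \<le> i - k \<or> k \<le> 0 \<and> i - k \<le> 0"
    by (cases "0 < i"; cases "i = 0") (auto simp: k_def)
  then have i: "bpow i = bpow k @ bpow (i - k)" using bpow_add_same_sign[of k "i - k"] by simp
  have len: "length (bpow k) = length r" using assms by (cases "i = 0") (auto simp: abs_mult k_def)
  show ?thesis unfolding k_def[symmetric]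
  proof
    assume "prefix r (bpow i @ A)"
    then obtain z where "bpow k @ (bpow (i - k) @ A) = r @ z" by (auto simp: prefix_def i)
    then show "r = bpow k" using append_eq_append_conv[of "bpow k" r "bpow (i - k) @ A" z] len by auto
  next
    assume "r = bpow k"
    then show "prefix r (bpow i @ A)" by (simp add: i prefix_def)
  qed
qed

lemma length_bound:
  assumes "finite J"
  obtains c :: int where "0 < c" "\<And>u. u \<in> J \<Longrightarrow> int (length u) \<le> c"
proof (rule that[of "int (Suc (Max (insert 0 (length ` J))))"])
  fix u assume "u \<in> J"
  then have "length u \<le> Max (insert 0 (length ` J))" using assms by (intro Max_ge) auto
  then show "int (length u) \<le> int (Suc (Max (insert 0 (length ` J))))" by simp
qed simp

text \<open>With long blocks of \<open>b\<close> around a core, only words with this core and outer powers of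
\<open>b\<close> of the right signs reach beyond it on both sides.\<close>

lemma card_bb:
  assumes g: "red_tail s ys" and i: "length u \<le> nat \<bar>i\<bar>" "length u \<le> nat \<bar>j\<bar>"
  shows "card {(l, r). u = l @ (s # tail ys) @ r \<and> l \<noteq> [] \<and> r \<noteq> [] \<and>
      suffix l (A @ bpow i) \<and> prefix r (bpow j @ B)} =
    of_bool (\<exists>p q. b_form u p s ys q \<and> p * i > 0 \<and> q * j > 0)" (is "card ?S = of_bool ?P")
proof (cases ?P)
  case True
  then obtain p q where f: "b_form u p s ys q" and s: "p * i > 0" "q * j > 0" by blast
  have u: "u = bpow p @ (s # tail ys) @ bpow q" using f by (simp add: b_form_def)
  have sg: "sgn i * \<bar>p\<bar> = p" "sgn j * \<bar>q\<bar> = q"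
    using s by (auto simp: zero_less_mult_iff)
  have "?S = {(bpow p, bpow q)}"
  proof (intro equalityI subsetI)
    fix z assume "z \<in> ?S"
    then obtain l r where z: "z = (l, r)" and lr: "u = l @ (s # tail ys) @ r" "l \<noteq> []" "r \<noteq> []"
      "suffix l (A @ bpow i)" "prefix r (bpow j @ B)" by auto
    have "length l \<le> nat \<bar>i\<bar>" "length r \<le> nat \<bar>j\<bar>" using i lr(1) by auto
    then obtain p' q' where l: "l = bpow p'" and r: "r = bpow q'"
      using lr suffix_bpow_iff prefix_bpow_iff by metis
    then have "b_form u p' s ys q'" using lr(1) g by (simp add: b_form_def)
    then have "p' = p" "q' = q" using b_form_unique[OF f] by auto
    then show "z \<in> {(bpow p, bpow q)}" using z l r by simp
  next
    fix z assume "z \<in> {(bpow p, bpow q)}"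
    moreover have "suffix (bpow p) (A @ bpow i)" "prefix (bpow q) (bpow j @ B)"
      using suffix_bpow_iff[of "bpow p" i A] prefix_bpow_iff[of "bpow q" j B] i u sg by auto
    moreover have "p \<noteq> 0" "q \<noteq> 0" using s by auto
    ultimately show "z \<in> ?S" using u by auto
  qed
  then show ?thesis using True by simp
next
  case False
  have "?S = {}"
  proof (rule equals0I)
    fix z assume "z \<in> ?S"
    then obtain l r where z: "z = (l, r)" and lr: "u = l @ (s # tail ys) @ r" "l \<noteq> []" "r \<noteq> []"
      "suffix l (A @ bpow i)" "prefix r (bpow j @ B)" by auto
    have "length l \<le> nat \<bar>i\<bar>" "length r \<le> nat \<bar>j\<bar>" using i lr(1) by auto
    then have l: "l = bpow (sgn i * int (length l))" and r: "r = bpow (sgn j * int (length r))"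
      using lr suffix_bpow_iff prefix_bpow_iff by metis+
    define p where "p = sgn i * int (length l)"
    define q where "q = sgn j * int (length r)"
    have "b_form u p s ys q" using lr(1) g l r by (simp add: b_form_def p_def q_def)
    moreover have "length l > 0" "length r > 0" "i \<noteq> 0" "j \<noteq> 0" using lr i by auto
    then have "p * i > 0" "q * j > 0"
      by (auto simp: p_def q_def zero_less_mult_iff sgn_if)
    ultimately show False using False by blast
  qed
  then show ?thesis using False by (simp only: card.empty of_bool_eq)
qed

lemma word_in_F: "w \<in> F d \<longleftrightarrow> reduced w \<and> (\<forall>x\<in>set w. fst x \<in> {1..d})"
  by (auto simp: F_iff)

lemma letters_bpow: "2 \<le> d \<Longrightarrow> x \<in> set (bpow m) \<Longrightarrow> fst x \<in> {1..d}"
  using set_bpow[of m] by (auto simp: gen_b_def linv_def)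

definition letters_in :: "nat \<Rightarrow> (int \<times> letter) list \<Rightarrow> bool" where
  "letters_in d ys \<longleftrightarrow> (\<forall>t\<in>snd ` set ys. fst t \<in> {1..d})"

lemma letters_in_simps [simp]: "letters_in d []" "letters_in d ((m, t) # ys) \<longleftrightarrow> fst t \<in> {1..d} \<and> letters_in d ys"
  "letters_in d (xs @ ys) \<longleftrightarrow> letters_in d xs \<and> letters_in d ys"
  by (auto simp: letters_in_def)

lemma letters_in_shift [simp]: "letters_in d (shift n s ys) \<longleftrightarrow> letters_in d ys"
  by (induction n s ys rule: shift.induct) auto

lemma letters_in_tail: "2 \<le> d \<Longrightarrow> (\<forall>x\<in>set (tail ys). fst x \<in> {1..d}) \<longleftrightarrow> letters_in d ys"
  by (induction ys rule: tail.induct) (auto dest: letters_bpow)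

lemma core_in_F: "2 \<le> d \<Longrightarrow> red_tail s ys \<Longrightarrow> fst s \<in> {1..d} \<Longrightarrow> letters_in d ys \<Longrightarrow> s # tail ys \<in> F d"
  using red_tail_reduced[of s ys] letters_in_tail[of d ys] by (auto simp: word_in_F)

lemma core_nonb_ends: "red_tail s ys \<Longrightarrow> nonb_ends (s # tail ys)"
  unfolding nonb_ends_def last_core using red_tail_nonb[of s ys] red_tail_final[of s ys] by auto

lemma b_form_letters:
  assumes "2 \<le> d" "b_form v m s ys k" "v \<in> F d"
  shows "fst s \<in> {1..d}" "letters_in d ys"
  using assms letters_in_tail[of d ys] by (auto simp: b_form_def word_in_F)

lemma twist_pow_a_core:
  assumes "red_tail a ys" "final a ys = a'"
  shows "twist_pow n (a # tail ys) = a # tail (shift n a ys)"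
  using twist_pow_core_alone[OF assms(1), of n] assms(2) by simp

lemma sum_single:
  assumes "finite J" "v \<in> J" "\<And>u. u \<in> J \<Longrightarrow> u \<noteq> v \<Longrightarrow> h u = (0::real)"
  shows "(\<Sum>u\<in>J. \<beta> u * h u) = \<beta> v * h v"
proof -
  have "(\<Sum>u\<in>J. \<beta> u * h u) = (\<Sum>u\<in>{v}. \<beta> u * h u)"
    using assms by (intro sum.mono_neutral_right) auto
  then show ?thesis by simp
qed

lemma bpow_1: "bpow 1 = [b]"
  by (simp add: bpow_def)

text \<open>The test for words that start with \<open>a\<close> and end with \<open>a\<^sup>-\<^sup>1\<close>. No block at their ends moves,
so that \<open>T\<^sup>n\<close> acts on each of them by shifting the list of blocks.\<close>

lemma not_len_le_cores:
  fixes c :: int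
  assumes V: "a # tail (shift n a y11) = V11" "a # tail (shift n a y12) = V12"
      "a # tail (shift n a y21) = V21" "a # tail (shift n a y22) = V22"
    and d: "2 \<le> d" and J: "finite J" "J \<subseteq> F d - {[]}"
    and c: "0 < c" "\<And>u. u \<in> J \<Longrightarrow> int (length u) \<le> c" and L: "L \<le> length x + 1"
    and W: "p1 @ x @ q1 = a # tail y11" "p1 @ x @ q2 = a # tail y12"
      "p2 @ x @ q1 = a # tail y21" "p2 @ x @ q2 = a # tail y22"
    and y: "\<And>ys. ys \<in> {y11, y12, y21, y22} \<Longrightarrow> red_tail a ys \<and> final a ys = a' \<and> letters_in d ys"
    and cross: "\<And>M. c \<le> M \<Longrightarrow> (\<Sum>u\<in>J. \<beta> u * cross u (bpow M @ V11 @ bpow M)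
      (bpow M @ V22 @ bpow M) (bpow M @ V12 @ bpow M) (bpow M @ V21 @ bpow M)) \<noteq> 0"
  shows "\<not> len_le d L (\<lambda>w. \<Sum>u\<in>J. \<beta> u * real (occ u (twist_pow n w)))"
proof -
  have ab: "fst a \<in> {1..d}" using d by (simp add: gen_a_def)
  have W': "p @ x @ q \<in> F d \<and> nonb_ends (p @ x @ q)" if "p \<in> {p1, p2}" "q \<in> {q1, q2}" for p q
  proof -
    have "p @ x @ q \<in> {a # tail y11, a # tail y12, a # tail y21, a # tail y22}"
      using that W by blast
    then obtain ys where ys: "p @ x @ q = a # tail ys" "ys \<in> {y11, y12, y21, y22}" by blast
    show ?thesis unfolding ys(1) using y[OF ys(2)] core_in_F[OF d _ ab] core_nonb_ends by blast
  qed
  have T: "twist_pow n (p1 @ x @ q1) = V11" "twist_pow n (p2 @ x @ q2) = V22"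
    "twist_pow n (p1 @ x @ q2) = V12" "twist_pow n (p2 @ x @ q1) = V21"
    unfolding W V[symmetric] using y by (auto intro: twist_pow_a_core)
  have nb: "nonb_ends (a # tail (shift n a ys))" if "ys \<in> {y11, y12, y21, y22}" for ys
    using y[OF that] by (intro core_nonb_ends) simp
  define M where "M = int (length x) + c"
  show ?thesis
  proof (rule not_len_le[OF d J(1) _ _ _ L _ W' T])
    show "[] \<notin> J" using J by auto
    show "length u \<le> nat M + 1" if "u \<in> J" for u using c(2)[OF that] c(1) by (simp add: M_def)
    show "0 < M" using c(1) by (simp add: M_def)
    show "L \<le> nat M + 1" using L c(1) by (simp add: M_def)
    show "(\<Sum>u\<in>J. \<beta> u * cross u (bpow M @ V11 @ bpow M)
      (bpow M @ V22 @ bpow M) (bpow M @ V12 @ bpow M) (bpow M @ V21 @ bpow M)) \<noteq> 0"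
      by (rule cross) (simp add: M_def)
  qed (unfold V[symmetric], use nb in auto)
qed

section \<open>Lower bound from a b-and-b element\<close>

text \<open>The outer blocks of \<open>x\<close> are chosen such that, after \<open>T\<^sup>n\<close>, their exponents are at least \<open>c\<close> or at most
\<open>-c\<close>, depending on whether the letter beyond them is \<open>a\<close> or \<open>a\<^sup>-\<^sup>1\<close>. The four
combinations realise all pairs of signs, and the alternating sum picks out the words with the core of
\<open>v\<close> and both outer powers nontrivial.\<close>

lemma lower_bd_b_and_b:
  assumes d: "2 \<le> d" and J: "finite J" "J \<subseteq> F d - {[]}" and v: "v \<in> J" "\<beta> v \<noteq> 0"
    and f: "b_form v m s ys k" "m \<noteq> 0" "k \<noteq> 0"
    and uniq: "\<And>u m' k'. u \<in> J \<Longrightarrow> b_form u m' s ys k' \<Longrightarrow> m' \<noteq> 0 \<Longrightarrow> k' \<noteq> 0 \<Longrightarrow> u = v"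
  shows "lower_bd d (\<lambda>w. \<Sum>u\<in>J. \<beta> u * real (occ u w)) (shear_speed v)"
proof -
  obtain c :: int where c: "0 < c" "\<And>u. u \<in> J \<Longrightarrow> int (length u) \<le> c"
    using length_bound[OF J(1)] by blast
  define t where "t = final s ys"
  note g = b_form_good[OF f(1), folded t_def]
  have vF: "v \<in> F d" using v J by auto
  note lt = b_form_letters[OF d f(1) vF]
  have ab: "fst a \<in> {1..d}" using d by (simp add: gen_a_def)
  have notloc: "\<not> len_le d L (\<lambda>w. \<Sum>u\<in>J. \<beta> u * real (occ u (twist_pow (int n) w)))"
    if n: "2 * c < int n" and x: "x = bpow (if s = a' then int n - c else c - int n) @ s #
       tail (shift (- int n) s ys) @ bpow (if t = a then c - int n else int n - c)"
    and L: "L \<le> length x + 1" for n L x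
  proof -
    \<comment> \<open>The block in front of \<open>s\<close> moves by \<open>+n\<close> or \<open>0\<close> after \<open>a\<close> and \<open>a'\<close> if \<open>s \<noteq> a'\<close>, and by \<open>0\<close> or \<open>-n\<close> otherwise. In both cases it ends at distance at least \<open>c\<close> from zero, with opposite signs.\<close>
    define la where "la = (if s = a' then int n - c else c - int n)"
    define rh where "rh = (if t = a then c - int n else int n - c)"
    define ys' where "ys' = shift (- int n) s ys"
    define i1 where "i1 = la + int n + expL (int n) s"
    define i2 where "i2 = la + expL (int n) s"
    define j1 where "j1 = rh + expR (int n) t"
    define j2 where "j2 = rh + expR (int n) t - int n"
    have ij: "c \<le> i1" "i2 \<le> - c" "c \<le> j1" "j2 \<le> - c" "la \<noteq> 0" "rh \<noteq> 0"
      using n c(1) by (auto simp: i1_def i2_def j1_def j2_def la_def rh_def expR_def expL_def)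
    have ys': "red_tail s ys'" "final s ys' = t" "shift (int n) s ys' = ys" "letters_in d ys'"
      using g lt by (simp_all add: ys'_def t_def)
    have x: "x = bpow la @ s # tail ys' @ bpow rh" by (simp add: x la_def rh_def ys'_def)
    \<comment> \<open>All four words start with \<open>a\<close> and end with \<open>a'\<close>; where the letter next to \<open>x\<close> has to be another one, the block \<open>b\<close> inserted between them does not move.\<close>
    let ?W11 = "(la, s) # ys' @ [(rh, a), (1, a')]"
    let ?W12 = "(la, s) # ys' @ [(rh, a')]"
    let ?W21 = "(1, a') # (la, s) # ys' @ [(rh, a), (1, a')]"
    let ?W22 = "(1, a') # (la, s) # ys' @ [(rh, a')]"
    let ?C = "s # tail ys"
    let ?L1 = "[a] @ bpow i1" and ?L2 = "[a, b, a'] @ bpow i2"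
    let ?R1 = "bpow j1 @ [a, b, a']" and ?R2 = "bpow j2 @ [a']"
    have V: "a # tail (shift (int n) a ?W11) = ?L1 @ ?C @ ?R1"
      "a # tail (shift (int n) a ?W12) = ?L1 @ ?C @ ?R2"
      "a # tail (shift (int n) a ?W21) = ?L2 @ ?C @ ?R1"
      "a # tail (shift (int n) a ?W22) = ?L2 @ ?C @ ?R2"
      using ys' by (simp_all add: bpow_1 i1_def i2_def j1_def j2_def)
    show ?thesis
    proof (rule not_len_le_cores[OF V d J c L, where ?p1.0 = "[a]" and ?p2.0 = "[a, b, a']"
          and ?q1.0 = "[a, b, a']" and ?q2.0 = "[a']"])
      show "[a] @ x @ [a, b, a'] = a # tail ?W11" "[a] @ x @ [a'] = a # tail ?W12"
        "[a, b, a'] @ x @ [a, b, a'] = a # tail ?W21" "[a, b, a'] @ x @ [a'] = a # tail ?W22"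
        by (simp_all add: x bpow_1)
      show "red_tail a zs \<and> final a zs = a' \<and> letters_in d zs" if "zs \<in> {?W11, ?W12, ?W21, ?W22}" for zs
        using that ys' ij g ab lt by auto
      fix M :: int
      assume "c \<le> M"
      \<comment> \<open>The alternating sum counts the outer signs with which the core occurs.\<close>
      have cr: "cross u (bpow M @ (?L1 @ ?C @ ?R1) @ bpow M)
        (bpow M @ (?L2 @ ?C @ ?R2) @ bpow M) (bpow M @ (?L1 @ ?C @ ?R2) @ bpow M)
        (bpow M @ (?L2 @ ?C @ ?R1) @ bpow M) =
        (let h = \<lambda>i j. of_bool (\<exists>p q. b_form u p s ys q \<and> p * i > 0 \<and> q * j > 0)
         in h i1 j1 + h i2 j2 - h i1 j2 - h i2 j1)" if "u \<in> J" for u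
      proof -
        have u: "u \<noteq> []" using that J by auto
        have len: "length u \<le> nat \<bar>i1\<bar>" "length u \<le> nat \<bar>i2\<bar>" "length u \<le> nat \<bar>j1\<bar>" "length u \<le> nat \<bar>j2\<bar>"
          using c(2)[OF that] ij by auto
        show ?thesis
          using cross_product[OF u, of "bpow M @ ?L1" ?C "?R1 @ bpow M" "bpow M @ ?L2" "?R2 @ bpow M"]
            card_bb[OF g(1) len(1,3), of "bpow M @ [a]" "[a, b, a'] @ bpow M"]
            card_bb[OF g(1) len(1,4), of "bpow M @ [a]" "[a'] @ bpow M"]
            card_bb[OF g(1) len(2,3), of "bpow M @ [a, b, a']" "[a, b, a'] @ bpow M"]
            card_bb[OF g(1) len(2,4), of "bpow M @ [a, b, a']" "[a'] @ bpow M"]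
          unfolding Let_def append_assoc append_Cons append_Nil by simp
      qed
      let ?h = "\<lambda>u. cross u (bpow M @ (?L1 @ ?C @ ?R1) @ bpow M)
        (bpow M @ (?L2 @ ?C @ ?R2) @ bpow M) (bpow M @ (?L1 @ ?C @ ?R2) @ bpow M)
        (bpow M @ (?L2 @ ?C @ ?R1) @ bpow M)"
      have z: "?h u = 0" if "u \<in> J" "u \<noteq> v" for u
      proof -
        have "\<not> (b_form u p s ys q \<and> p * i > 0 \<and> q * j > 0)" for p q i j
          using uniq[OF that(1), of p q] that(2) by (cases "p = 0"; cases "q = 0") auto
        then have "(\<exists>p q. b_form u p s ys q \<and> p * i > 0 \<and> q * j > 0) = False" for i j by blast
        then show ?thesis unfolding cr[OF that(1)] by (simp only: Let_def of_bool_eq)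
      qed
      have "(\<exists>p q. b_form v p s ys q \<and> p * i > 0 \<and> q * j > 0) \<longleftrightarrow> m * i > 0 \<and> k * j > 0" for i j
        using f(1) b_form_unique[OF f(1)] by metis
      then have "?h v \<noteq> 0"
        unfolding cr[OF v(1)] using ij c(1) f(2,3)
        by (cases "0 < m"; cases "0 < k") (auto simp: zero_less_mult_iff)
      then show "(\<Sum>u\<in>J. \<beta> u * ?h u) \<noteq> 0"
        using sum_single[of J v ?h \<beta>, OF J(1) v(1) z] v(2) by simp
    qed
  qed
  show ?thesis
  proof (rule lower_bdI[where N = "nat (2 * c) + 1" and C = "nat (2 * c) + length (tail ys)"])
    fix n L assume n: "nat (2 * c) + 1 \<le> n"
      and l: "len_le d L (\<lambda>w. \<Sum>u\<in>J. \<beta> u * real (occ u (twist_pow (int n) w)))"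
    define x where "x = bpow (if s = a' then int n - c else c - int n) @ s #
       tail (shift (- int n) s ys) @ bpow (if t = a then c - int n else int n - c)"
    have "2 * c < int n" using n c(1) by linarith
    from notloc[OF this x_def, of L] l have "int (length x) + 1 < int L" by linarith
    moreover have "int (length x) = 2 * int n - 2 * c + 1 + int (length (tail (shift (- int n) s ys)))"
      using \<open>2 * c < int n\<close> c(1) by (simp add: x_def)
    moreover have "int (length (tail (shift (- int n) s ys))) \<ge> int n * int (shear_count s ys) - int (length (tail ys))"
      using length_tail_shift(2)[of "- int n" s ys] by simp
    moreover have "int (shear_speed v * n) = 2 * int n + int n * int (shear_count s ys)"
      using f by (simp add: shear_speed_form[OF f(1)] algebra_simps)
    ultimately have "int (shear_speed v * n) \<le> int L + 2 * c + int (length (tail ys))" by linarith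
    then show "shear_speed v * n \<le> L + (nat (2 * c) + length (tail ys))" using c(1) by linarith
  qed
qed

section \<open>Lower bound from a b-left element\<close>

lemma b_form_ends:
  assumes "b_form u m s ys k"
  shows "nonb (hd u) \<longleftrightarrow> m = 0" "nonb (last u) \<longleftrightarrow> k = 0"
proof -
  have u: "u = bpow m @ (s # tail ys) @ bpow k" using assms by (simp add: b_form_def)
  show "nonb (hd u) \<longleftrightarrow> m = 0"
    unfolding u using b_form_good(2)[OF assms] by (cases "m = 0") (simp_all add: hd_append hd_bpow)
  have "last (s # tail ys) = final s ys" by (rule last_core)
  then show "nonb (last u) \<longleftrightarrow> k = 0"
    unfolding u using b_form_good(3)[OF assms] by (cases "k = 0") (simp_all add: last_append last_bpow)
qed

text \<open>A word that ends with a letter other than \<open>b\<^sup>\<plusminus>\<^sup>1\<close> cannot end inside the long block \<open>b\<^sup>g\<close>.\<close>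

lemma prefix_syllable:
  assumes "r \<noteq> []" "prefix r (bpow \<mu> @ t # bpow g @ B)" "length r \<le> nat \<bar>g\<bar>" "nonb (last r)"
  shows "r = bpow \<mu> @ [t]"
proof -
  obtain z where z: "bpow \<mu> @ t # bpow g @ B = r @ z" using assms(2) by (auto simp: prefix_def)
  show ?thesis
  proof (cases "length r \<le> length (bpow \<mu>)")
    case True
    then have "r = take (length r) (bpow \<mu>)" using arg_cong[OF z, of "take (length r)"] by simp
    then have "last r \<in> set (bpow \<mu>)" using assms(1) by (metis last_in_set in_set_takeD)
    then show ?thesis using assms(4) bpow_not_nonb by blast
  next
    case False
    then obtain r' where r: "r = bpow \<mu> @ t # r'"
      using z by (auto simp: append_eq_append_conv2 Cons_eq_append_conv dest: arg_cong[where f = length])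
    show ?thesis
    proof (cases "r' = []")
      case False
      have "bpow g @ B = r' @ z" using z r by simp
      moreover have "length r' \<le> length (bpow g)" using assms(3) r by simp
      ultimately have "r' = take (length r') (bpow g)" by (metis append_eq_conv_conj take_append append_Nil2 diff_is_0_eq take0)
      then have "last r' \<in> set (bpow g)" using False by (metis last_in_set in_set_takeD)
      then show ?thesis using assms(4) bpow_not_nonb r False by simp
    qed (simp add: r)
  qed
qed

lemma prefix_bpow_last:
  assumes "r \<noteq> []" "prefix r (bpow \<mu> @ B)" "length r \<le> nat \<bar>\<mu>\<bar>"
  shows "\<not> nonb (last r)"
proof -
  have "r = bpow (sgn \<mu> * int (length r))" using assms prefix_bpow_iff by blast
  then have "last r \<in> set (bpow (sgn \<mu> * int (length r)))" using assms(1) by (metis last_in_set)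
  then show ?thesis by (rule bpow_not_nonb)
qed

lemma suffix_syllable:
  assumes "l \<noteq> []" "suffix l (A @ bpow g @ s # bpow \<mu>)" "length l \<le> nat \<bar>g\<bar>" "nonb (hd l)"
  shows "l = s # bpow \<mu>"
proof -
  have "prefix (winv l) (winv (A @ bpow g @ s # bpow \<mu>))"
    using assms(2) prefix_winv[of "winv l" "winv (A @ bpow g @ s # bpow \<mu>)"] by (simp only: winv_simps(3))
  then have "prefix (winv l) (bpow (- \<mu>) @ linv s # bpow (- g) @ winv A)" by simp
  then have "winv l = bpow (- \<mu>) @ [linv s]"
    using assms by (intro prefix_syllable[where g = "- g" and B = "winv A"]) (auto simp: last_winv)
  then have "winv (winv l) = winv (bpow (- \<mu>) @ [linv s])" by simp
  then show ?thesis by simp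
qed

lemma suffix_bpow_hd:
  assumes "l \<noteq> []" "suffix l (A @ bpow \<mu>)" "length l \<le> nat \<bar>\<mu>\<bar>"
  shows "\<not> nonb (hd l)"
proof -
  have "l = bpow (sgn \<mu> * int (length l))" using assms suffix_bpow_iff by blast
  then have "hd l \<in> set (bpow (sgn \<mu> * int (length l)))" using assms(1) by (metis list.set_sel(1))
  then show ?thesis by (rule bpow_not_nonb)
qed

text \<open>On the left the signs of a long block are compared as for b-and-b elements. On the right the last
inner block of \<open>v\<close> is compared with a much longer block: a word that reaches into the latter ends
with a power of \<open>b\<close>, and then it would be b-and-b. The common middle part of the images is the core
without its last block and letter.\<close>

lemma lower_bd_b_left:
  assumes d: "2 \<le> d" and J: "finite J" "J \<subseteq> F d - {[]}" and v: "v \<in> J" "\<beta> v \<noteq> 0"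
    and f: "b_form v m s (zs @ [(\<mu>, t)]) 0" "m \<noteq> 0"
    and nbb: "\<And>u. u \<in> J \<Longrightarrow> nonb (hd u) \<or> nonb (last u)"
    and uniq: "\<And>u m'. u \<in> J \<Longrightarrow> b_form u m' s (zs @ [(\<mu>, t)]) 0 \<Longrightarrow> m' \<noteq> 0 \<Longrightarrow> u = v"
  shows "lower_bd d (\<lambda>w. \<Sum>u\<in>J. \<beta> u * real (occ u w)) (shear_speed v)"
proof -
  obtain c :: int where c: "0 < c" "\<And>u. u \<in> J \<Longrightarrow> int (length u) \<le> c"
    using length_bound[OF J(1)] by blast
  have ab: "fst a \<in> {1..d}" using d by (simp add: gen_a_def)
  define s' where "s' = final s zs"
  define e where "e = expR 1 s' + expL 1 t"
  have g: "red_tail s zs" "nonb s" "nonb t" "nonb s'" "red_tail s' [(\<mu>, t)]"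
    using b_form_good[OF f(1)] red_tail_final[of s zs] by (simp_all add: s'_def)
  have vF: "v \<in> F d" using v J by auto
  note lt = b_form_letters[OF d f(1) vF]
  have vlen: "\<bar>\<mu>\<bar> + 1 \<le> c" using c(2)[OF v(1)] f(1) by (simp add: b_form_def)
  have scale: "expR (int n) s' + expL (int n) t = int n * e" for n
    using expR_expL_scale[of "int n" s' t] by (simp add: e_def)
  have notloc: "\<not> len_le d L (\<lambda>w. \<Sum>u\<in>J. \<beta> u * real (occ u (twist_pow (int n) w)))"
    if n: "2 * c < int n" and x: "x = bpow (if s = a' then int n - c else c - int n) @ s #
       tail (shift (- int n) s zs) @ bpow (\<mu> - int n * e)"
    and L: "L \<le> length x + 1" for n L x
  proof -
    define la where "la = (if s = a' then int n - c else c - int n)"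
    define zs' where "zs' = shift (- int n) s zs"
    define \<mu>' where "\<mu>' = \<mu> - int n * e"
    \<comment> \<open>The extension has the sign of the preimage block, such that the words before the twist are reduced; its size makes the image block long even if the signs differ there.\<close>
    define \<sigma> :: int where "\<sigma> = (if 0 \<le> \<mu>' then 2 * c else - 2 * c)"
    define i1 where "i1 = la + int n + expL (int n) s"
    define i2 where "i2 = la + expL (int n) s"
    define G where "G = 2 * int n + expR (int n) t"
    have ij: "c \<le> i1" "i2 \<le> - c" "la \<noteq> 0" "c \<le> G" "0 < int n"
      using n c(1) by (auto simp: i1_def i2_def la_def G_def expR_def expL_def)
    have mu2: "c \<le> \<bar>\<mu> + \<sigma>\<bar>" "\<mu>' + \<sigma> \<noteq> 0" "bpow (\<mu>' + \<sigma>) = bpow \<mu>' @ bpow \<sigma>"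
      using vlen c(1) bpow_add_same_sign[of \<mu>' \<sigma>] by (auto simp: \<sigma>_def)
    have zs': "red_tail s zs'" "final s zs' = s'" "shift (int n) s zs' = zs" "letters_in d zs'"
      using g lt by (simp_all add: zs'_def s'_def)
    have mu': "\<mu>' + (expR (int n) s' + expL (int n) t) = \<mu>" by (simp add: scale \<mu>'_def)
    have "\<mu>' = 0 \<Longrightarrow> t \<noteq> linv s'"
    proof
      assume "\<mu>' = 0" "t = linv s'"
      then have "\<mu> = 0" using mu' by simp
      with g(5) \<open>t = linv s'\<close> show False by simp
    qed
    note gt = this
    have x: "x = bpow la @ s # tail zs' @ bpow \<mu>'" by (simp add: x la_def zs'_def \<mu>'_def)
    let ?W11 = "(la, s) # zs' @ [(\<mu>', t), (3 * int n, a')]"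
    let ?W12 = "(la, s) # zs' @ [(\<mu>' + \<sigma>, t), (3 * int n, a')]"
    let ?W21 = "(1, a') # (la, s) # zs' @ [(\<mu>', t), (3 * int n, a')]"
    let ?W22 = "(1, a') # (la, s) # zs' @ [(\<mu>' + \<sigma>, t), (3 * int n, a')]"
    let ?q1 = "t # bpow (3 * int n) @ [a']"
    let ?C = "s # tail zs"
    let ?L1 = "[a] @ bpow i1" and ?L2 = "[a, b, a'] @ bpow i2"
    let ?R1 = "bpow \<mu> @ t # bpow G @ [a']" and ?R2 = "bpow (\<mu> + \<sigma>) @ t # bpow G @ [a']"
    have mus: "\<mu>' + expR (int n) s' + expL (int n) t = \<mu>" "\<mu>' + \<sigma> + expR (int n) s' + expL (int n) t = \<mu> + \<sigma>"
      using mu' by simp_all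
    have V: "a # tail (shift (int n) a ?W11) = ?L1 @ ?C @ ?R1"
      "a # tail (shift (int n) a ?W12) = ?L1 @ ?C @ ?R2"
      "a # tail (shift (int n) a ?W21) = ?L2 @ ?C @ ?R1"
      "a # tail (shift (int n) a ?W22) = ?L2 @ ?C @ ?R2"
      using zs' by (simp_all add: bpow_1 i1_def i2_def G_def mus)
    show ?thesis
    proof (rule not_len_le_cores[OF V d J c L, where ?p1.0 = "[a]" and ?p2.0 = "[a, b, a']"
          and ?q1.0 = ?q1 and ?q2.0 = "bpow \<sigma> @ ?q1"])
      show "[a] @ x @ ?q1 = a # tail ?W11" "[a] @ x @ bpow \<sigma> @ ?q1 = a # tail ?W12"
        "[a, b, a'] @ x @ ?q1 = a # tail ?W21" "[a, b, a'] @ x @ bpow \<sigma> @ ?q1 = a # tail ?W22"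
        by (simp_all add: x bpow_1 mu2)
      show "red_tail a ys \<and> final a ys = a' \<and> letters_in d ys" if "ys \<in> {?W11, ?W12, ?W21, ?W22}" for ys
        using that zs' ij g ab lt gt mu2(2) by auto
      fix M :: int
      assume "c \<le> M"
      have card1: "card {(l, r). u = l @ ?C @ r \<and> l \<noteq> [] \<and> r \<noteq> [] \<and>
          suffix l (A @ bpow i) \<and> prefix r (bpow \<mu> @ t # bpow G @ B)} =
          of_bool (\<exists>p. b_form u p s (zs @ [(\<mu>, t)]) 0 \<and> p * i > 0)" (is "card ?S = of_bool ?P")
        if u: "u \<in> J" and i: "c \<le> \<bar>i\<bar>" for u i A B
      proof -
        have len: "length u \<le> nat \<bar>i\<bar>" "length u \<le> nat \<bar>G\<bar>" using c(2)[OF u] i ij by auto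
        have S: "l = bpow p \<and> r = bpow \<mu> @ [t] \<and> b_form u p s (zs @ [(\<mu>, t)]) 0 \<and> p * i > 0"
          if lr: "(l, r) \<in> ?S" and p: "p = sgn i * int (length l)" for l r p
        proof -
          have *: "u = l @ ?C @ r" "l \<noteq> []" "r \<noteq> []" "suffix l (A @ bpow i)" "prefix r (bpow \<mu> @ t # bpow G @ B)"
            using lr by auto
          have l: "l = bpow p" using * len suffix_bpow_iff[of l i A] by (simp add: p)
          have "length l \<noteq> 0" using * by simp
          then have pi: "p * i > 0" using i c(1) by (auto simp: p zero_less_mult_iff sgn_if)
          then have "p \<noteq> 0" by auto
          then have "\<not> nonb (hd u)" using * l by (simp add: hd_append hd_bpow)
          then have "nonb (last r)" using nbb[OF u] * by simp
          then have r: "r = bpow \<mu> @ [t]" using * len by (intro prefix_syllable) auto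
          have "b_form u p s (zs @ [(\<mu>, t)]) 0"
            using * l r b_form_good(1)[OF f(1)] by (simp add: b_form_def)
          then show ?thesis using l r pi by simp
        qed
        show ?thesis
        proof (cases ?P)
          case True
          then obtain p where p: "b_form u p s (zs @ [(\<mu>, t)]) 0" "p * i > 0" by blast
          have u': "u = bpow p @ ?C @ bpow \<mu> @ [t]" using p by (simp add: b_form_def)
          have "?S = {(bpow p, bpow \<mu> @ [t])}"
          proof (intro equalityI subsetI)
            fix z assume z: "z \<in> ?S"
            obtain l r where lr: "z = (l, r)" by (cases z)
            have "l = bpow (sgn i * int (length l)) \<and> r = bpow \<mu> @ [t] \<and>
                b_form u (sgn i * int (length l)) s (zs @ [(\<mu>, t)]) 0" using S z lr by blast
            then have "l = bpow p" "r = bpow \<mu> @ [t]" using b_form_unique(1)[OF p(1)] by metis+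
            then show "z \<in> {(bpow p, bpow \<mu> @ [t])}" using lr by blast
          next
            fix z assume z: "z \<in> {(bpow p, bpow \<mu> @ [t])}"
            have "sgn i * \<bar>p\<bar> = p" "p \<noteq> 0" using p(2) by (auto simp: zero_less_mult_iff)
            moreover from this have "suffix (bpow p) (A @ bpow i)"
              using suffix_bpow_iff[of "bpow p" i A] len u' by auto
            ultimately show "z \<in> ?S" using z u' by (auto simp: prefix_def)
          qed
          then show ?thesis using True by simp
        next
          case False
          have "?S = {}"
          proof (rule equals0I)
            fix z assume z: "z \<in> ?S"
            obtain l r where lr: "z = (l, r)" by (cases z)
            show False using S[of l r] z lr False by blast
          qed
          then show ?thesis using False by (simp only: card.empty of_bool_eq)
        qed
      qed
      have card2: "card {(l, r). u = l @ ?C @ r \<and> l \<noteq> [] \<and> r \<noteq> [] \<and>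
          suffix l (A @ bpow i) \<and> prefix r (bpow (\<mu> + \<sigma>) @ B)} = 0"
        if u: "u \<in> J" and i: "c \<le> \<bar>i\<bar>" for u i A B
      proof -
        have len: "length u \<le> nat \<bar>i\<bar>" "length u \<le> nat \<bar>\<mu> + \<sigma>\<bar>" using c(2)[OF u] i mu2 by auto
        have "False" if *: "u = l @ ?C @ r" "l \<noteq> []" "r \<noteq> []" "suffix l (A @ bpow i)"
          "prefix r (bpow (\<mu> + \<sigma>) @ B)" for l r
        proof -
          have "\<not> nonb (hd l)" using * len by (intro suffix_bpow_hd) auto
          moreover have "\<not> nonb (last r)" using * len by (intro prefix_bpow_last) auto
          ultimately show False using nbb[OF u] * by simp
        qed
        then have "{(l, r). u = l @ ?C @ r \<and> l \<noteq> [] \<and> r \<noteq> [] \<and>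
          suffix l (A @ bpow i) \<and> prefix r (bpow (\<mu> + \<sigma>) @ B)} = {}" by blast
        then show ?thesis by (simp only: card.empty)
      qed
      let ?h = "\<lambda>u. cross u (bpow M @ (?L1 @ ?C @ ?R1) @ bpow M)
        (bpow M @ (?L2 @ ?C @ ?R2) @ bpow M) (bpow M @ (?L1 @ ?C @ ?R2) @ bpow M)
        (bpow M @ (?L2 @ ?C @ ?R1) @ bpow M)"
      have cr: "?h u = of_bool (\<exists>p. b_form u p s (zs @ [(\<mu>, t)]) 0 \<and> p * i1 > 0) -
          of_bool (\<exists>p. b_form u p s (zs @ [(\<mu>, t)]) 0 \<and> p * i2 > 0)" if u: "u \<in> J" for u
      proof -
        have u0: "u \<noteq> []" using u J by auto
        have i: "c \<le> \<bar>i1\<bar>" "c \<le> \<bar>i2\<bar>" using ij by auto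
        show ?thesis
          using cross_product[OF u0, of "bpow M @ ?L1" ?C "?R1 @ bpow M" "bpow M @ ?L2" "?R2 @ bpow M"]
            card1[OF u i(1), of "bpow M @ [a]" "[a'] @ bpow M"]
            card1[OF u i(2), of "bpow M @ [a, b, a']" "[a'] @ bpow M"]
            card2[OF u i(1), of "bpow M @ [a]" "t # bpow G @ [a'] @ bpow M"]
            card2[OF u i(2), of "bpow M @ [a, b, a']" "t # bpow G @ [a'] @ bpow M"]
          unfolding Let_def append_assoc append_Cons append_Nil by simp
      qed
      have z: "?h u = 0" if "u \<in> J" "u \<noteq> v" for u
      proof -
        have "(\<exists>p. b_form u p s (zs @ [(\<mu>, t)]) 0 \<and> p * i > 0) = False" for i
          using uniq[OF that(1)] that(2) by (metis less_irrefl mult_zero_left)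
        then show ?thesis unfolding cr[OF that(1)] by (simp only: of_bool_eq)
      qed
      have sgn: "(\<exists>p. b_form v p s (zs @ [(\<mu>, t)]) 0 \<and> p * i > 0) \<longleftrightarrow> m * i > 0" for i
        using f(1) b_form_unique[OF f(1)] by metis
      have "?h v \<noteq> 0"
        unfolding cr[OF v(1)] sgn using ij c(1) f(2)
        by (cases "0 < m") (auto simp: zero_less_mult_iff)
      then show "(\<Sum>u\<in>J. \<beta> u * ?h u) \<noteq> 0"
        using sum_single[of J v ?h \<beta>, OF J(1) v(1) z] v(2) by simp
    qed
  qed
  show ?thesis
  proof (rule lower_bdI[where N = "nat (2 * c) + 1" and C = "nat (2 * c) + length (tail zs)"])
    fix n L assume n: "nat (2 * c) + 1 \<le> n"
      and l: "len_le d L (\<lambda>w. \<Sum>u\<in>J. \<beta> u * real (occ u (twist_pow (int n) w)))"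
    define x where "x = bpow (if s = a' then int n - c else c - int n) @ s #
       tail (shift (- int n) s zs) @ bpow (\<mu> - int n * e)"
    have n': "2 * c < int n" using n c(1) by linarith
    from notloc[OF n' x_def, of L] l have "int (length x) + 1 < int L" by linarith
    moreover have e: "\<bar>\<mu> - int n * e\<bar> \<ge> int n * of_bool (e \<noteq> 0) - \<bar>\<mu>\<bar>"
      using expR_expL_unit[of s' t] by (auto simp: e_def)
    moreover have "int (length x) = int n - c + 1 + int (length (tail (shift (- int n) s zs))) + \<bar>\<mu> - int n * e\<bar>"
      using n' c(1) by (simp add: x_def)
    moreover have "int (length (tail (shift (- int n) s zs))) \<ge> int n * int (shear_count s zs) - int (length (tail zs))"
      using length_tail_shift(2)[of "- int n" s zs] by simp
    moreover have "int (shear_speed v * n) = int n + int n * int (shear_count s zs) + int n * of_bool (e \<noteq> 0)"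
      using f by (simp add: shear_speed_form[OF f(1)] algebra_simps s'_def e_def)
    ultimately have "int (shear_speed v * n) \<le> int L + 2 * c + int (length (tail zs))" using vlen by linarith
    then show "shear_speed v * n \<le> L + (nat (2 * c) + length (tail zs))" using c(1) by linarith
  qed
qed

section \<open>Lower bound from a truncated element\<close>

lemma occ_append_bpow:
  assumes "u \<noteq> []" "nonb (last u)"
  shows "occ u (A @ bpow j) = occ u A"
proof -
  have none: "{(l, r). u = l @ [] @ r \<and> l \<noteq> [] \<and> r \<noteq> [] \<and> suffix l A \<and> prefix r (bpow j)} = {}"
  proof -
    have "False" if "u = l @ r" "r \<noteq> []" "prefix r (bpow j)" for l r
    proof -
      have "last u \<in> set (bpow j)" using that by (auto simp: prefix_def)
      then show False using bpow_not_nonb assms(2) by blast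
    qed
    then show ?thesis by auto
  qed
  have "occ u (bpow j) = 0"
  proof (rule occ_eq_0I)
    fix x y show "bpow j \<noteq> x @ u @ y"
    proof
      assume "bpow j = x @ u @ y"
      then have "last u \<in> set (bpow j)" using assms(1) by simp
      then show False using bpow_not_nonb assms(2) by blast
    qed
  qed
  moreover have "occ u [] = 0" using assms(1) by (intro occ_eq_0I) auto
  ultimately show ?thesis using occ_glue[OF assms(1), of A "[]" "bpow j"] unfolding none by simp
qed

lemma occ_winv: "occ (winv u) (winv w) = occ u w"
proof -
  have "occ (winv u) (winv w) = card {(x, y). winv w = x @ winv u @ y}" by (simp add: occ_def)
  also have "\<dots> = card {(x, y). w = x @ u @ y}"
  proof (rule bij_betw_same_card, rule bij_betwI[where f = "\<lambda>(x, y). (winv y, winv x)"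
        and g = "\<lambda>(x, y). (winv y, winv x)"])
    show "(\<lambda>(x, y). (winv y, winv x)) \<in> {(x, y). winv w = x @ winv u @ y} \<rightarrow> {(x, y). w = x @ u @ y}"
    proof (rule Pi_I, clarify)
      fix x y assume "winv w = x @ winv u @ y"
      then have "winv (winv w) = winv (x @ winv u @ y)" by simp
      then show "w = winv y @ u @ winv x" by simp
    qed
  qed auto
  finally show ?thesis by (simp add: occ_def)
qed

lemma occ_bpow_append:
  assumes "u \<noteq> []" "nonb (hd u)"
  shows "occ u (bpow j @ B) = occ u B"
  using occ_append_bpow[of "winv u" "winv B" "- j"] assms occ_winv[of u "bpow j @ B"] occ_winv[of u B]
  by (simp add: last_winv)

lemma occ_bpow_0: "set u - {b, linv b} \<noteq> {} \<Longrightarrow> occ u (bpow j) = 0"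
proof (rule occ_eq_0I)
  fix x y assume u: "set u - {b, linv b} \<noteq> {}"
  show "bpow j \<noteq> x @ u @ y"
  proof
    assume "bpow j = x @ u @ y"
    then have "set u \<subseteq> set (bpow j)" by auto
    then show False using u set_bpow by blast
  qed
qed

text \<open>A truncated word that reached into a long block of \<open>b\<close> would have to start or end inside it.\<close>

lemma occ_truncated_split:
  assumes "nonb_ends u" "length u \<le> nat \<bar>j\<bar>"
  shows "occ u (A @ bpow j @ B) = occ u A + occ u B"
proof -
  have u: "u \<noteq> []" "nonb (hd u)" "nonb (last u)" using assms by (auto simp: nonb_ends_def)
  have "set u - {b, linv b} \<noteq> {}" using u(1,2) nonbD[of "hd u"] by (metis DiffI empty_iff hd_in_set insertE)
  then have "occ u (bpow j) = 0" by (rule occ_bpow_0)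
  then have "real (occ u (A @ bpow j @ B)) = real (occ u A + occ u B)"
    using occ_sep[OF u(1), of "bpow j" A B] assms(2)
    by (simp add: occ_append_bpow[OF u(1,3)] occ_bpow_append[OF u(1,2)])
  then show ?thesis by (simp only: of_nat_eq_iff)
qed

text \<open>The core \<open>s b\<^sup>\<mu> t\<close> has a single block, which has to be lengthened from both sides. The images have the
exponents \<open>\<mu>\<close>, \<open>\<mu> + \<sigma>\<close> (twice) and \<open>\<mu> + 2 \<sigma>\<close>, and only the first is short enough to be
crossed by a truncated word.\<close>

lemma lower_bd_truncated_2:
  assumes d: "2 \<le> d" and J: "finite J" "J \<subseteq> F d - {[]}" and v: "v \<in> J" "\<beta> v \<noteq> 0"
    and f: "b_form v 0 s [(\<mu>, t)] 0"
    and trunc: "\<And>u. u \<in> J \<Longrightarrow> nonb_ends u"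
  shows "lower_bd d (\<lambda>w. \<Sum>u\<in>J. \<beta> u * real (occ u w)) (shear_speed v)"
proof -
  obtain c :: int where c: "0 < c" "\<And>u. u \<in> J \<Longrightarrow> int (length u) \<le> c"
    using length_bound[OF J(1)] by blast
  have ab: "fst a \<in> {1..d}" using d by (simp add: gen_a_def)
  define e where "e = expR 1 s + expL 1 t"
  have g: "nonb s" "nonb t" "\<mu> = 0 \<longrightarrow> t \<noteq> linv s"
    using b_form_good[OF f(1)] by simp_all
  have vF: "v \<in> F d" using v J by auto
  note lt = b_form_letters[OF d f(1) vF]
  have v_eq: "v = s # bpow \<mu> @ [t]" using f by (simp add: b_form_def)
  have vlen: "\<bar>\<mu>\<bar> + 2 \<le> c" using c(2)[OF v(1)] by (simp add: v_eq)
  have scale: "expR (int n) s + expL (int n) t = int n * e" for n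
    using expR_expL_scale[of "int n" s t] by (simp add: e_def)
  have notloc: "\<not> len_le d L (\<lambda>w. \<Sum>u\<in>J. \<beta> u * real (occ u (twist_pow (int n) w)))"
    if n: "2 * c < int n" and x: "x = bpow (\<mu> - int n * e)" and L: "L \<le> length x + 1" for n L x
  proof -
    define \<mu>' where "\<mu>' = \<mu> - int n * e"
    define \<sigma> :: int where "\<sigma> = (if 0 \<le> \<mu>' then 2 * c else - 2 * c)"
    define H where "H = 3 * int n + int n + expL (int n) s"
    define G where "G = 3 * int n + expR (int n) t - int n"
    have ij: "c \<le> H" "c \<le> G" "0 < int n"
      using n c(1) by (auto simp: H_def G_def expR_def expL_def)
    have mu2: "c \<le> \<bar>\<mu> + \<sigma>\<bar>" "c \<le> \<bar>\<mu> + \<sigma> + \<sigma>\<bar>" "\<mu>' + \<sigma> \<noteq> 0" "\<mu>' + \<sigma> + \<sigma> \<noteq> 0"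
      "bpow (\<mu>' + \<sigma>) = bpow \<mu>' @ bpow \<sigma>" "bpow (\<mu>' + \<sigma>) = bpow \<sigma> @ bpow \<mu>'"
      "bpow (\<mu>' + \<sigma> + \<sigma>) = bpow \<sigma> @ bpow \<mu>' @ bpow \<sigma>"
      using vlen c(1) bpow_add_same_sign[of \<mu>' \<sigma>] bpow_add_same_sign[of \<sigma> \<mu>'] bpow_add_same_sign[of \<sigma> "\<mu>' + \<sigma>"]
      by (auto simp: \<sigma>_def add.commute)
    have mu': "\<mu>' + (expR (int n) s + expL (int n) t) = \<mu>" by (simp add: scale \<mu>'_def)
    have gt: "\<mu>' = 0 \<Longrightarrow> t \<noteq> linv s"
    proof
      assume "\<mu>' = 0" "t = linv s"
      then have "\<mu> = 0" using mu' by simp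
      with g(3) \<open>t = linv s\<close> show False by simp
    qed
    have x: "x = bpow \<mu>'" by (simp add: x \<mu>'_def)
    let ?W = "\<lambda>i. [(3 * int n, s), (i, t), (3 * int n, a')]"
    let ?p = "a # bpow (3 * int n) @ [s]" and ?q = "t # bpow (3 * int n) @ [a']"
    have V: "a # tail (shift (int n) a (?W (\<mu>' + j))) =
        (a # bpow H @ [s]) @ bpow (\<mu> + j) @ (t # bpow G @ [a'])" for j
    proof -
      have "\<mu>' + j + expR (int n) s + expL (int n) t = \<mu> + j" using mu' by simp
      note * = this
      show ?thesis by (simp add: H_def G_def *)
    qed
    note V = V[of 0, unfolded add_0_right] V[of \<sigma>] V[of "\<sigma> + \<sigma>", folded add.assoc]
    show ?thesis
    proof (rule not_len_le_cores[OF V(1,2,2,3) d J c L, where ?p1.0 = ?p and ?p2.0 = "?p @ bpow \<sigma>"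
          and ?q1.0 = ?q and ?q2.0 = "bpow \<sigma> @ ?q"])
      show "?p @ x @ ?q = a # tail (?W \<mu>')" "?p @ x @ bpow \<sigma> @ ?q = a # tail (?W (\<mu>' + \<sigma>))"
        by (simp_all add: x mu2(5))
      show "(?p @ bpow \<sigma>) @ x @ bpow \<sigma> @ ?q = a # tail (?W (\<mu>' + \<sigma> + \<sigma>))"
        by (simp only: tail.simps mu2(7) x append_assoc append_Cons append_Nil)
      show "(?p @ bpow \<sigma>) @ x @ ?q = a # tail (?W (\<mu>' + \<sigma>))" by (simp add: x mu2(6))
      show "red_tail a ys \<and> final a ys = a' \<and> letters_in d ys"
        if "ys \<in> {?W \<mu>', ?W (\<mu>' + \<sigma>), ?W (\<mu>' + \<sigma>), ?W (\<mu>' + \<sigma> + \<sigma>)}" for ys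
        using that ij g ab lt gt mu2(3,4) by auto
      fix M :: int
      assume M: "c \<le> M"
      let ?A = "bpow M @ a # bpow H @ [s]" and ?B = "t # bpow G @ a' # bpow M"
      have V': "bpow M @ ((a # bpow H @ [s]) @ bpow i @ t # bpow G @ [a']) @ bpow M = ?A @ bpow i @ ?B" for i
        by simp
      let ?V = "\<lambda>i. bpow M @ ((a # bpow H @ [s]) @ bpow i @ t # bpow G @ [a']) @ bpow M"
      let ?h = "\<lambda>u. cross u (?V \<mu>) (?V (\<mu> + \<sigma> + \<sigma>)) (?V (\<mu> + \<sigma>)) (?V (\<mu> + \<sigma>))"
      have h: "?h u = of_bool (u = v)" if u: "u \<in> J" for u
      proof -
        note nu = trunc[OF u]
        have len: "length u \<le> nat \<bar>\<mu> + \<sigma>\<bar>" "length u \<le> nat \<bar>\<mu> + \<sigma> + \<sigma>\<bar>" "length u \<le> nat \<bar>H\<bar>"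
          "length u \<le> nat \<bar>G\<bar>" using c(2)[OF u] mu2(1,2) ij by auto
        have u0: "u \<noteq> []" "nonb (hd u)" "nonb (last u)" using nu by (auto simp: nonb_ends_def)
        have "occ u (?A @ bpow \<mu> @ ?B) + occ u (bpow \<mu>) = occ u (?A @ bpow \<mu>) + occ u (bpow \<mu> @ ?B) +
            card {(l, r). u = l @ bpow \<mu> @ r \<and> l \<noteq> [] \<and> r \<noteq> [] \<and> suffix l ?A \<and> prefix r ?B}"
          by (rule occ_glue[OF u0(1)])
        moreover have "occ u (bpow \<mu>) = 0"
          by (rule occ_bpow_0) (use u0 nonbD[of "hd u"] in \<open>metis DiffI empty_iff hd_in_set insertE\<close>)
        moreover have "{(l, r). u = l @ bpow \<mu> @ r \<and> l \<noteq> [] \<and> r \<noteq> [] \<and> suffix l ?A \<and> prefix r ?B} =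
            (if u = v then {([s], [t])} else {})"
        proof -
          have lr: "l = [s] \<and> r = [t]" if "u = l @ bpow \<mu> @ r" "l \<noteq> []" "r \<noteq> []" "suffix l ?A" "prefix r ?B" for l r
          proof
            show "l = [s]" using suffix_syllable[of l "bpow M @ [a]" H s 0] that len u0 by auto
            show "r = [t]" using prefix_syllable[of r 0 t G "a' # bpow M"] that len u0 by auto
          qed
          have "suffix [s] ?A" by (simp add: suffix_def)
          moreover have "prefix [t] ?B" by simp
          ultimately show ?thesis using lr v_eq by auto
        qed
        ultimately have "occ u (?A @ bpow \<mu> @ ?B) = occ u ?A + occ u ?B + of_bool (u = v)"
          using occ_append_bpow[OF u0(1,3), of ?A \<mu>] occ_bpow_append[OF u0(1,2), of \<mu> ?B] by simp
        moreover note occ_truncated_split[OF nu len(1), of ?A ?B] occ_truncated_split[OF nu len(2), of ?A ?B]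
        ultimately show ?thesis unfolding cross_def V' by (simp only:) simp
      qed
      have "?h v \<noteq> 0" using h[OF v(1)] by simp
      then show "(\<Sum>u\<in>J. \<beta> u * ?h u) \<noteq> 0"
        using sum_single[of J v ?h \<beta>, OF J(1) v(1)] h v(2) by simp
    qed
  qed
  show ?thesis
  proof (rule lower_bdI[where N = "nat (2 * c) + 1" and C = "nat (2 * c)"])
    fix n L assume n: "nat (2 * c) + 1 \<le> n"
      and l: "len_le d L (\<lambda>w. \<Sum>u\<in>J. \<beta> u * real (occ u (twist_pow (int n) w)))"
    define x where "x = bpow (\<mu> - int n * e)"
    have n': "2 * c < int n" using n c(1) by linarith
    from notloc[OF n' x_def, of L] l have "int (length x) + 1 < int L" by linarith
    moreover have "\<bar>\<mu> - int n * e\<bar> \<ge> int n * of_bool (e \<noteq> 0) - \<bar>\<mu>\<bar>"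
      using expR_expL_unit[of s t] by (auto simp: e_def)
    moreover have "int (length x) = \<bar>\<mu> - int n * e\<bar>" by (simp add: x_def)
    moreover have "int (shear_speed v * n) = int n * of_bool (e \<noteq> 0)"
      using f by (simp add: shear_speed_form[OF f(1)] algebra_simps e_def)
    ultimately have "int (shear_speed v * n) \<le> int L + 2 * c" using vlen by linarith
    then show "shear_speed v * n \<le> L + nat (2 * c)" using c(1) by linarith
  qed
qed

text \<open>With at least two inner blocks, the first and the last one are lengthened independently, and
the images share the part between them. A truncated word that reaches beyond this part on both sides needs
both blocks in their original length.\<close>

lemma lower_bd_truncated_3:
  assumes d: "2 \<le> d" and J: "finite J" "J \<subseteq> F d - {[]}" and v: "v \<in> J" "\<beta> v \<noteq> 0"
    and f: "b_form v 0 s ((\<nu>, z) # zs @ [(\<mu>, t)]) 0"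
    and trunc: "\<And>u. u \<in> J \<Longrightarrow> nonb_ends u"
  shows "lower_bd d (\<lambda>w. \<Sum>u\<in>J. \<beta> u * real (occ u w)) (shear_speed v)"
proof -
  obtain c :: int where c: "0 < c" "\<And>u. u \<in> J \<Longrightarrow> int (length u) \<le> c"
    using length_bound[OF J(1)] by blast
  have ab: "fst a \<in> {1..d}" using d by (simp add: gen_a_def)
  define y where "y = final z zs"
  define e where "e = expR 1 y + expL 1 t"
  define e' where "e' = expR 1 s + expL 1 z"
  have g: "nonb s" "nonb t" "nonb z" "red_tail z zs" "\<mu> = 0 \<longrightarrow> t \<noteq> linv y" "\<nu> = 0 \<longrightarrow> z \<noteq> linv s" "nonb y"
    using b_form_good[OF f(1)] red_tail_nonb[of z zs] red_tail_final[of z zs] by (simp_all add: y_def)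
  have vF: "v \<in> F d" using v J by auto
  note lt = b_form_letters[OF d f(1) vF]
  let ?C = "z # tail zs"
  have v_eq: "v = (s # bpow \<nu>) @ ?C @ (bpow \<mu> @ [t])" using f by (simp add: b_form_def)
  have vlen: "\<bar>\<mu>\<bar> + \<bar>\<nu>\<bar> + int (length (tail zs)) + 3 \<le> c" using c(2)[OF v(1)] by (simp add: v_eq)
  have scale: "expR (int n) y + expL (int n) t = int n * e" "expR (int n) s + expL (int n) z = int n * e'" for n
    using expR_expL_scale[of "int n"] by (simp_all add: e_def e'_def)
  have notloc: "\<not> len_le d L (\<lambda>w. \<Sum>u\<in>J. \<beta> u * real (occ u (twist_pow (int n) w)))"
    if n: "2 * c < int n" and x: "x = bpow (\<nu> - int n * e') @ z # tail (shift (- int n) z zs) @ bpow (\<mu> - int n * e)"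
      and L: "L \<le> length x + 1" for n L x
  proof -
    define \<mu>' where "\<mu>' = \<mu> - int n * e"
    define \<nu>' where "\<nu>' = \<nu> - int n * e'"
    define zs' where "zs' = shift (- int n) z zs"
    define \<sigma> :: int where "\<sigma> = (if 0 \<le> \<mu>' then 2 * c else - 2 * c)"
    define \<rho> :: int where "\<rho> = (if 0 \<le> \<nu>' then 2 * c else - 2 * c)"
    define H where "H = 3 * int n + int n + expL (int n) s"
    define G where "G = 3 * int n + expR (int n) t - int n"
    have ij: "c \<le> H" "c \<le> G" "0 < int n"
      using n c(1) by (auto simp: H_def G_def expR_def expL_def)
    have mu2: "c \<le> \<bar>\<mu> + \<sigma>\<bar>" "\<mu>' + \<sigma> \<noteq> 0" "bpow (\<mu>' + \<sigma>) = bpow \<mu>' @ bpow \<sigma>"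
      using vlen c(1) bpow_add_same_sign[of \<mu>' \<sigma>] by (auto simp: \<sigma>_def)
    have nu2: "c \<le> \<bar>\<nu> + \<rho>\<bar>" "\<nu>' + \<rho> \<noteq> 0" "bpow (\<nu>' + \<rho>) = bpow \<rho> @ bpow \<nu>'"
      using vlen c(1) bpow_add_same_sign[of \<rho> \<nu>'] by (auto simp: \<rho>_def add.commute)
    have mu': "\<mu>' + (expR (int n) y + expL (int n) t) = \<mu>" by (simp add: scale \<mu>'_def)
    have nu': "\<nu>' + (expR (int n) s + expL (int n) z) = \<nu>" by (simp add: scale \<nu>'_def)
    have gt: "\<mu>' = 0 \<Longrightarrow> t \<noteq> linv y"
    proof
      assume "\<mu>' = 0" "t = linv y"
      then have "\<mu> = 0" using mu' by simp
      with g(5) \<open>t = linv y\<close> show False by simp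
    qed
    have gz: "\<nu>' = 0 \<Longrightarrow> z \<noteq> linv s"
    proof
      assume "\<nu>' = 0" "z = linv s"
      then have "\<nu> = 0" using nu' by simp
      with g(6) \<open>z = linv s\<close> show False by simp
    qed
    have zs': "red_tail z zs'" "final z zs' = y" "shift (int n) z zs' = zs" "letters_in d zs'"
      using g lt by (simp_all add: zs'_def y_def)
    have x: "x = bpow \<nu>' @ z # tail zs' @ bpow \<mu>'" by (simp add: x \<mu>'_def \<nu>'_def zs'_def)
    let ?W = "\<lambda>i j. (3 * int n, s) # (\<nu>' + i, z) # zs' @ [(\<mu>' + j, t), (3 * int n, a')]"
    let ?p = "a # bpow (3 * int n) @ [s]" and ?q = "t # bpow (3 * int n) @ [a']"
    let ?L = "\<lambda>i. a # bpow H @ s # bpow (\<nu> + i)" and ?R = "\<lambda>j. bpow (\<mu> + j) @ t # bpow G @ [a']"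
    have V: "a # tail (shift (int n) a (?W i j)) = ?L i @ ?C @ ?R j" for i j
    proof -
      have "\<mu>' + j + expR (int n) y + expL (int n) t = \<mu> + j" "\<nu>' + i + expR (int n) s + expL (int n) z = \<nu> + i"
        using mu' nu' by simp_all
      note * = this
      show ?thesis using zs' by (simp add: H_def G_def *)
    qed
    show ?thesis
    proof (rule not_len_le_cores[OF V[of 0 0] V[of 0 \<sigma>] V[of \<rho> 0] V[of \<rho> \<sigma>] d J c L, where ?p1.0 = ?p and ?p2.0 = "?p @ bpow \<rho>"
          and ?q1.0 = ?q and ?q2.0 = "bpow \<sigma> @ ?q"])
      show "?p @ x @ ?q = a # tail (?W 0 0)" "?p @ x @ bpow \<sigma> @ ?q = a # tail (?W 0 \<sigma>)"
        "(?p @ bpow \<rho>) @ x @ bpow \<sigma> @ ?q = a # tail (?W \<rho> \<sigma>)"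
        "(?p @ bpow \<rho>) @ x @ ?q = a # tail (?W \<rho> 0)"
        by (simp_all add: x mu2(3) nu2(3))
      show "red_tail a ys \<and> final a ys = a' \<and> letters_in d ys"
        if "ys \<in> {?W 0 0, ?W 0 \<sigma>, ?W \<rho> 0, ?W \<rho> \<sigma>}" for ys
        using that ij g ab lt gt gz zs' mu2(2) nu2(2) by auto
      fix M :: int
      assume M: "c \<le> M"
      let ?h = "\<lambda>u. cross u (bpow M @ (?L 0 @ ?C @ ?R 0) @ bpow M)
        (bpow M @ (?L \<rho> @ ?C @ ?R \<sigma>) @ bpow M) (bpow M @ (?L 0 @ ?C @ ?R \<sigma>) @ bpow M)
        (bpow M @ (?L \<rho> @ ?C @ ?R 0) @ bpow M)"
      have h: "?h u = of_bool (u = v)" if u: "u \<in> J" for u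
      proof -
        let ?S = "\<lambda>L R. {(l, r). u = l @ ?C @ r \<and> l \<noteq> [] \<and> r \<noteq> [] \<and> suffix l L \<and> prefix r R}"
        have len: "length u \<le> nat \<bar>\<mu> + \<sigma>\<bar>" "length u \<le> nat \<bar>\<nu> + \<rho>\<bar>" "length u \<le> nat \<bar>H\<bar>"
          "length u \<le> nat \<bar>G\<bar>" using c(2)[OF u] mu2(1) nu2(1) ij by auto
        have u0: "u \<noteq> []" "nonb (hd u)" "nonb (last u)" using trunc[OF u] by (auto simp: nonb_ends_def)
        have S2: "?S L (bpow (\<mu> + \<sigma>) @ B) = {}" for L B
        proof -
          have False if "u = l @ ?C @ r" "r \<noteq> []" "prefix r (bpow (\<mu> + \<sigma>) @ B)" for l r
            using prefix_bpow_last[OF that(2,3)] that(1,2) len(1) u0 by simp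
          then show ?thesis by blast
        qed
        have S1: "?S (A @ bpow (\<nu> + \<rho>)) R = {}" for A R
        proof -
          have False if "u = l @ ?C @ r" "l \<noteq> []" "suffix l (A @ bpow (\<nu> + \<rho>))" for l r
            using suffix_bpow_hd[OF that(2,3)] that(1,2) len(2) u0 by simp
          then show ?thesis by blast
        qed
        have S0: "?S (A @ bpow H @ s # bpow \<nu>) (bpow \<mu> @ t # bpow G @ B) =
            (if u = v then {(s # bpow \<nu>, bpow \<mu> @ [t])} else {})" for A B
        proof -
          have "l = s # bpow \<nu> \<and> r = bpow \<mu> @ [t]" if "u = l @ ?C @ r" "l \<noteq> []" "r \<noteq> []"
            "suffix l (A @ bpow H @ s # bpow \<nu>)" "prefix r (bpow \<mu> @ t # bpow G @ B)" for l r
            using suffix_syllable[OF that(2,4)] prefix_syllable[OF that(3,5)] that len u0 by auto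
          moreover have "suffix (s # bpow \<nu>) (A @ bpow H @ s # bpow \<nu>)"
            "prefix (bpow \<mu> @ [t]) (bpow \<mu> @ t # bpow G @ B)" by (auto simp: suffix_def)
          ultimately show ?thesis using v_eq by auto
        qed
        have "card (?S (bpow M @ ?L 0) (?R 0 @ bpow M)) = of_bool (u = v)"
          using S0[of "bpow M @ [a]" "a' # bpow M"] by simp
        moreover have "card (?S (bpow M @ ?L \<rho>) R) = 0" for R
          using arg_cong[OF S1[of "bpow M @ a # bpow H @ [s]" R], of card]
          by (simp only: append_assoc append_Cons append_Nil card.empty)
        moreover have "card (?S L (?R \<sigma> @ bpow M)) = 0" for L
          using arg_cong[OF S2[of L "t # bpow G @ a' # bpow M"], of card]
          by (simp only: append_assoc append_Cons append_Nil card.empty)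
        ultimately show ?thesis
          using cross_product[OF u0(1), of "bpow M @ ?L 0" ?C "?R 0 @ bpow M" "bpow M @ ?L \<rho>" "?R \<sigma> @ bpow M"]
          unfolding Let_def append_assoc by simp
      qed
      have "?h v \<noteq> 0" using h[OF v(1)] by simp
      then show "(\<Sum>u\<in>J. \<beta> u * ?h u) \<noteq> 0"
        using sum_single[of J v ?h \<beta>, OF J(1) v(1)] h v(2) by simp
    qed
  qed
  show ?thesis
  proof (rule lower_bdI[where N = "nat (2 * c) + 1" and C = "nat (2 * c)"])
    fix n L assume n: "nat (2 * c) + 1 \<le> n"
      and l: "len_le d L (\<lambda>w. \<Sum>u\<in>J. \<beta> u * real (occ u (twist_pow (int n) w)))"
    define x where "x = bpow (\<nu> - int n * e') @ z # tail (shift (- int n) z zs) @ bpow (\<mu> - int n * e)"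
    have n': "2 * c < int n" using n c(1) by linarith
    from notloc[OF n' x_def, of L] l have "int (length x) + 1 < int L" by linarith
    moreover have "\<bar>\<mu> - int n * e\<bar> \<ge> int n * of_bool (e \<noteq> 0) - \<bar>\<mu>\<bar>"
      using expR_expL_unit[of y t] by (auto simp: e_def)
    moreover have "\<bar>\<nu> - int n * e'\<bar> \<ge> int n * of_bool (e' \<noteq> 0) - \<bar>\<nu>\<bar>"
      using expR_expL_unit[of s z] by (auto simp: e'_def)
    moreover have "int (length x) = \<bar>\<nu> - int n * e'\<bar> + 1 + int (length (tail (shift (- int n) z zs))) + \<bar>\<mu> - int n * e\<bar>"
      by (simp add: x_def)
    moreover have "int (length (tail (shift (- int n) z zs))) \<ge> int n * int (shear_count z zs) - int (length (tail zs))"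
      using length_tail_shift(2)[of "- int n" z zs] by simp
    moreover have "int (shear_speed v * n) = int n * of_bool (e' \<noteq> 0) + int n * int (shear_count z zs) + int n * of_bool (e \<noteq> 0)"
      using f by (simp add: shear_speed_form[OF f(1)] algebra_simps e_def e'_def y_def)
    ultimately have "int (shear_speed v * n) \<le> int L + 2 * c" using vlen by linarith
    then show "shear_speed v * n \<le> L + nat (2 * c)" using c(1) by linarith
  qed
qed

section \<open>Lower bound from a b-left element of b-length one\<close>

text \<open>A word \<open>b\<^sup>m s\<close> crosses the border behind a long block \<open>b\<^sup>j\<close> iff the next letter is \<open>s\<close> and the signs
of the exponents agree.\<close>

lemma occ_left_1:
  assumes m: "m \<noteq> 0" and s: "nonb s" and t: "nonb t" and len: "nat \<bar>m\<bar> < nat \<bar>j\<bar>"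
  shows "occ (bpow m @ [s]) (A @ bpow j @ t # R) =
    occ (bpow m @ [s]) A + occ (bpow m @ [s]) (t # R) + of_bool (t = s \<and> m * j > 0)"
proof -
  let ?v = "bpow m @ [s]"
  have v: "?v \<noteq> []" "nonb (last ?v)" using s by simp_all
  have "set ?v - {b, linv b} \<noteq> {}" using nonbD[OF s] by auto
  then have 0: "occ ?v (bpow j) = 0" by (rule occ_bpow_0)
  have 1: "occ ?v (A @ bpow j) = occ ?v A" by (rule occ_append_bpow[OF v])
  have "{(l, r). ?v = l @ [] @ r \<and> l \<noteq> [] \<and> r \<noteq> [] \<and> suffix l (bpow j) \<and> prefix r (t # R)} =
      (if t = s \<and> m * j > 0 then {(bpow m, [s])} else {})"
  proof -
    have suf: "suffix (bpow m) (bpow j) \<longleftrightarrow> m * j > 0"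
    proof -
      have "suffix (bpow m) (bpow j) \<longleftrightarrow> bpow m = bpow (sgn j * \<bar>m\<bar>)"
        using suffix_bpow_iff[of "bpow m" j "[]"] len by simp
      also have "\<dots> \<longleftrightarrow> m = sgn j * \<bar>m\<bar>" by (metis bpow_inj)
      also have "\<dots> \<longleftrightarrow> m * j > 0" using m len by (auto simp: sgn_if zero_less_mult_iff)
      finally show ?thesis .
    qed
    have lr: "l = bpow m \<and> r = [s] \<and> t = s" if "?v = l @ r" "r \<noteq> []" "prefix r (t # R)" for l r
    proof -
      have hd: "hd r = t" using that(2,3) by (cases r) auto
      have r: "r = butlast r @ [s]" using that(1,2) by (metis append_butlast_last_id last_appendR last_snoc)
      then have "?v = (l @ butlast r) @ [s]" using that(1) by simp
      then have bp: "bpow m = l @ butlast r" by simp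
      have "butlast r = []"
      proof (rule ccontr)
        assume ne: "butlast r \<noteq> []"
        then have "hd r = hd (butlast r)" by (metis r hd_append2)
        then have "t \<in> set (bpow m)" using ne hd bp by (metis UnCI hd_in_set set_append)
        then show False using t bpow_not_nonb by blast
      qed
      then show ?thesis using r bp hd by (metis append_Nil append_Nil2 list.sel(1))
    qed
    show ?thesis
    proof (intro equalityI subsetI)
      fix p assume "p \<in> {(l, r). ?v = l @ [] @ r \<and> l \<noteq> [] \<and> r \<noteq> [] \<and> suffix l (bpow j) \<and> prefix r (t # R)}"
      then obtain l r where p: "p = (l, r)" "?v = l @ r" "r \<noteq> []" "suffix l (bpow j)" "prefix r (t # R)" by auto
      from lr[OF p(2,3,5)] have "l = bpow m" "r = [s]" "t = s" by blast+
      then show "p \<in> (if t = s \<and> m * j > 0 then {(bpow m, [s])} else {})"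
        using p(1,4) suf by simp
    qed (use m suf in \<open>auto split: if_splits\<close>)
  qed
  then have 2: "occ ?v (bpow j @ t # R) = occ ?v (t # R) + of_bool (t = s \<and> m * j > 0)"
    using occ_glue[OF v(1), of "bpow j" "[]" "t # R"] 0 by (simp add: occ_eq_0I)
  have "real (occ ?v (A @ bpow j @ t # R)) = real (occ ?v A + occ ?v (t # R) + of_bool (t = s \<and> m * j > 0))"
    using occ_sep[OF v(1), of "bpow j" A "t # R"] len by (simp add: 0 1 2)
  then show ?thesis by (simp only: of_nat_eq_iff)
qed

text \<open>For \<open>b\<^sup>m s\<close> the block in front of \<open>s\<close> is the whole of \<open>x\<close>. It is preceded by \<open>a\<close> or \<open>a\<^sup>-\<^sup>1\<close>, and it is
lengthened or not. In exactly one of the two contexts lengthening changes the sign of the image block,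
so that \<open>b\<^sup>m s\<close> is counted differently. The inverse \<open>s\<^sup>-\<^sup>1 b\<^sup>-\<^sup>m\<close> would be affected only if the preceding
letter in that context were \<open>s\<^sup>-\<^sup>1\<close>, which it is not.\<close>

lemma lower_bd_b_left_1:
  assumes d: "2 \<le> d" and J: "finite J" "J \<subseteq> F d - {[]}" and v: "v \<in> J" "\<beta> v \<noteq> 0"
    and f: "b_form v m s [] 0" "m \<noteq> 0" and single: "J \<subseteq> {v, winv v}"
  shows "lower_bd d (\<lambda>w. \<Sum>u\<in>J. \<beta> u * real (occ u w)) (shear_speed v)"
proof -
  obtain c :: int where c: "0 < c" "\<And>u. u \<in> J \<Longrightarrow> int (length u) \<le> c"
    using length_bound[OF J(1)] by blast
  have ab: "fst a \<in> {1..d}" using d by (simp add: gen_a_def)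
  have g: "nonb s" using b_form_good[OF f(1)] by simp
  have vF: "v \<in> F d" using v J by auto
  note lt = b_form_letters[OF d f(1) vF]
  have v_eq: "v = bpow m @ [s]" using f by (simp add: b_form_def)
  have vlen: "\<bar>m\<bar> + 1 \<le> c" using c(2)[OF v(1)] by (simp add: v_eq)
  have notloc: "\<not> len_le d L (\<lambda>w. \<Sum>u\<in>J. \<beta> u * real (occ u (twist_pow (int n) w)))"
    if n: "2 * c < int n" and x: "x = bpow (if s = a' then int n - c else c - int n)"
      and L: "L \<le> length x + 1" for n L x
  proof -
    define la where "la = (if s = a' then int n - c else c - int n)"
    \<comment> \<open>Twice the distance \<open>c\<close> of the critical image block from zero, so that its sign changes.\<close>
    define \<sigma> where "\<sigma> = (if s = a' then 2 * c else - 2 * c)"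
    define i1 where "i1 = la + int n + expL (int n) s"
    define i2 where "i2 = la + expL (int n) s"
    define G where "G = 2 * int n + expR (int n) s"
    have sg: "c \<le> i1" "i2 \<le> - c" "c \<le> \<bar>i1 + \<sigma>\<bar>" "c \<le> \<bar>i2 + \<sigma>\<bar>"
      "s = a' \<Longrightarrow> i1 + \<sigma> > 0" "s = a' \<Longrightarrow> i2 + \<sigma> > 0" "s \<noteq> a' \<Longrightarrow> i1 + \<sigma> < 0" "s \<noteq> a' \<Longrightarrow> i2 + \<sigma> < 0"
      and la: "la \<noteq> 0" "la + \<sigma> \<noteq> 0"
      using n c(1) by (auto simp: i1_def i2_def la_def \<sigma>_def expR_def expL_def)
    have bp: "bpow (la + \<sigma>) = bpow la @ bpow \<sigma>"
      using n c(1) by (intro bpow_add_same_sign) (auto simp: la_def \<sigma>_def)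
    have x: "x = bpow la" by (simp add: x la_def)
    let ?W1 = "\<lambda>i. [(la + i, s), (3 * int n, a')]"
    let ?W2 = "\<lambda>i. [(1, a'), (la + i, s), (3 * int n, a')]"
    let ?q = "s # bpow (3 * int n) @ [a']"
    have "la + i + int n + expL (int n) s = i1 + i" "la + i + expL (int n) s = i2 + i" for i
      by (simp_all add: i1_def i2_def)
    note ii = this
    have V: "a # tail (shift (int n) a (?W1 i)) = [a] @ bpow (i1 + i) @ s # bpow G @ [a']"
      "a # tail (shift (int n) a (?W2 i)) = [a, b, a'] @ bpow (i2 + i) @ s # bpow G @ [a']" for i
      by (simp_all add: ii bpow_1 G_def)
    show ?thesis
    proof (rule not_len_le_cores[OF V(1)[of 0] V(1)[of \<sigma>] V(2)[of 0] V(2)[of \<sigma>] d J c L, where ?p1.0 = "[a]" and ?p2.0 = "[a, b, a']"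
          and ?q1.0 = ?q and ?q2.0 = "bpow \<sigma> @ ?q"])
      show "[a] @ x @ ?q = a # tail (?W1 0)" "[a] @ x @ bpow \<sigma> @ ?q = a # tail (?W1 \<sigma>)"
        "[a, b, a'] @ x @ ?q = a # tail (?W2 0)" "[a, b, a'] @ x @ bpow \<sigma> @ ?q = a # tail (?W2 \<sigma>)"
        by (simp_all add: x bp bpow_1)
      show "red_tail a ys \<and> final a ys = a' \<and> letters_in d ys"
        if "ys \<in> {?W1 0, ?W1 \<sigma>, ?W2 0, ?W2 \<sigma>}" for ys
        using that la g ab lt n c(1) by auto
      fix M :: int
      assume M: "c \<le> M"
      let ?A1 = "bpow M @ [a]" and ?A2 = "bpow M @ [a, b, a']" and ?B = "s # bpow G @ a' # bpow M"
      let ?V = "\<lambda>p i. bpow M @ (p @ bpow i @ s # bpow G @ [a']) @ bpow M"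
      let ?h = "\<lambda>u. cross u (?V [a] (i1 + 0)) (?V [a, b, a'] (i2 + \<sigma>)) (?V [a] (i1 + \<sigma>)) (?V [a, b, a'] (i2 + 0))"
      have V': "?V p i = (bpow M @ p) @ bpow i @ ?B" for p i by simp
      have len: "nat \<bar>m\<bar> < nat \<bar>i1\<bar>" "nat \<bar>m\<bar> < nat \<bar>i2\<bar>" "nat \<bar>m\<bar> < nat \<bar>i1 + \<sigma>\<bar>" "nat \<bar>m\<bar> < nat \<bar>i2 + \<sigma>\<bar>"
        using sg vlen by auto
      have "?h v = of_bool (m * i1 > 0) + of_bool (m * (i2 + \<sigma>) > 0) - of_bool (m * (i1 + \<sigma>) > 0) - of_bool (m * i2 > 0)"
        unfolding cross_def V' v_eq using occ_left_1[OF f(2) g g len(1), of ?A1] occ_left_1[OF f(2) g g len(2), of ?A2]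
          occ_left_1[OF f(2) g g len(3), of ?A1] occ_left_1[OF f(2) g g len(4), of ?A2] by simp
      also have "\<dots> \<noteq> 0"
        using sg c(1) f(2) by (cases "0 < m"; cases "s = a'") (simp_all add: zero_less_mult_iff)
      finally have hv: "?h v \<noteq> 0" .
      \<comment> \<open>The inverse is evaluated by reading the words backwards.\<close>
      have inv: "occ (winv v) (A @ [z] @ bpow j @ ?B) = occ v (winv ?B) + occ v (linv z # winv A) + of_bool (linv z = s \<and> m * j < 0)"
        if "nonb z" "nat \<bar>m\<bar> < nat \<bar>j\<bar>" for A z j
      proof -
        have "winv (A @ [z] @ bpow j @ ?B) = winv ?B @ bpow (- j) @ linv z # winv A" by simp
        then have "occ (winv v) (A @ [z] @ bpow j @ ?B) = occ v (winv ?B @ bpow (- j) @ linv z # winv A)"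
          by (metis occ_winv winv_simps(3))
        then show ?thesis using occ_left_1[OF f(2) g, of "linv z" "- j" "winv ?B" "winv A"] that
          unfolding v_eq by simp
      qed
      have "?h (winv v) = of_bool (a' = s \<and> m * i1 < 0) + of_bool (a = s \<and> m * (i2 + \<sigma>) < 0)
          - of_bool (a' = s \<and> m * (i1 + \<sigma>) < 0) - of_bool (a = s \<and> m * i2 < 0)"
        unfolding cross_def V' using inv[of a i1 "bpow M"] inv[of a' i2 "bpow M @ [a, b]"]
          inv[of a "i1 + \<sigma>" "bpow M"] inv[of a' "i2 + \<sigma>" "bpow M @ [a, b]"] len by simp
      also have "\<dots> = 0"
        using sg c(1) by (cases "s = a'"; cases "s = a") (simp_all add: mult_less_0_iff)
      finally have hi: "?h (winv v) = 0" .
      have z: "?h u = 0" if "u \<in> J" "u \<noteq> v" for u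
      proof -
        have "u = winv v" using single that by blast
        then show ?thesis using hi by simp
      qed
      show "(\<Sum>u\<in>J. \<beta> u * ?h u) \<noteq> 0"
        using sum_single[of J v ?h \<beta>, OF J(1) v(1) z] hv v(2) by simp
    qed
  qed
  show ?thesis
  proof (rule lower_bdI[where N = "nat (2 * c) + 1" and C = "nat (2 * c)"])
    fix n L assume n: "nat (2 * c) + 1 \<le> n"
      and l: "len_le d L (\<lambda>w. \<Sum>u\<in>J. \<beta> u * real (occ u (twist_pow (int n) w)))"
    define x where "x = bpow (if s = a' then int n - c else c - int n)"
    have n': "2 * c < int n" using n c(1) by linarith
    from notloc[OF n' x_def, of L] l have "int (length x) + 1 < int L" by linarith
    moreover have "int (length x) = int n - c" using n' c(1) by (simp add: x_def)
    moreover have "shear_speed v = 1" using f by (simp add: shear_speed_form[OF f(1)])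
    ultimately show "shear_speed v * n \<le> L + nat (2 * c)" using c(1) by simp
  qed
qed

section \<open>Normal forms\<close>

lemma kind_iff:
  assumes "b_form v m s ys k"
  shows "b_truncated v \<longleftrightarrow> m = 0 \<and> k = 0" "b_left v \<longleftrightarrow> m \<noteq> 0 \<and> k = 0"
    "right_b v \<longleftrightarrow> m = 0 \<and> k \<noteq> 0" "b_and_b v \<longleftrightarrow> m \<noteq> 0 \<and> k \<noteq> 0"
  by (simp_all add: b_truncated_def b_left_def right_b_def b_and_b_def b_form_the[OF assms])

lemma normal_formD:
  assumes "normal_form d I"
  shows "finite I" "I \<subseteq> F d - {[]}" "v \<in> I \<Longrightarrow> tau_b v = [] \<Longrightarrow> v = [b]"
  using assms unfolding normal_form_def by blast+

lemma normal_form_cases: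
  assumes "normal_form d I" "v \<in> I"
  obtains "v = [b]" | m s ys k where "b_form v m s ys k"
proof -
  have "reduced v" using normal_formD(2)[OF assms(1)] assms(2) by (auto simp: F_iff)
  then show ?thesis
  proof (cases rule: b_form_cases)
    case (1 m)
    then have "v = [b]" using normal_formD(3)[OF assms] bpow_the(2) by simp
    then show ?thesis using that by blast
  qed (use that in blast)
qed

text \<open>The third condition of a normal form, read on decompositions.\<close>

lemma normal_form_opposite:
  assumes nf: "normal_form d I" and "v \<in> I" "w \<in> I"
    and v: "b_form (winv v) m s ys k" and w: "b_form w m' s ys k'"
    and kind: "m = 0 \<longleftrightarrow> m' = 0" "k = 0 \<longleftrightarrow> k' = 0"
  shows False
proof -
  have "b_form v (- k) (linv (final s ys)) (rev_tail s ys) (- m)" using b_form_winv[OF v] by simp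
  note k = kind_iff[OF this] kind_iff[OF w]
  have "opposite_kind v w" unfolding opposite_kind_def k using kind by auto
  moreover have "tau_b (winv v) = tau_b w" by (simp add: b_form_the[OF v] b_form_the[OF w])
  ultimately show False using nf assms(2,3) unfolding normal_form_def by blast
qed

lemma normal_form_same:
  assumes nf: "normal_form d I" and "v \<in> I" "w \<in> I"
    and v: "b_form v m s ys k" and w: "b_form w m' s ys k'"
    and kind: "m = 0 \<longleftrightarrow> m' = 0" "k = 0 \<longleftrightarrow> k' = 0"
  shows "v = w"
proof -
  have "one_kind v w" unfolding one_kind_def kind_iff[OF v] kind_iff[OF w] using kind by auto
  moreover have "tau_b v = tau_b w" by (simp add: b_form_the[OF v] b_form_the[OF w])
  ultimately show ?thesis using nf assms(2,3) unfolding normal_form_def by blast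
qed

text \<open>Each \<open>\<phi> v\<close> involves \<open>v\<close> and its inverse, so the uniqueness of cores is needed on the symmetric closure of
the normal form. Two elements, an element and an inverse, and two inverses are covered by conditions
(2), (3) and (2).\<close>

lemma normal_form_sym:
  assumes nf: "normal_form d I" and u: "u \<in> I \<union> winv ` I" and v: "v \<in> I \<union> winv ` I"
    and f: "b_form u m s ys k" "b_form v m' s ys k'"
    and kind: "m = 0 \<longleftrightarrow> m' = 0" "k = 0 \<longleftrightarrow> k' = 0"
  shows "u = v"
proof -
  consider "u \<in> I" "v \<in> I" | "winv u \<in> I" "v \<in> I" | "u \<in> I" "winv v \<in> I" | "winv u \<in> I" "winv v \<in> I"
    using u v by auto
  then show ?thesis
  proof cases
    case 1 then show ?thesis using normal_form_same[OF nf _ _ f kind] by blast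
  next
    case 2
    have "b_form (winv (winv u)) m s ys k" using f by simp
    then show ?thesis using normal_form_opposite[OF nf 2 _ f(2) kind] by blast
  next
    case 3
    have "b_form (winv (winv v)) m' s ys k'" using f by simp
    then show ?thesis using normal_form_opposite[OF nf 3(2,1) _ f(1)] kind by blast
  next
    case 4
    have "winv u = winv v"
      using normal_form_same[OF nf 4 b_form_winv[OF f(1)] b_form_winv[OF f(2)]] kind by simp
    then show ?thesis by simp
  qed
qed

lemma normal_form_disjoint:
  assumes nf: "normal_form d I" and "v \<in> I" "b_form v m s ys k"
  shows "winv v \<notin> I"
proof
  assume w: "winv v \<in> I"
  have "b_form (winv (winv v)) m s ys k" using assms(3) by simp
  from normal_form_opposite[OF nf w assms(2) this assms(3)] show False by simp
qed

lemma lower_bd_cases: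
  assumes d: "2 \<le> d" and J: "finite J" "J \<subseteq> F d - {[]}" and v: "v \<in> J" "\<beta> v \<noteq> 0"
    and f: "b_form v m s ys k"
    and uniq: "\<And>u m' k'. u \<in> J \<Longrightarrow> b_form u m' s ys k' \<Longrightarrow> m' = 0 \<longleftrightarrow> m = 0 \<Longrightarrow> k' = 0 \<longleftrightarrow> k = 0 \<Longrightarrow> u = v"
    and kind: "m \<noteq> 0 \<and> k \<noteq> 0 \<or>
      m \<noteq> 0 \<and> k = 0 \<and> (\<forall>u\<in>J. nonb (hd u) \<or> nonb (last u)) \<and> (ys = [] \<longrightarrow> J \<subseteq> {v, winv v}) \<or>
      m = 0 \<and> k = 0 \<and> (\<forall>u\<in>J. nonb_ends u)"
  shows "lower_bd d (\<lambda>w. \<Sum>u\<in>J. \<beta> u * real (occ u w)) (shear_speed v)"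
proof -
  consider "m \<noteq> 0" "k \<noteq> 0" | "m \<noteq> 0" "k = 0" "ys = []" "J \<subseteq> {v, winv v}"
    | "m \<noteq> 0" "k = 0" "\<forall>u\<in>J. nonb (hd u) \<or> nonb (last u)" "ys \<noteq> []"
    | "m = 0" "k = 0" "\<forall>u\<in>J. nonb_ends u" using kind by blast
  then show ?thesis
  proof cases
    case 1
    then show ?thesis using uniq by (intro lower_bd_b_and_b[where \<beta> = \<beta>, OF d J v f]) auto
  next
    case 2
    then show ?thesis using f by (intro lower_bd_b_left_1[where \<beta> = \<beta>, OF d J v]) auto
  next
    case 3
    then obtain zs \<mu> t where ys: "ys = zs @ [(\<mu>, t)]" by (metis rev_exhaust surj_pair)
    show ?thesis using 3 uniq f unfolding ys by (intro lower_bd_b_left[where \<beta> = \<beta>, OF d J v]) auto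
  next
    case 4
    show ?thesis
    proof (cases ys)
      case Nil
      then have "shear_speed v = 0" using f 4 by (simp add: shear_speed_form)
      then show ?thesis by (simp add: lower_bd_0)
    next
      case (Cons p ys')
      obtain \<nu> z where p: "p = (\<nu>, z)" by (cases p)
      show ?thesis
      proof (cases ys' rule: rev_exhaust)
        case Nil
        then show ?thesis using 4 f Cons p by (intro lower_bd_truncated_2[where \<beta> = \<beta>, OF d J v]) auto
      next
        case (snoc zs q)
        obtain \<mu> t where q: "q = (\<mu>, t)" by (cases q)
        show ?thesis using 4 f Cons p snoc q by (intro lower_bd_truncated_3[where \<beta> = \<beta>, OF d J v]) auto
      qed
    qed
  qed
qed

text \<open>The sum of the \<open>\<phi> u\<close> is a combination of the counting functions of the elements and their inverses, with
nonzero coefficients because the two sets are disjoint. A right-b element is replaced by its b-left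
inverse.\<close>

lemma lower_bd_kinds:
  assumes d: "2 \<le> d" and nf: "normal_form d I" and A: "A \<subseteq> I" "v \<in> A"
    and \<alpha>: "\<And>u. u \<in> A \<Longrightarrow> \<alpha> u \<noteq> 0"
    and shear_speed: "\<And>u. u \<in> A \<Longrightarrow> shear_speed u = r" and r: "0 < r"
    and kind: "b_and_b v \<or>
      (b_left v \<or> right_b v) \<and> (\<forall>u\<in>A. \<not> b_and_b u) \<and> (1 < b_length v \<or> A = {v}) \<or>
      (\<forall>u\<in>A. b_truncated u)"
  shows "lower_bd d (\<lambda>w. \<Sum>u\<in>A. \<alpha> u * phi u w) r"
proof -
  define J where "J = A \<union> winv ` A"
  define \<beta> where "\<beta> u = (if u \<in> A then \<alpha> u else - \<alpha> (winv u))" for u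
  have finA: "finite A" and AF: "A \<subseteq> F d - {[]}" using normal_formD(1,2)[OF nf] A finite_subset by blast+
  have J: "finite J" "J \<subseteq> F d - {[]}" using finA AF winv_in_F by (auto simp: J_def)
  have b_form: "\<exists>m s ys k. b_form u m s ys k" if u: "u \<in> A" for u
  proof -
    have "u \<in> I" using A u by blast
    show ?thesis
    proof (cases rule: normal_form_cases[OF nf \<open>u \<in> I\<close>])
      case 1
      then have "u = bpow 1" by (simp add: bpow_1)
      then show ?thesis using shear_speed[OF u] r by simp
    qed blast
  qed
  have disj: "winv u \<notin> A" if u: "u \<in> A" for u
    using b_form[OF u] normal_form_disjoint[OF nf, of u] u A by blast
  have \<beta>: "\<beta> u = \<alpha> u" "\<beta> (winv u) = - \<alpha> u" if "u \<in> A" for u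
    using that disj[OF that] by (simp_all add: \<beta>_def)
  have sum: "(\<Sum>u\<in>A. \<alpha> u * phi u w) = (\<Sum>u\<in>J. \<beta> u * real (occ u w))" for w
  proof -
    have "(\<Sum>u\<in>J. \<beta> u * real (occ u w)) =
        (\<Sum>u\<in>A. \<beta> u * real (occ u w)) + (\<Sum>u\<in>winv ` A. \<beta> u * real (occ u w))"
      unfolding J_def using finA disj by (intro sum.union_disjoint) auto
    also have "(\<Sum>u\<in>winv ` A. \<beta> u * real (occ u w)) = (\<Sum>u\<in>A. \<beta> (winv u) * real (occ (winv u) w))"
      by (subst sum.reindex) (auto simp: inj_on_def)
    finally show ?thesis
      by (simp add: \<beta> phi_def right_diff_distrib sum_subtractf sum_negf)
  qed
  obtain m s ys k where f: "b_form v m s ys k" using b_form[OF A(2)] by blast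
  have vr: "shear_speed v = r" using shear_speed A by blast
  have spdw: "shear_speed (winv v) = r" using vr shear_speed_form[OF b_form_winv[OF f]] shear_speed_form[OF f] by (simp add: rev_tail_shear_count)
  have ends: "nonb (hd u) \<or> nonb (last u)" if "u \<in> J" "\<forall>u\<in>A. \<not> b_and_b u" for u
  proof -
    have *: "nonb (hd u) \<or> nonb (last u)" if "u \<in> A" for u
    proof -
      obtain m s ys k where "b_form u m s ys k" using b_form[OF \<open>u \<in> A\<close>] by blast
      then show ?thesis using b_form_ends kind_iff(4) \<open>\<forall>u\<in>A. \<not> b_and_b u\<close> \<open>u \<in> A\<close> by blast
    qed
    show ?thesis using that(1) unfolding J_def
    proof
      assume "u \<in> winv ` A"
      then obtain u' where "u = winv u'" "u' \<in> A" by blast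
      moreover have "u' \<noteq> []" using \<open>u' \<in> A\<close> AF by auto
      ultimately show ?thesis using *[of u'] by (auto simp: hd_winv last_winv)
    qed (rule *)
  qed
  have nb: "nonb_ends u" if "u \<in> J" "\<forall>u\<in>A. b_truncated u" for u
  proof -
    have *: "nonb_ends u" if "u \<in> A" for u
    proof -
      obtain m s ys k where f: "b_form u m s ys k" using b_form[OF \<open>u \<in> A\<close>] by blast
      moreover have "u \<noteq> []" using \<open>u \<in> A\<close> AF by auto
      ultimately show ?thesis using b_form_ends[OF f] kind_iff(1)[OF f] \<open>\<forall>u\<in>A. b_truncated u\<close> \<open>u \<in> A\<close>
        by (simp add: nonb_ends_def)
    qed
    show ?thesis using that(1) unfolding J_def
    proof
      assume "u \<in> winv ` A"
      then obtain u' where "u = winv u'" "u' \<in> A" by blast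
      then show ?thesis using *[of u'] by (auto simp: nonb_ends_def hd_winv last_winv)
    qed (rule *)
  qed
  have JI: "J \<subseteq> I \<union> winv ` I" using A by (auto simp: J_def)
  have main: "lower_bd d (\<lambda>w. \<Sum>u\<in>J. \<beta> u * real (occ u w)) (shear_speed v')"
    if v': "v' \<in> J" and f': "b_form v' m' s' ys' k'" and kind': "m' \<noteq> 0 \<and> k' \<noteq> 0 \<or>
      m' \<noteq> 0 \<and> k' = 0 \<and> (\<forall>u\<in>J. nonb (hd u) \<or> nonb (last u)) \<and> (ys' = [] \<longrightarrow> J \<subseteq> {v', winv v'}) \<or>
      m' = 0 \<and> k' = 0 \<and> (\<forall>u\<in>J. nonb_ends u)" for v' m' s' ys' k'
  proof (rule lower_bd_cases[where \<beta> = \<beta>, OF d J v' _ f' _ kind'])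
    show "\<beta> v' \<noteq> 0" using v' \<alpha> \<beta> unfolding J_def by auto
    show "u = v'" if "u \<in> J" "b_form u m'' s' ys' k''" "(m'' = 0) = (m' = 0)" "(k'' = 0) = (k' = 0)" for u m'' k''
      using normal_form_sym[OF nf _ _ that(2) f' that(3,4)] that(1) v' JI by blast
  qed
  note k = kind_iff[OF f]
  have len: "b_length v = Suc (length ys)" by (rule b_form_the(3)[OF f])
  have vJ: "v \<in> J" "winv v \<in> J" using A by (simp_all add: J_def)
  have JA: "J = {v, winv v}" if "A = {v}" using that by (auto simp: J_def)
  consider "m \<noteq> 0" "k \<noteq> 0" | "m = 0" "k = 0" "\<forall>u\<in>A. b_truncated u"
    | "m \<noteq> 0" "k = 0" "\<forall>u\<in>A. \<not> b_and_b u" "ys \<noteq> [] \<or> A = {v}"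
    | "m = 0" "k \<noteq> 0" "\<forall>u\<in>A. \<not> b_and_b u" "ys \<noteq> [] \<or> A = {v}"
  proof -
    have ys: "1 < b_length v \<Longrightarrow> ys \<noteq> []" by (auto simp: len)
    from kind consider "b_and_b v" | "b_left v" "\<forall>u\<in>A. \<not> b_and_b u" "1 < b_length v \<or> A = {v}"
      | "right_b v" "\<forall>u\<in>A. \<not> b_and_b u" "1 < b_length v \<or> A = {v}" | "\<forall>u\<in>A. b_truncated u" by blast
    then show ?thesis
    proof cases
      case 1 then show ?thesis using k(4) that(1) by blast
    next
      case 2 then show ?thesis using k(2) ys that(3) by blast
    next
      case 3 then show ?thesis using k(3) ys that(4) by blast
    next
      case 4 then show ?thesis using k(1) A(2) that(2) by blast
    qed
  qed
  then have "lower_bd d (\<lambda>w. \<Sum>u\<in>J. \<beta> u * real (occ u w)) r"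
  proof cases
    case 1
    then show ?thesis using main[OF vJ(1) f] vr by simp
  next
    case 2
    then show ?thesis using main[OF vJ(1) f] vr nb by simp
  next
    case 3
    then have "\<forall>u\<in>J. nonb (hd u) \<or> nonb (last u)" "ys = [] \<longrightarrow> J \<subseteq> {v, winv v}"
      using ends JA by auto
    then show ?thesis using main[OF vJ(1) f] vr 3(1,2) by simp
  next
    case 4
    then have "\<forall>u\<in>J. nonb (hd u) \<or> nonb (last u)" "ys = [] \<longrightarrow> J \<subseteq> {winv v, winv (winv v)}"
      using ends JA by auto
    moreover have "rev_tail s ys = [] \<longleftrightarrow> ys = []" by (simp flip: length_0_conv)
    ultimately show ?thesis using main[OF vJ(2) b_form_winv[OF f]] spdw 4(1,2) by simp
  qed
  then show ?thesis by (simp only: sum)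
qed

section \<open>Speed\<close>

lemma bdd_class_cong: "(\<And>w. w \<in> F d \<Longrightarrow> f w = g w) \<Longrightarrow> bdd_class d f = bdd_class d g"
  by (auto simp: bdd_class_def bdd_equiv_def)

lemma twist_inv_iso:
  assumes "2 \<le> d" shows "twist_inv d \<in> iso (free_group d) (free_group d)"
  unfolding twist_inv_def by (rule group.iso_set_sym[OF group_free_group twist_iso[OF assms]])

lemma inv_twist_inv:
  assumes "2 \<le> d" "w \<in> F d" shows "inv_into (F d) (twist_inv d) w = twist w"
proof -
  have "bij_betw twist (F d) (F d)" using twist_iso[OF assms(1)] by (simp add: iso_def)
  then show ?thesis unfolding twist_inv_def using assms(2) by (rule inv_into_inv_into_eq)
qed

text \<open>The inverse of \<open>T\<^sup>-\<^sup>1\<close> is \<open>T\<close>, so that acting by \<open>T\<^sup>-\<^sup>n\<close> on a class means composing with \<open>T\<^sup>n\<close>.\<close>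

lemma class_act_power:
  assumes d: "2 \<le> d"
  shows "(class_act d (twist_inv d) ^^ n) (bdd_class d f) = bdd_class d (\<lambda>w. f (twist_pow (int n) w))"
proof (induction n)
  case 0
  show ?case by (auto intro!: bdd_class_cong simp: twist_pow_0 F_iff)
next
  case (Suc n)
  have "(class_act d (twist_inv d) ^^ Suc n) (bdd_class d f) =
      bdd_class d ((\<lambda>w. f (twist_pow (int n) w)) \<circ> inv_into (F d) (twist_inv d))"
    by (simp add: Suc class_act_bdd_class[OF twist_inv_iso[OF d]])
  also have "\<dots> = bdd_class d (\<lambda>w. f (twist_pow (int (Suc n)) w))"
    by (rule bdd_class_cong) (simp add: inv_twist_inv[OF d] twist_eq_twist_pow twist_pow_twist_pow add.commute)
  finally show ?case .
qed

lemma counting_norm_eq: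
  assumes "represents d \<gamma> g"
  shows "counting_norm d g = Max (insert 0 (length ` {v. \<gamma> v \<noteq> 0}))"
proof -
  have "(THE \<gamma>. represents d \<gamma> g) = \<gamma>" using assms represents_unique by blast
  then show ?thesis by (simp add: counting_norm_def Let_def)
qed

lemma class_norm_le:
  assumes "len_le d L g"
  shows "class_norm d (bdd_class d g) \<le> L"
    and "bdd_class d g \<inter> counting_space d \<noteq> {}"
proof -
  obtain \<gamma> U where U: "finite U" "U \<subseteq> F d - {[]}" "\<forall>u\<in>U. length u \<le> L"
    and B: "bdd_equiv d g (\<lambda>w. \<Sum>u\<in>U. \<gamma> u * real (occ u w))"
    using assms unfolding len_le_def by blast
  define h where "h = (\<lambda>w. \<Sum>u\<in>U. \<gamma> u * real (occ u w))"
  define \<delta> where "\<delta> u = (if u \<in> U then \<gamma> u else 0)" for u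
  have twist_subst: "{u. \<delta> u \<noteq> 0} \<subseteq> U" by (auto simp: \<delta>_def)
  have fin: "finite {u. \<delta> u \<noteq> 0}" using twist_subst U(1) by (rule finite_subset)
  have "h w = (\<Sum>u\<in>{u. \<delta> u \<noteq> 0}. \<delta> u * real (occ u w))" for w
    unfolding h_def using U(1) by (intro sum.mono_neutral_cong_right) (auto simp: \<delta>_def)
  then have rep: "represents d \<delta> h" using fin twist_subst U(2) by (auto simp: represents_def coefficients_def)
  have "counting_norm d h \<le> L"
    unfolding counting_norm_eq[OF rep] using fin twist_subst U(3) by (subst Max_le_iff) auto
  moreover have h: "h \<in> bdd_class d g \<inter> counting_space d"
    using B rep by (auto simp: bdd_class_def h_def counting_space_def)
  then have "class_norm d (bdd_class d g) \<le> counting_norm d h"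
    unfolding class_norm_def by (intro cInf_lower) auto
  ultimately show "class_norm d (bdd_class d g) \<le> L" by linarith
  show "bdd_class d g \<inter> counting_space d \<noteq> {}" using h by blast
qed

lemma len_le_class_norm:
  assumes "len_le d L g"
  shows "len_le d (class_norm d (bdd_class d g)) g"
proof -
  have "class_norm d (bdd_class d g) \<in> counting_norm d ` (bdd_class d g \<inter> counting_space d)"
    unfolding class_norm_def using class_norm_le(2)[OF assms] by (intro Inf_nat_def1) auto
  then obtain h \<gamma> where h: "bdd_equiv d g h" "represents d \<gamma> h" "class_norm d (bdd_class d g) = counting_norm d h"
    by (auto simp: bdd_class_def counting_space_def)
  have fin: "finite {v. \<gamma> v \<noteq> 0}" "{v. \<gamma> v \<noteq> 0} \<subseteq> F d - {[]}"
    using h(2) by (auto simp: represents_def coefficients_def)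
  have "length u \<le> counting_norm d h" if "\<gamma> u \<noteq> 0" for u
    unfolding counting_norm_eq[OF h(2)] using that fin by (intro Max_ge) auto
  moreover have "bdd_equiv d g (\<lambda>w. \<Sum>u\<in>{v. \<gamma> v \<noteq> 0}. \<gamma> u * real (occ u w))"
    using h(1,2) by (auto simp: bdd_equiv_def represents_def)
  ultimately show ?thesis unfolding len_le_def h(3) using fin by blast
qed

text \<open>Dividing both estimates of the norm by \<open>n\<close> squeezes the limit.\<close>

lemma speedI:
  assumes d: "2 \<le> d" and up: "upper_bd d f r" and lo: "lower_bd d f r"
  shows "speed_exists d (twist_inv d) (bdd_class d f) \<and> speed d (twist_inv d) (bdd_class d f) = real r"
proof -
  obtain C where C: "\<And>n. len_le d (r * n + C) (\<lambda>w. f (twist_pow (int n) w))" using up by (auto simp: upper_bd_def)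
  obtain D where D: "\<And>n L. n \<ge> D \<Longrightarrow> len_le d L (\<lambda>w. f (twist_pow (int n) w)) \<Longrightarrow> r * n \<le> L + D"
    using lo by (auto simp: lower_bd_def)
  define N where "N n = class_norm d (bdd_class d (\<lambda>w. f (twist_pow (int n) w)))" for n
  have N1: "N n \<le> r * n + C" for n unfolding N_def by (rule class_norm_le(1)[OF C])
  have N2: "r * n \<le> N n + D" if "n \<ge> D" for n
    unfolding N_def by (rule D[OF that len_le_class_norm[OF C]])
  have seq: "speed_seq d (twist_inv d) (bdd_class d f) = (\<lambda>n. real (N n) / real n)"
    by (simp add: speed_seq_def[abs_def] class_act_power[OF d] N_def)
  have lim: "(\<lambda>n. real (N n) / real n) \<longlonglongrightarrow> real r"
  proof (rule tendsto_sandwich)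
    show "\<forall>\<^sub>F n in sequentially. real r - real D / real n \<le> real (N n) / real n"
      using eventually_ge_at_top[of "Suc D"]
    proof eventually_elim
      fix n assume n: "Suc D \<le> n"
      then have "real (r * n) \<le> real (N n + D)" using N2 by (simp only: of_nat_le_iff)
      then have "real r \<le> (real (N n) + real D) / real n" using n by (simp add: pos_le_divide_eq)
      then show "real r - real D / real n \<le> real (N n) / real n" by (simp add: add_divide_distrib)
    qed
    show "\<forall>\<^sub>F n in sequentially. real (N n) / real n \<le> real r + real C / real n"
      using eventually_ge_at_top[of 1]
    proof eventually_elim
      fix n :: nat assume n: "1 \<le> n"
      have "real (N n) \<le> real (r * n + C)" using N1 by (simp only: of_nat_le_iff)
      then show "real (N n) / real n \<le> real r + real C / real n" using n by (simp add: field_simps)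
    qed
    have "(\<lambda>n. real D / real n) \<longlonglongrightarrow> 0" by (rule lim_const_over_n)
    from tendsto_diff[OF tendsto_const this] show "(\<lambda>n. real r - real D / real n) \<longlonglongrightarrow> real r" by simp
    have "(\<lambda>n. real C / real n) \<longlonglongrightarrow> 0" by (rule lim_const_over_n)
    from tendsto_add[OF tendsto_const this] show "(\<lambda>n. real r + real C / real n) \<longlonglongrightarrow> real r" by simp
  qed
  show ?thesis unfolding speed_exists_def speed_def seq using lim by (auto intro: convergentI limI)
qed

text \<open>A perturbation of smaller growth rate can be subtracted from a hypothetical short representative
without making it long.\<close>

lemma lower_bd_add:
  assumes lo: "lower_bd d f r" and up: "upper_bd d g r'" and "r' < r"
  shows "lower_bd d (\<lambda>w. f w + g w) r"
proof -
  obtain C where C: "\<And>n. len_le d (r' * n + C) (\<lambda>w. g (twist_pow (int n) w))" using up by (auto simp: upper_bd_def)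
  obtain D where D: "\<And>n L. n \<ge> D \<Longrightarrow> len_le d L (\<lambda>w. f (twist_pow (int n) w)) \<Longrightarrow> r * n \<le> L + D"
    using lo by (auto simp: lower_bd_def)
  show ?thesis
  proof (rule lower_bdI[where N = "C + D + 1" and C = D])
    fix n L assume n: "C + D + 1 \<le> n" and L: "len_le d L (\<lambda>w. f (twist_pow (int n) w) + g (twist_pow (int n) w))"
    define K where "K = max L (r' * n + C)"
    have "len_le d K (\<lambda>w. (f (twist_pow (int n) w) + g (twist_pow (int n) w)) - g (twist_pow (int n) w))"
      by (rule len_le_diff[OF len_le_mono[OF L] len_le_mono[OF C]]) (simp_all add: K_def)
    then have "r * n \<le> K + D" using n by (intro D) simp_all
    moreover have "r' * n + n \<le> r * n"
      using mult_le_mono1[of "Suc r'" r n] \<open>r' < r\<close> by simp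
    ultimately show "r * n \<le> L + D" using n by (auto simp: K_def max_def split: if_splits)
  qed
qed

lemma normal_form_upper_bd:
  assumes "2 \<le> d" "normal_form d I" "v \<in> I"
  shows "upper_bd d (phi v) (shear_speed v)"
proof (cases rule: normal_form_cases[OF assms(2,3)])
  case 1
  have "shear_speed [b] = 0" using shear_speed_bpow[of 1] by (simp add: bpow_1)
  then show ?thesis using upper_bd_b[OF assms(1)] 1 by simp
qed (rule upper_bd_phi_form)

lemma normal_form_lower_bd:
  assumes d: "2 \<le> d" and nf: "normal_form d I" and v: "v \<in> I"
  shows "lower_bd d (phi v) (shear_speed v)"
proof (cases "shear_speed v = 0")
  case False
  have "lower_bd d (\<lambda>w. \<Sum>u\<in>{v}. 1 * phi u w) (shear_speed v)"
  proof (rule lower_bd_kinds[OF d nf, where v = v])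
    show "b_and_b v \<or> (b_left v \<or> right_b v) \<and> (\<forall>u\<in>{v}. \<not> b_and_b u) \<and> (1 < b_length v \<or> {v} = {v}) \<or>
      (\<forall>u\<in>{v}. b_truncated u)"
    proof (cases rule: normal_form_cases[OF nf v])
      case 1
      then show ?thesis using False shear_speed_bpow[of 1] by (simp add: bpow_1)
    next
      case (2 m s ys k)
      show ?thesis using kind_iff[OF 2] by auto
    qed
  qed (use v False in auto)
  then show ?thesis by simp
qed (simp add: lower_bd_0)

theorem theorem6p26:
  fixes d :: nat and \<alpha> :: "word \<Rightarrow> real" and I A :: "word set"
    and f :: "word \<Rightarrow> real" and sp :: "word \<Rightarrow> real"
  assumes "2 \<le> d"
    and "I = {v. \<alpha> v \<noteq> 0}"
    and "I \<noteq> {}"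
    and "normal_form d I"
    and "f = (\<lambda>w. \<Sum>v\<in>I. \<alpha> v * phi v w)"
    and "sp = (\<lambda>v. speed d (twist_inv d) (bdd_class d (phi v)))"
    and "A = {v \<in> I. sp v = Max (sp ` I)}"
  shows "(\<forall>v\<in>I. speed_exists d (twist_inv d) (bdd_class d (phi v))) \<and>
    (((\<forall>v\<in>A. \<not> b_and_b v) \<longrightarrow>
        ((\<exists>v\<in>A. b_left v) \<longrightarrow> (\<exists>v\<in>A. b_left v \<and> 1 < b_length v)) \<and>
        ((\<exists>v\<in>A. right_b v) \<longrightarrow> (\<exists>v\<in>A. right_b v \<and> 1 < b_length v)))
     \<longrightarrow> speed_exists d (twist_inv d) (bdd_class d f) \<and>
         speed d (twist_inv d) (bdd_class d f) = Max (sp ` I))"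
proof -
  note d = assms(1) and nf = assms(4)
  have finI: "finite I" using normal_formD(1)[OF nf] .
  have single: "speed_exists d (twist_inv d) (bdd_class d (phi v)) \<and> sp v = real (shear_speed v)" if "v \<in> I" for v
    using speedI[OF d normal_form_upper_bd[OF d nf that] normal_form_lower_bd[OF d nf that]] assms(6) by simp
  define r where "r = Max (shear_speed ` I)"
  have r: "\<And>v. v \<in> I \<Longrightarrow> shear_speed v \<le> r" using finI by (simp add: r_def)
  have "r \<in> shear_speed ` I" unfolding r_def using finI assms(3) by (intro Max_in) auto
  then obtain v0 where v0: "v0 \<in> I" "shear_speed v0 = r" by auto
  have maxr: "Max (sp ` I) = real r"
  proof (rule Max_eqI)
    show "finite (sp ` I)" using finI by simp
    show "y \<le> real r" if "y \<in> sp ` I" for y using that single r by auto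
    show "real r \<in> sp ` I" using single[OF v0(1)] v0 by (metis imageI)
  qed
  have A: "A = {v \<in> I. shear_speed v = r}"
    unfolding assms(7) maxr using single by auto
  have up: "upper_bd d f r"
    unfolding assms(5) using finI r normal_form_upper_bd[OF d nf]
    by (intro upper_bd_sum upper_bd_scale) (auto intro: upper_bd_mono)
  have lo: "lower_bd d f r"
    if hyp: "(\<forall>v\<in>A. \<not> b_and_b v) \<longrightarrow>
        ((\<exists>v\<in>A. b_left v) \<longrightarrow> (\<exists>v\<in>A. b_left v \<and> 1 < b_length v)) \<and>
        ((\<exists>v\<in>A. right_b v) \<longrightarrow> (\<exists>v\<in>A. right_b v \<and> 1 < b_length v))"
  proof (cases "r = 0")
    case False
    have kinds_A: "b_truncated v \<or> b_left v \<or> right_b v \<or> b_and_b v" if "v \<in> A" for v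
    proof -
      have "v \<in> I" "shear_speed v \<noteq> 0" using that A False by auto
      show ?thesis
      proof (cases rule: normal_form_cases[OF nf \<open>v \<in> I\<close>])
        case 1
        then show ?thesis using \<open>shear_speed v \<noteq> 0\<close> shear_speed_bpow[of 1] by (simp add: bpow_1)
      next
        case (2 m s ys k)
        show ?thesis using kind_iff[OF 2] by auto
      qed
    qed
    obtain v where v: "v \<in> A" and kind: "b_and_b v \<or>
      (b_left v \<or> right_b v) \<and> (\<forall>u\<in>A. \<not> b_and_b u) \<and> (1 < b_length v \<or> A = {v}) \<or>
      (\<forall>u\<in>A. b_truncated u)"
    proof (cases "\<exists>v\<in>A. b_and_b v")
      case True
      then show ?thesis using that by blast
    next
      case bb: False
      show ?thesis
      proof (cases "\<exists>v\<in>A. b_left v \<or> right_b v")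
        case True
        have "\<forall>v\<in>A. \<not> b_and_b v" using bb by blast
        moreover from this hyp True obtain w where "w \<in> A" "b_left w \<or> right_b w" "1 < b_length w"
          by blast
        ultimately show ?thesis using that[of w] by blast
      next
        case False
        then have "\<forall>u\<in>A. b_truncated u" using bb kinds_A by blast
        moreover have "v0 \<in> A" using v0 A by blast
        ultimately show ?thesis using that[of v0] by blast
      qed
    qed
    have loA: "lower_bd d (\<lambda>w. \<Sum>u\<in>A. \<alpha> u * phi u w) r"
      using A assms(2) False by (intro lower_bd_kinds[OF d nf _ v _ _ _ kind]) auto
    have upR: "upper_bd d (\<lambda>w. \<Sum>u\<in>I - A. \<alpha> u * phi u w) (r - 1)"
    proof (intro upper_bd_sum upper_bd_scale)
      fix u assume u: "u \<in> I - A"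
      then have "shear_speed u \<le> r - 1" using r[of u] A by auto
      then show "upper_bd d (phi u) (r - 1)"
        using normal_form_upper_bd[OF d nf, of u] u upper_bd_mono by blast
    qed (use finI in simp)
    have "f = (\<lambda>w. (\<Sum>u\<in>A. \<alpha> u * phi u w) + (\<Sum>u\<in>I - A. \<alpha> u * phi u w))"
      unfolding assms(5) using finI A by (intro ext) (subst sum.subset_diff[of A I], auto)
    then show ?thesis using lower_bd_add[OF loA upR] False by simp
  qed (simp add: lower_bd_0)
  show ?thesis
  proof (intro conjI impI ballI)
    show "speed_exists d (twist_inv d) (bdd_class d (phi v))" if "v \<in> I" for v using single[OF that] by blast
  next
    assume hyp: "(\<forall>v\<in>A. \<not> b_and_b v) \<longrightarrow>
        ((\<exists>v\<in>A. b_left v) \<longrightarrow> (\<exists>v\<in>A. b_left v \<and> 1 < b_length v)) \<and>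
        ((\<exists>v\<in>A. right_b v) \<longrightarrow> (\<exists>v\<in>A. right_b v \<and> 1 < b_length v))"
    note s = speedI[OF d up lo[OF hyp]]
    show "speed_exists d (twist_inv d) (bdd_class d f)" using s by blast
    show "speed d (twist_inv d) (bdd_class d f) = Max (sp ` I)" using s maxr by simp
  qed
qed

end
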